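(* Let $E = (E^0, E^1, r, s)$ be a compact topological graph with no sinks, i.e. $E^0$ and $E^1$ are compact and $s$ is surjective. If $C^*(E)$ is finite, then $s$ is a homeomorphism and $r$ is surjective.
   Context: A topological graph $E=(E^0,E^1,r,s)$ consists of locally compact Hausdorff second countable spaces $E^0$ (vertices) and $E^1$ (edges) and continuous maps $r,s:E^1\to E^0$ such that $s$ is a local homeomorphism: every $e\in E^1$ has an open neighborhood $U$ such that $s(U)$ is open in $E^0$ and $s|_U:U\to s(U)$ is a homeomorphism. $E$ is compact if $E^0$ and $E^1$ are both compact. A vertex $v$ is a sink if $s^{-1}(v)=\emptyset$. The $C^*$-algebra $C^*(E)$. For $a\in C_0(E^0)$ and $\xi,\eta\in C_c(E^1)$ put $(a\xi)(e)=a(r(e))\xi(e)$, $(\xi a)(e)=\xi(e)a(s(e))$ for $e\in E^1$, and $\langle\xi,\eta\rangle(v)=\sum_{e\in s^{-1}(v)}\overline{\xi(e)}\eta(e)$ for $v\in E^0$. Completing $C_c(E^1)$ in the norm $\|\xi\|^2=\|\langle\xi,\xi\rangle\|$ gives a right Hilbert $C_0(E^0)$-module $X(E)$ with a left action $\lambda:C_0(E^0)\to\mathbb{B}(X(E))$ (a $C^*$-correspondence over $C_0(E^0)$), where $\mathbb{B}(X)$ denotes the adjointable operators on $X$. By definition $C^*(E)=\mathcal{O}(X(E))$, the Cuntz-Pimsner algebra defined as follows. Let $X$ be a $C^*$-correspondence over a $C^*$-algebra $A$ with left action $\lambda:A\to\mathbb{B}(X)$. A Toeplitz representation of $X$ on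 a $C^*$-algebra $B$ is a pair $(\pi,\tau)$, with $\pi:A\to B$ a $*$-homomorphism and $\tau:X\to B$ linear, such that $\tau(a\xi)=\pi(a)\tau(\xi)$ and $\tau(\xi)^*\tau(\eta)=\pi(\langle\xi,\eta\rangle)$ for all $a\in A$, $\xi,\eta\in X$. Let $\theta_{\xi,\eta}(\zeta)=\xi\langle\eta,\zeta\rangle$, and let $\mathbb{K}(X)\subseteq\mathbb{B}(X)$ be the closed linear span of the $\theta_{\xi,\eta}$. There is a unique $*$-homomorphism $\varphi:\mathbb{K}(X)\to B$ with $\varphi(\theta_{\xi,\eta})=\tau(\xi)\tau(\eta)^*$. Let $J_X=\lambda^{-1}(\mathbb{K}(X))\cap\{a\in A: ab=0\text{ for all }b\in\ker\lambda\}$. The representation $(\pi,\tau)$ is covariant if $\varphi(\lambda(a))=\pi(a)$ for all $a\in J_X$. $\mathcal{O}(X)$ is the universal $C^*$-algebra generated by a covariant Toeplitz representation of $X$. When $E^0$ is compact, $C^*(E)$ is unital. A unital $C^*$-algebra is finite if every isometry in it is unitary (equivalently, every left-invertible element is right-invertible). *)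

theory Defs
  imports "HOL-Analysis.Analysis"
begin

section \<open>C*-algebras\<close>

record 'a cstar =
  cs_carrier :: "'a set"
  cs_add :: "'a \<Rightarrow> 'a \<Rightarrow> 'a" (infixl "\<boxplus>\<index>" 65)
  cs_zero :: 'a ("\<zero>\<index>")
  cs_scale :: "complex \<Rightarrow> 'a \<Rightarrow> 'a" (infixr "\<odot>\<index>" 75)
  cs_mult :: "'a \<Rightarrow> 'a \<Rightarrow> 'a" (infixl "\<boxtimes>\<index>" 70)
  cs_star :: "'a \<Rightarrow> 'a"
  cs_norm :: "'a \<Rightarrow> real"

text \<open>The library locale \<open>Metric_space\<close> requires symmetry and nonnegativity off the
  carrier as well, whence the guard.\<close>

definition cs_dist :: "'a cstar \<Rightarrow> 'a \<Rightarrow> 'a \<Rightarrow> real" where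
  "cs_dist A x y =
    (if x \<in> cs_carrier A \<and> y \<in> cs_carrier A
     then cs_norm A (x \<boxplus>\<^bsub>A\<^esub> (-1) \<odot>\<^bsub>A\<^esub> y) else 0)"

locale cstar_algebra =
  fixes A :: "'a cstar" (structure)
  assumes zero_closed: "\<zero> \<in> cs_carrier A"
    and add_closed: "\<lbrakk>x \<in> cs_carrier A; y \<in> cs_carrier A\<rbrakk> \<Longrightarrow> x \<boxplus> y \<in> cs_carrier A"
    and scale_closed: "x \<in> cs_carrier A \<Longrightarrow> c \<odot> x \<in> cs_carrier A"
    and mult_closed: "\<lbrakk>x \<in> cs_carrier A; y \<in> cs_carrier A\<rbrakk> \<Longrightarrow> x \<boxtimes> y \<in> cs_carrier A"
    and star_closed: "x \<in> cs_carrier A \<Longrightarrow> cs_star A x \<in> cs_carrier A"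
    and add_assoc: "\<lbrakk>x \<in> cs_carrier A; y \<in> cs_carrier A; z \<in> cs_carrier A\<rbrakk>
      \<Longrightarrow> (x \<boxplus> y) \<boxplus> z = x \<boxplus> (y \<boxplus> z)"
    and add_commute: "\<lbrakk>x \<in> cs_carrier A; y \<in> cs_carrier A\<rbrakk> \<Longrightarrow> x \<boxplus> y = y \<boxplus> x"
    and add_zero: "x \<in> cs_carrier A \<Longrightarrow> x \<boxplus> \<zero> = x"
    and add_inverse: "x \<in> cs_carrier A \<Longrightarrow> x \<boxplus> (-1) \<odot> x = \<zero>"
    and scale_one: "x \<in> cs_carrier A \<Longrightarrow> 1 \<odot> x = x"
    and scale_scale: "x \<in> cs_carrier A \<Longrightarrow> c \<odot> d \<odot> x = (c * d) \<odot> x"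
    and scale_add_left: "x \<in> cs_carrier A \<Longrightarrow> (c + d) \<odot> x = c \<odot> x \<boxplus> d \<odot> x"
    and scale_add_right: "\<lbrakk>x \<in> cs_carrier A; y \<in> cs_carrier A\<rbrakk>
      \<Longrightarrow> c \<odot> (x \<boxplus> y) = c \<odot> x \<boxplus> c \<odot> y"
    and mult_assoc: "\<lbrakk>x \<in> cs_carrier A; y \<in> cs_carrier A; z \<in> cs_carrier A\<rbrakk>
      \<Longrightarrow> (x \<boxtimes> y) \<boxtimes> z = x \<boxtimes> (y \<boxtimes> z)"
    and distrib_left: "\<lbrakk>x \<in> cs_carrier A; y \<in> cs_carrier A; z \<in> cs_carrier A\<rbrakk>
      \<Longrightarrow> x \<boxtimes> (y \<boxplus> z) = (x \<boxtimes> y) \<boxplus> (x \<boxtimes> z)"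
    and distrib_right: "\<lbrakk>x \<in> cs_carrier A; y \<in> cs_carrier A; z \<in> cs_carrier A\<rbrakk>
      \<Longrightarrow> (x \<boxplus> y) \<boxtimes> z = (x \<boxtimes> z) \<boxplus> (y \<boxtimes> z)"
    and mult_scale_left: "\<lbrakk>x \<in> cs_carrier A; y \<in> cs_carrier A\<rbrakk>
      \<Longrightarrow> (c \<odot> x) \<boxtimes> y = c \<odot> (x \<boxtimes> y)"
    and mult_scale_right: "\<lbrakk>x \<in> cs_carrier A; y \<in> cs_carrier A\<rbrakk>
      \<Longrightarrow> x \<boxtimes> (c \<odot> y) = c \<odot> (x \<boxtimes> y)"
    and star_star: "x \<in> cs_carrier A \<Longrightarrow> cs_star A (cs_star A x) = x"
    and star_add: "\<lbrakk>x \<in> cs_carrier A; y \<in> cs_carrier A\<rbrakk>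
      \<Longrightarrow> cs_star A (x \<boxplus> y) = cs_star A x \<boxplus> cs_star A y"
    and star_scale: "x \<in> cs_carrier A \<Longrightarrow> cs_star A (c \<odot> x) = cnj c \<odot> cs_star A x"
    and star_mult: "\<lbrakk>x \<in> cs_carrier A; y \<in> cs_carrier A\<rbrakk>
      \<Longrightarrow> cs_star A (x \<boxtimes> y) = cs_star A y \<boxtimes> cs_star A x"
    and norm_nonneg: "x \<in> cs_carrier A \<Longrightarrow> 0 \<le> cs_norm A x"
    and norm_zero_iff: "x \<in> cs_carrier A \<Longrightarrow> cs_norm A x = 0 \<longleftrightarrow> x = \<zero>"
    and norm_triangle: "\<lbrakk>x \<in> cs_carrier A; y \<in> cs_carrier A\<rbrakk>
      \<Longrightarrow> cs_norm A (x \<boxplus> y) \<le> cs_norm A x + cs_norm A y"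
    and norm_scale: "x \<in> cs_carrier A \<Longrightarrow> cs_norm A (c \<odot> x) = cmod c * cs_norm A x"
    and norm_mult: "\<lbrakk>x \<in> cs_carrier A; y \<in> cs_carrier A\<rbrakk>
      \<Longrightarrow> cs_norm A (x \<boxtimes> y) \<le> cs_norm A x * cs_norm A y"
    and cstar_identity: "x \<in> cs_carrier A \<Longrightarrow> cs_norm A (cs_star A x \<boxtimes> x) = (cs_norm A x)\<^sup>2"
    and complete: "Metric_space.mcomplete (cs_carrier A) (cs_dist A)"

definition star_hom :: "'a cstar \<Rightarrow> 'b cstar \<Rightarrow> ('a \<Rightarrow> 'b) \<Rightarrow> bool" where
  "star_hom A B f \<longleftrightarrow>
     f \<in> cs_carrier A \<rightarrow> cs_carrier B \<and>
     (\<forall>x\<in>cs_carrier A. \<forall>y\<in>cs_carrier A.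
        f (x \<boxplus>\<^bsub>A\<^esub> y) = f x \<boxplus>\<^bsub>B\<^esub> f y \<and> f (x \<boxtimes>\<^bsub>A\<^esub> y) = f x \<boxtimes>\<^bsub>B\<^esub> f y) \<and>
     (\<forall>x\<in>cs_carrier A. f (cs_star A x) = cs_star B (f x) \<and>
        (\<forall>c. f (c \<odot>\<^bsub>A\<^esub> x) = c \<odot>\<^bsub>B\<^esub> f x))"

definition closed_subspace :: "'a cstar \<Rightarrow> 'a set \<Rightarrow> bool" where
  "closed_subspace A V \<longleftrightarrow>
     \<zero>\<^bsub>A\<^esub> \<in> V \<and> (\<forall>x\<in>V. \<forall>y\<in>V. x \<boxplus>\<^bsub>A\<^esub> y \<in> V) \<and> (\<forall>c. \<forall>x\<in>V. c \<odot>\<^bsub>A\<^esub> x \<in> V) \<and>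
     closedin (Metric_space.mtopology (cs_carrier A) (cs_dist A)) V"

definition closed_span :: "'a cstar \<Rightarrow> 'a set \<Rightarrow> 'a set" where
  "closed_span A S = \<Inter>{V. closed_subspace A V \<and> S \<subseteq> V}"

definition generated_cstar :: "'a cstar \<Rightarrow> 'a set \<Rightarrow> 'a set" where
  "generated_cstar A S =
     \<Inter>{V. closed_subspace A V \<and> S \<subseteq> V \<and>
          (\<forall>x\<in>V. \<forall>y\<in>V. x \<boxtimes>\<^bsub>A\<^esub> y \<in> V) \<and> (\<forall>x\<in>V. cs_star A x \<in> V)}"

text \<open>The next two notions are meant for unital algebras only.\<close>

definition cs_one :: "'a cstar \<Rightarrow> 'a" ("\<one>\<index>") where
  "cs_one A = (THE u. u \<in> cs_carrier A \<and>
     (\<forall>x\<in>cs_carrier A. u \<boxtimes>\<^bsub>A\<^esub> x = x \<and> x \<boxtimes>\<^bsub>A\<^esub> u = x))"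

definition finite_cstar :: "'a cstar \<Rightarrow> bool" where
  "finite_cstar A \<longleftrightarrow>
     (\<forall>v\<in>cs_carrier A. cs_star A v \<boxtimes>\<^bsub>A\<^esub> v = \<one>\<^bsub>A\<^esub> \<longrightarrow> v \<boxtimes>\<^bsub>A\<^esub> cs_star A v = \<one>\<^bsub>A\<^esub>)"

section \<open>C*-correspondences and Cuntz--Pimsner algebras\<close>

text \<open>The data of a C*-correspondence with elements in \<open>'x\<close> over a C*-algebra with elements
  in \<open>'a\<close>; \<open>co_inner\<close> is conjugate linear in its first argument.\<close>

record ('x, 'a) corr =
  co_carrier :: "'x set"
  co_add :: "'x \<Rightarrow> 'x \<Rightarrow> 'x"
  co_zero :: 'x
  co_scale :: "complex \<Rightarrow> 'x \<Rightarrow> 'x"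
  co_ract :: "'x \<Rightarrow> 'a \<Rightarrow> 'x"
  co_lact :: "'a \<Rightarrow> 'x \<Rightarrow> 'x"
  co_inner :: "'x \<Rightarrow> 'x \<Rightarrow> 'a"

definition co_norm :: "'a cstar \<Rightarrow> ('x, 'a) corr \<Rightarrow> 'x \<Rightarrow> real" where
  "co_norm A X \<xi> = sqrt (cs_norm A (co_inner X \<xi> \<xi>))"

text \<open>Operators are extensional functions on the carrier of \<open>X\<close>. Adjointable maps are
  automatically linear and bounded, and their adjoints are unique.\<close>

definition is_adjoint :: "('x, 'a) corr \<Rightarrow> ('x \<Rightarrow> 'x) \<Rightarrow> ('x \<Rightarrow> 'x) \<Rightarrow> bool" where
  "is_adjoint X T S \<longleftrightarrow> S \<in> co_carrier X \<rightarrow>\<^sub>E co_carrier X \<and>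
     (\<forall>\<xi>\<in>co_carrier X. \<forall>\<eta>\<in>co_carrier X. co_inner X (T \<xi>) \<eta> = co_inner X \<xi> (S \<eta>))"

definition adjointable_ops :: "'a cstar \<Rightarrow> ('x, 'a) corr \<Rightarrow> ('x \<Rightarrow> 'x) cstar" where
  "adjointable_ops A X =
    \<lparr> cs_carrier = {T \<in> co_carrier X \<rightarrow>\<^sub>E co_carrier X. \<exists>S. is_adjoint X T S},
      cs_add = (\<lambda>S T. \<lambda>\<xi>\<in>co_carrier X. co_add X (S \<xi>) (T \<xi>)),
      cs_zero = (\<lambda>\<xi>\<in>co_carrier X. co_zero X),
      cs_scale = (\<lambda>c T. \<lambda>\<xi>\<in>co_carrier X. co_scale X c (T \<xi>)),
      cs_mult = compose (co_carrier X),
      cs_star = (\<lambda>T. THE S. is_adjoint X T S),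
      cs_norm = (\<lambda>T. SUP \<xi>\<in>{\<xi>\<in>co_carrier X. co_norm A X \<xi> \<le> 1}. co_norm A X (T \<xi>)) \<rparr>"

definition rank_one :: "('x, 'a) corr \<Rightarrow> 'x \<Rightarrow> 'x \<Rightarrow> 'x \<Rightarrow> 'x" where
  "rank_one X \<xi> \<eta> = (\<lambda>\<zeta>\<in>co_carrier X. co_ract X \<xi> (co_inner X \<eta> \<zeta>))"

definition compact_ops :: "'a cstar \<Rightarrow> ('x, 'a) corr \<Rightarrow> ('x \<Rightarrow> 'x) cstar" where
  "compact_ops A X = (adjointable_ops A X)
     \<lparr> cs_carrier := closed_span (adjointable_ops A X)
         {rank_one X \<xi> \<eta> | \<xi> \<eta>. \<xi> \<in> co_carrier X \<and> \<eta> \<in> co_carrier X} \<rparr>"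

definition left_action :: "('x, 'a) corr \<Rightarrow> 'a \<Rightarrow> 'x \<Rightarrow> 'x" where
  "left_action X a = (\<lambda>\<xi>\<in>co_carrier X. co_lact X a \<xi>)"

definition covariance_ideal :: "'a cstar \<Rightarrow> ('x, 'a) corr \<Rightarrow> 'a set" where
  "covariance_ideal A X =
     {a \<in> cs_carrier A. left_action X a \<in> cs_carrier (compact_ops A X) \<and>
        (\<forall>b\<in>cs_carrier A. left_action X b = \<zero>\<^bsub>adjointable_ops A X\<^esub> \<longrightarrow> a \<boxtimes>\<^bsub>A\<^esub> b = \<zero>\<^bsub>A\<^esub>)}"

definition toeplitz_rep ::
  "'a cstar \<Rightarrow> ('x, 'a) corr \<Rightarrow> 'b cstar \<Rightarrow> ('a \<Rightarrow> 'b) \<Rightarrow> ('x \<Rightarrow> 'b) \<Rightarrow> bool" where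
  "toeplitz_rep A X B \<pi> \<tau> \<longleftrightarrow>
     star_hom A B \<pi> \<and>
     \<tau> \<in> co_carrier X \<rightarrow> cs_carrier B \<and>
     (\<forall>\<xi>\<in>co_carrier X. \<forall>\<eta>\<in>co_carrier X. \<tau> (co_add X \<xi> \<eta>) = \<tau> \<xi> \<boxplus>\<^bsub>B\<^esub> \<tau> \<eta>) \<and>
     (\<forall>c. \<forall>\<xi>\<in>co_carrier X. \<tau> (co_scale X c \<xi>) = c \<odot>\<^bsub>B\<^esub> \<tau> \<xi>) \<and>
     (\<forall>a\<in>cs_carrier A. \<forall>\<xi>\<in>co_carrier X. \<tau> (co_lact X a \<xi>) = \<pi> a \<boxtimes>\<^bsub>B\<^esub> \<tau> \<xi>) \<and>
     (\<forall>\<xi>\<in>co_carrier X. \<forall>\<eta>\<in>co_carrier X. cs_star B (\<tau> \<xi>) \<boxtimes>\<^bsub>B\<^esub> \<tau> \<eta> = \<pi> (co_inner X \<xi> \<eta>))"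

text \<open>The homomorphism \<open>\<phi>\<close> below exists and is unique for every Toeplitz representation, so
  quantifying it existentially is harmless.\<close>

definition covariant_rep ::
  "'a cstar \<Rightarrow> ('x, 'a) corr \<Rightarrow> 'b cstar \<Rightarrow> ('a \<Rightarrow> 'b) \<Rightarrow> ('x \<Rightarrow> 'b) \<Rightarrow> bool" where
  "covariant_rep A X B \<pi> \<tau> \<longleftrightarrow>
     toeplitz_rep A X B \<pi> \<tau> \<and>
     (\<exists>\<phi>. star_hom (compact_ops A X) B \<phi> \<and>
        (\<forall>\<xi>\<in>co_carrier X. \<forall>\<eta>\<in>co_carrier X. \<phi> (rank_one X \<xi> \<eta>) = \<tau> \<xi> \<boxtimes>\<^bsub>B\<^esub> cs_star B (\<tau> \<eta>)) \<and>
        (\<forall>a\<in>covariance_ideal A X. \<phi> (left_action X a) = \<pi> a))"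

text \<open>A definition cannot quantify over C*-algebras \<open>D\<close> on all types. Their elements are
  therefore drawn from one type that is large enough: if \<open>D\<close> is generated by the images of
  \<open>\<rho>\<close> and \<open>\<sigma>\<close>, each of its elements is a limit of a sequence of finite sums of finite products
  of elements \<open>\<rho> a\<close>, \<open>\<sigma> \<xi>\<close> and their adjoints (the Boolean marks an adjoint; scalars are
  absorbed into the generators), so \<open>D\<close> has an isomorphic copy on the type \<open>universe\<close>.\<close>

type_synonym ('a, 'x) universe = "nat \<Rightarrow> (('a + 'x) \<times> bool) list list"

text \<open>\<open>cuntz_pimsner A X B \<pi> \<tau>\<close>: the C*-algebra \<open>B\<close>, with \<open>(\<pi>, \<tau>)\<close>, is \<open>\<O>(X)\<close>. Uniqueness of
  \<open>\<psi>\<close> on \<open>cs_carrier B\<close> follows from generation.\<close>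

definition cuntz_pimsner ::
  "'a cstar \<Rightarrow> ('x, 'a) corr \<Rightarrow> 'b cstar \<Rightarrow> ('a \<Rightarrow> 'b) \<Rightarrow> ('x \<Rightarrow> 'b) \<Rightarrow> bool" where
  "cuntz_pimsner A X B \<pi> \<tau> \<longleftrightarrow>
     cstar_algebra B \<and> covariant_rep A X B \<pi> \<tau> \<and>
     cs_carrier B = generated_cstar B (\<pi> ` cs_carrier A \<union> \<tau> ` co_carrier X) \<and>
     (\<forall>(D :: ('a, 'x) universe cstar) \<rho> \<sigma>.
        cstar_algebra D \<and> covariant_rep A X D \<rho> \<sigma> \<longrightarrow>
        (\<exists>\<psi>. star_hom B D \<psi> \<and>
           (\<forall>a\<in>cs_carrier A. \<psi> (\<pi> a) = \<rho> a) \<and> (\<forall>\<xi>\<in>co_carrier X. \<psi> (\<tau> \<xi>) = \<sigma> \<xi>)))"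

section \<open>Topological graphs and their C*-algebras\<close>

record ('v, 'e) topgraph =
  vertices :: "'v topology"
  edges :: "'e topology"
  rng :: "'e \<Rightarrow> 'v"
  src :: "'e \<Rightarrow> 'v"

locale topological_graph =
  fixes E :: "('v, 'e) topgraph"
  assumes vertices_lc: "locally_compact_space (vertices E)"
    and vertices_t2: "Hausdorff_space (vertices E)"
    and vertices_sc: "second_countable (vertices E)"
    and edges_lc: "locally_compact_space (edges E)"
    and edges_t2: "Hausdorff_space (edges E)"
    and edges_sc: "second_countable (edges E)"
    and rng_continuous: "continuous_map (edges E) (vertices E) (rng E)"
    and src_continuous: "continuous_map (edges E) (vertices E) (src E)"
    and src_local_homeo: "e \<in> topspace (edges E) \<Longrightarrow>
      \<exists>U. openin (edges E) U \<and> e \<in> U \<and> openin (vertices E) (src E ` U) \<and>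
        homeomorphic_map (subtopology (edges E) U) (subtopology (vertices E) (src E ` U)) (src E)"

definition compact_graph :: "('v, 'e) topgraph \<Rightarrow> bool" where
  "compact_graph E \<longleftrightarrow> compact_space (vertices E) \<and> compact_space (edges E)"

definition sink :: "('v, 'e) topgraph \<Rightarrow> 'v \<Rightarrow> bool" where
  "sink E v \<longleftrightarrow> v \<in> topspace (vertices E) \<and> {e \<in> topspace (edges E). src E e = v} = {}"

text \<open>Functions on a space are represented by functions on the whole type that vanish off the
  space. The inserted \<open>0\<close> makes the supremum meaningful on the empty space.\<close>

definition sup_norm :: "'v topology \<Rightarrow> ('v \<Rightarrow> complex) \<Rightarrow> real" where
  "sup_norm T f = Sup (insert 0 ((\<lambda>v. cmod (f v)) ` topspace T))"

definition C0 :: "'v topology \<Rightarrow> ('v \<Rightarrow> complex) cstar" where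
  "C0 T =
    \<lparr> cs_carrier = {f. continuous_map T euclidean f \<and> (\<forall>v. v \<notin> topspace T \<longrightarrow> f v = 0) \<and>
        (\<forall>\<epsilon>>0. compactin T {v \<in> topspace T. \<epsilon> \<le> cmod (f v)})},
      cs_add = (\<lambda>f g v. f v + g v),
      cs_zero = (\<lambda>v. 0),
      cs_scale = (\<lambda>c f v. c * f v),
      cs_mult = (\<lambda>f g v. f v * g v),
      cs_star = (\<lambda>f v. cnj (f v)),
      cs_norm = sup_norm T \<rparr>"

definition Cc :: "'e topology \<Rightarrow> ('e \<Rightarrow> complex) set" where
  "Cc T = {\<xi>. continuous_map T euclidean \<xi> \<and> (\<forall>e. e \<notin> topspace T \<longrightarrow> \<xi> e = 0) \<and>
     compactin T (T closure_of {e \<in> topspace T. \<xi> e \<noteq> 0})}"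

text \<open>Fibres of \<open>src E\<close> may be infinite when \<open>E\<close> is not compact, but compactly supported
  functions vanish at all but finitely many points of a fibre.\<close>

definition edge_inner ::
  "('v, 'e) topgraph \<Rightarrow> ('e \<Rightarrow> complex) \<Rightarrow> ('e \<Rightarrow> complex) \<Rightarrow> 'v \<Rightarrow> complex" where
  "edge_inner E \<xi> \<eta> v =
     (if v \<in> topspace (vertices E)
      then \<Sum>\<^sub>\<infinity>e\<in>{e \<in> topspace (edges E). src E e = v}. cnj (\<xi> e) * \<eta> e else 0)"

definition edge_norm :: "('v, 'e) topgraph \<Rightarrow> ('e \<Rightarrow> complex) \<Rightarrow> real" where
  "edge_norm E \<xi> = sqrt (sup_norm (vertices E) (edge_inner E \<xi> \<xi>))"

definition edge_dist :: "('v, 'e) topgraph \<Rightarrow> ('e \<Rightarrow> complex) \<Rightarrow> ('e \<Rightarrow> complex) \<Rightarrow> real" where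
  "edge_dist E \<xi> \<eta> =
     (if \<xi> \<in> Cc (edges E) \<and> \<eta> \<in> Cc (edges E) then edge_norm E (\<lambda>e. \<xi> e - \<eta> e) else 0)"

text \<open>\<open>X(E)\<close> is the completion of \<open>C\<^sub>c(E\<^sup>1)\<close>, realised as the set of classes of Cauchy sequences
  modulo sequences tending to 0, with operations computed on representatives.\<close>

definition edge_cauchy :: "('v, 'e) topgraph \<Rightarrow> (nat \<Rightarrow> 'e \<Rightarrow> complex) set" where
  "edge_cauchy E = {s. Metric_space.MCauchy (Cc (edges E)) (edge_dist E) s}"

definition edge_class ::
  "('v, 'e) topgraph \<Rightarrow> (nat \<Rightarrow> 'e \<Rightarrow> complex) \<Rightarrow> (nat \<Rightarrow> 'e \<Rightarrow> complex) set" where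
  "edge_class E s = {t \<in> edge_cauchy E. (\<lambda>n. edge_dist E (s n) (t n)) \<longlonglongrightarrow> 0}"

definition some_rep :: "'c set \<Rightarrow> 'c" where
  "some_rep P = (SOME s. s \<in> P)"

definition graph_corr ::
  "('v, 'e) topgraph \<Rightarrow> ((nat \<Rightarrow> 'e \<Rightarrow> complex) set, 'v \<Rightarrow> complex) corr" where
  "graph_corr E =
    \<lparr> co_carrier = edge_class E ` edge_cauchy E,
      co_add = (\<lambda>P Q. edge_class E (\<lambda>n e. some_rep P n e + some_rep Q n e)),
      co_zero = edge_class E (\<lambda>n e. 0),
      co_scale = (\<lambda>c P. edge_class E (\<lambda>n e. c * some_rep P n e)),
      co_ract = (\<lambda>P a. edge_class E (\<lambda>n e. some_rep P n e * a (src E e))),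
      co_lact = (\<lambda>a P. edge_class E (\<lambda>n e. a (rng E e) * some_rep P n e)),
      co_inner = (\<lambda>P Q v. lim (\<lambda>n. edge_inner E (some_rep P n) (some_rep Q n) v)) \<rparr>"

definition graph_cstar ::
  "('v, 'e) topgraph \<Rightarrow> 'b cstar \<Rightarrow> (('v \<Rightarrow> complex) \<Rightarrow> 'b) \<Rightarrow>
     ((nat \<Rightarrow> 'e \<Rightarrow> complex) set \<Rightarrow> 'b) \<Rightarrow> bool" where
  "graph_cstar E B \<pi> \<tau> \<longleftrightarrow> cuntz_pimsner (C0 (vertices E)) (graph_corr E) B \<pi> \<tau>"

end

(*
  A function xi on the edges that is constant on the fibres of s and has <xi,xi> = 1 gives an
  isometry S = tau(xi). If C*(E) is finite then S S* = 1, so tau(f)* tau(g) = tau(f)* S S* tau(g),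
  that is, pi(<f,g>) = pi(<f,xi> <xi,g>), for all f and g; taking for f and g bump functions at two
  edges with the same source shows that s is injective. Moreover, if a vanishes on the image of r,
  then pi(a) = pi(a) S S* = tau(a xi) S* = 0.

  Both arguments need pi to be injective. For this, C0(E^0) and X(E) are represented on the l2-space
  of a countable set of boundary paths through a given vertex (paths that are infinite or end at a
  vertex outside the image of r). A finite frame u_k of X(E) makes every adjointable operator T
  compact, T = sum_k theta_{T u_k, u_k}, which yields the homomorphism on K(X(E)) required for
  covariance.
*)

theory Submission
  imports Defs
begin

section \<open>Units in C*-algebras\<close>

text \<open>The obstacle to injectivity of \<open>\<pi>\<close> is that \<open>cuntz_pimsner\<close>
  describes B only through generation and through maps into algebras on the one type
  \<open>universe\<close>. Concrete operators must therefore be carried over to that type by an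
  injective code, and a matrix indexed by naturals can be coded there. This is why the index set is
  countable and why one vertex v is treated at a time: the orbit of a single boundary path with
  range v under removing and prepending edges is countable, since the fibres of s are finite.
  Maximality of the paths is dictated by covariance. The frame sum of the operators \<sigma>(u_k)
  times their adjoints is the projection onto paths of positive length, and it has to act as a unit
  on the image of J_X. A path of length 0 does no harm if its vertex lies outside r(E^1), because
  functions in J_X vanish there. Compactness makes the module norm equivalent to the uniform norm,
  so the completion X(E) adds nothing to the continuous functions on E^1. The unit of B is not part
  of the data: it is shown to be \<pi>(1), where the action on the right of \<tau>(f) is settled by
  the C*-identity.\<close>

context cstar_algebra
begin

abbreviation diff :: "'a \<Rightarrow> 'a \<Rightarrow> 'a" (infixl "\<boxminus>" 65) where
  "x \<boxminus> y \<equiv> x \<boxplus> (-1) \<odot> y"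

lemmas closed = zero_closed add_closed scale_closed mult_closed star_closed

lemma zero_add: "x \<in> cs_carrier A \<Longrightarrow> \<zero> \<boxplus> x = x"
  by (simp add: add_commute add_zero closed)

lemma zero_scale: "x \<in> cs_carrier A \<Longrightarrow> 0 \<odot> x = \<zero>"
  using scale_add_left[of x 1 "-1"] by (simp add: scale_one add_inverse)

lemma eq_iff_diff_zero:
  assumes "x \<in> cs_carrier A" "y \<in> cs_carrier A"
  shows "x \<boxminus> y = \<zero> \<longleftrightarrow> x = y"
proof
  assume "x \<boxminus> y = \<zero>"
  then have "x \<boxplus> ((-1) \<odot> y \<boxplus> y) = y"
    using assms by (simp add: closed zero_add flip: add_assoc)
  then show "x = y"
    using assms by (simp add: closed add_commute[of "(-1) \<odot> y"] add_inverse add_zero)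
qed (use assms in \<open>simp add: add_inverse\<close>)

lemma diff_add_diff:
  assumes "x \<in> cs_carrier A" "y \<in> cs_carrier A" "z \<in> cs_carrier A"
  shows "(x \<boxminus> y) \<boxplus> (y \<boxminus> z) = x \<boxminus> z"
proof -
  have "(x \<boxminus> y) \<boxplus> (y \<boxminus> z) = x \<boxplus> (((-1) \<odot> y \<boxplus> y) \<boxminus> z)"
    using assms by (simp add: closed add_assoc)
  then show ?thesis
    using assms by (simp add: closed add_commute[of "(-1) \<odot> y"] add_inverse zero_add)
qed

lemma diff_swap: "x \<in> cs_carrier A \<Longrightarrow> y \<in> cs_carrier A \<Longrightarrow> (-1) \<odot> (x \<boxminus> y) = y \<boxminus> x"
  by (simp add: closed scale_add_right scale_scale scale_one add_commute)

lemma mult_diff: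
  assumes "x \<in> cs_carrier A" "y \<in> cs_carrier A" "z \<in> cs_carrier A"
  shows "x \<boxtimes> (y \<boxminus> z) = x \<boxtimes> y \<boxminus> x \<boxtimes> z" "(y \<boxminus> z) \<boxtimes> x = y \<boxtimes> x \<boxminus> z \<boxtimes> x"
  using assms by (simp_all add: closed distrib_left distrib_right mult_scale_left mult_scale_right)

lemma star_mult_self_eq_zero: "x \<in> cs_carrier A \<Longrightarrow> cs_star A x \<boxtimes> x = \<zero> \<Longrightarrow> x = \<zero>"
  using cstar_identity[of x] norm_zero_iff[of x] norm_zero_iff[of "\<zero>"] by (simp add: closed)

lemma cs_dist_eq:
  "x \<in> cs_carrier A \<Longrightarrow> y \<in> cs_carrier A \<Longrightarrow> cs_dist A x y = cs_norm A (x \<boxminus> y)"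
  by (simp add: cs_dist_def)

lemma norm_diff_commute:
  "x \<in> cs_carrier A \<Longrightarrow> y \<in> cs_carrier A \<Longrightarrow> cs_norm A (x \<boxminus> y) = cs_norm A (y \<boxminus> x)"
  using norm_scale[of "y \<boxminus> x" "-1"] by (simp add: closed diff_swap)

lemma Metric_space_cs_dist: "Metric_space (cs_carrier A) (cs_dist A)"
proof
  show "0 \<le> cs_dist A x y" for x y
    by (simp add: cs_dist_def norm_nonneg closed)
  show "cs_dist A x y = cs_dist A y x" for x y
    by (simp add: cs_dist_def norm_diff_commute)
  show "cs_dist A x y = 0 \<longleftrightarrow> x = y" if "x \<in> cs_carrier A" "y \<in> cs_carrier A" for x y
    using that by (simp add: cs_dist_eq norm_zero_iff closed eq_iff_diff_zero)
  show "cs_dist A x z \<le> cs_dist A x y + cs_dist A y z"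
    if "x \<in> cs_carrier A" "y \<in> cs_carrier A" "z \<in> cs_carrier A" for x y z
    using that norm_triangle[of "x \<boxminus> y" "y \<boxminus> z"] by (simp add: cs_dist_eq closed diff_add_diff)
qed

text \<open>A self-adjoint idempotent acting as a unit on \<open>x\<^sup>* x\<close> is a right unit for \<open>x\<close>, because
  \<open>y = x u - x\<close> has \<open>y\<^sup>* y = 0\<close>.\<close>

lemma right_unit_from_square:
  assumes u: "u \<in> cs_carrier A" "cs_star A u = u" and x: "x \<in> cs_carrier A"
    and left: "u \<boxtimes> (cs_star A x \<boxtimes> x) = cs_star A x \<boxtimes> x"
    and right: "(cs_star A x \<boxtimes> x) \<boxtimes> u = cs_star A x \<boxtimes> x"
  shows "x \<boxtimes> u = x"
proof -
  define y where "y = x \<boxtimes> u \<boxminus> x"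
  have y: "y \<in> cs_carrier A" using u x by (simp add: y_def closed)
  have "cs_star A y = u \<boxtimes> cs_star A x \<boxminus> cs_star A x"
    using u x by (simp add: y_def closed star_add star_mult star_scale)
  then have "cs_star A y \<boxtimes> y =
      ((u \<boxtimes> cs_star A x) \<boxtimes> (x \<boxtimes> u) \<boxminus> cs_star A x \<boxtimes> (x \<boxtimes> u)) \<boxminus>
      ((u \<boxtimes> cs_star A x) \<boxtimes> x \<boxminus> cs_star A x \<boxtimes> x)"
    using u x by (simp add: y_def closed mult_diff)
  also have "(u \<boxtimes> cs_star A x) \<boxtimes> (x \<boxtimes> u) = cs_star A x \<boxtimes> x"
    using u x left right by (metis closed(4,5) mult_assoc)
  also have "(u \<boxtimes> cs_star A x) \<boxtimes> x = cs_star A x \<boxtimes> x"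
    using u x left by (simp add: closed mult_assoc)
  also have "cs_star A x \<boxtimes> (x \<boxtimes> u) = cs_star A x \<boxtimes> x"
    using u x right by (simp add: closed mult_assoc)
  finally have "cs_star A y \<boxtimes> y = \<zero>"
    using x by (simp add: closed add_inverse)
  then have "y = \<zero>" using y by (rule star_mult_self_eq_zero[rotated])
  then show ?thesis using u x by (simp add: y_def closed eq_iff_diff_zero)
qed

text \<open>Closedness comes from boundedness: if the \<open>\<sigma> n\<close> are fixed and tend
  to \<open>l\<close>, then \<open>f l - l = f (l - \<sigma> n) + (\<sigma> n - l)\<close> has norm
  at most \<open>C + 1\<close> times the distance. It is meant for left and right multiplication by
  a candidate unit.\<close>

lemma closed_subspace_fixed:
  assumes f: "f \<in> cs_carrier A \<rightarrow> cs_carrier A"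
    and add: "\<And>x y. x \<in> cs_carrier A \<Longrightarrow> y \<in> cs_carrier A \<Longrightarrow> f (x \<boxplus> y) = f x \<boxplus> f y"
    and scale: "\<And>c x. x \<in> cs_carrier A \<Longrightarrow> f (c \<odot> x) = c \<odot> f x"
    and bounded: "\<And>x. x \<in> cs_carrier A \<Longrightarrow> cs_norm A (f x) \<le> C * cs_norm A x"
  shows "closed_subspace A {x \<in> cs_carrier A. f x = x}"
proof -
  interpret Metric_space "cs_carrier A" "cs_dist A" by (rule Metric_space_cs_dist)
  have f_closed: "f x \<in> cs_carrier A" if "x \<in> cs_carrier A" for x using f that by auto
  have diff: "f (x \<boxminus> y) = f x \<boxminus> f y" if "x \<in> cs_carrier A" "y \<in> cs_carrier A" for x y
    using that by (simp add: add scale closed)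
  have "f \<zero> = \<zero>" using scale[of \<zero> 0] zero_closed f_closed by (simp add: zero_scale)
  moreover have "closedin mtopology {x \<in> cs_carrier A. f x = x}"
    unfolding metric_closedin_iff_sequentially_closed
  proof (intro conjI allI impI)
    fix \<sigma> l assume *: "range \<sigma> \<subseteq> {x \<in> cs_carrier A. f x = x} \<and> limitin mtopology \<sigma> l sequentially"
    then have \<sigma>: "\<sigma> n \<in> cs_carrier A" "f (\<sigma> n) = \<sigma> n" for n by auto
    have l: "l \<in> cs_carrier A" and lim: "(\<lambda>n. cs_dist A (\<sigma> n) l) \<longlonglongrightarrow> 0"
      using * by (auto simp: limitin_metric_dist_null)
    have "cs_norm A (f l \<boxminus> l) \<le> (C + 1) * cs_dist A (\<sigma> n) l" for n
    proof -
      have "f l \<boxminus> l = f (l \<boxminus> \<sigma> n) \<boxplus> (\<sigma> n \<boxminus> l)"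
        using diff[of l "\<sigma> n"] diff_add_diff[of "f l" "\<sigma> n" l] \<sigma> l f_closed by simp
      then have "cs_norm A (f l \<boxminus> l) \<le> cs_norm A (f (l \<boxminus> \<sigma> n)) + cs_norm A (\<sigma> n \<boxminus> l)"
        using \<sigma> l f_closed by (simp add: norm_triangle closed)
      also have "cs_norm A (f (l \<boxminus> \<sigma> n)) \<le> C * cs_norm A (l \<boxminus> \<sigma> n)"
        using \<sigma> l by (intro bounded closed)
      finally show ?thesis
        using \<sigma> l by (simp add: cs_dist_eq norm_diff_commute[of l] algebra_simps)
    qed
    moreover have "(\<lambda>n. (C + 1) * cs_dist A (\<sigma> n) l) \<longlonglongrightarrow> (C + 1) * 0"
      by (intro tendsto_intros lim)
    ultimately have "cs_norm A (f l \<boxminus> l) \<le> (C + 1) * 0"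
      by (intro tendsto_lowerbound[OF _ _ sequentially_bot]) auto
    then have "f l \<boxminus> l = \<zero>"
      using l f_closed norm_nonneg[of "f l \<boxminus> l"] by (simp add: norm_zero_iff[symmetric] closed)
    then show "l \<in> {x \<in> cs_carrier A. f x = x}"
      using l f_closed by (simp add: eq_iff_diff_zero)
  qed auto
  ultimately show ?thesis
    by (auto simp: closed_subspace_def add scale closed)
qed

lemma closed_subspace_Int:
  "closed_subspace A V \<Longrightarrow> closed_subspace A W \<Longrightarrow> closed_subspace A (V \<inter> W)"
  by (auto simp: closed_subspace_def)

text \<open>The elements on which \<open>u\<close> is a two-sided unit form a closed subspace that
  is stable under products and under adjoints, the latter because \<open>u\<close> is self-adjoint
  and the adjoint exchanges the two conditions. Hence it suffices to test generators.\<close>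

lemma cs_one_eqI:
  assumes gen: "cs_carrier A = generated_cstar A S" and S: "S \<subseteq> cs_carrier A"
    and u: "u \<in> cs_carrier A" "cs_star A u = u"
    and unit: "\<And>x. x \<in> S \<Longrightarrow> u \<boxtimes> x = x" "\<And>x. x \<in> S \<Longrightarrow> x \<boxtimes> u = x"
  shows "cs_one A = u" "\<And>x. x \<in> cs_carrier A \<Longrightarrow> u \<boxtimes> x = x" "\<And>x. x \<in> cs_carrier A \<Longrightarrow> x \<boxtimes> u = x"
proof -
  define V where "V = {x \<in> cs_carrier A. u \<boxtimes> x = x} \<inter> {x \<in> cs_carrier A. x \<boxtimes> u = x}"
  have "closed_subspace A V"
    unfolding V_def
  proof (intro closed_subspace_Int closed_subspace_fixed[where C = "cs_norm A u"])
    show "cs_norm A (x \<boxtimes> u) \<le> cs_norm A u * cs_norm A x" if "x \<in> cs_carrier A" for x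
      using norm_mult[OF that u(1)] by (simp add: mult.commute)
  qed (use u in \<open>simp_all add: closed norm_mult distrib_left distrib_right mult_scale_left
        mult_scale_right Pi_iff\<close>)
  moreover have "S \<subseteq> V" using S unit by (auto simp: V_def)
  moreover have "x \<boxtimes> y \<in> V" if "x \<in> V" "y \<in> V" for x y
    using that u by (simp add: V_def closed mult_assoc) (simp flip: mult_assoc)
  moreover have "cs_star A x \<in> V" if "x \<in> V" for x
    using that u star_mult[of u x] star_mult[of x u] by (simp add: V_def closed)
  ultimately have "generated_cstar A S \<subseteq> V"
    unfolding generated_cstar_def by (intro Inter_lower) simp
  then have V: "u \<boxtimes> x = x" "x \<boxtimes> u = x" if "x \<in> cs_carrier A" for x
    using that gen by (auto simp: V_def)
  show "cs_one A = u"
    unfolding cs_one_def by (rule the_equality) (use V u in auto)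
  show "\<And>x. x \<in> cs_carrier A \<Longrightarrow> u \<boxtimes> x = x" "\<And>x. x \<in> cs_carrier A \<Longrightarrow> x \<boxtimes> u = x"
    using V by auto
qed

end

section \<open>The Hilbert space of square summable families\<close>

typedef 'i ell2 = "{x :: 'i \<Rightarrow> complex. (\<lambda>i. (cmod (x i))\<^sup>2) summable_on UNIV}"
  morphisms ell2_nth Abs_ell2
  by (rule exI[of _ "\<lambda>_. 0"]) simp

setup_lifting type_definition_ell2

lemma square_summable_add:
  fixes x y :: "'i \<Rightarrow> complex"
  assumes "(\<lambda>i. (cmod (x i))\<^sup>2) summable_on A" "(\<lambda>i. (cmod (y i))\<^sup>2) summable_on A"
  shows "(\<lambda>i. (cmod (x i + y i))\<^sup>2) summable_on A"
proof (rule summable_on_comparison_test)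
  show "(\<lambda>i. 2 * (cmod (x i))\<^sup>2 + 2 * (cmod (y i))\<^sup>2) summable_on A"
    using assms by (intro summable_on_add summable_on_cmult_right)
  fix i
  have "(cmod (x i + y i))\<^sup>2 \<le> (cmod (x i) + cmod (y i))\<^sup>2"
    by (simp add: norm_triangle_ineq)
  also have "\<dots> \<le> 2 * (cmod (x i))\<^sup>2 + 2 * (cmod (y i))\<^sup>2"
    using sum_squares_bound[of "cmod (x i)" "cmod (y i)"] by (simp add: power2_sum)
  finally show "(cmod (x i + y i))\<^sup>2 \<le> 2 * (cmod (x i))\<^sup>2 + 2 * (cmod (y i))\<^sup>2" .
qed simp

lemma square_summable_inner:
  fixes x y :: "'i \<Rightarrow> complex"
  assumes "(\<lambda>i. (cmod (x i))\<^sup>2) summable_on A" "(\<lambda>i. (cmod (y i))\<^sup>2) summable_on A"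
  shows "(\<lambda>i. cmod (x i) * cmod (y i)) summable_on A" "(\<lambda>i. inner (x i) (y i)) summable_on A"
proof -
  show *: "(\<lambda>i. cmod (x i) * cmod (y i)) summable_on A"
  proof (rule summable_on_comparison_test)
    show "(\<lambda>i. (cmod (x i))\<^sup>2 + (cmod (y i))\<^sup>2) summable_on A"
      using assms by (intro summable_on_add)
    show "cmod (x i) * cmod (y i) \<le> (cmod (x i))\<^sup>2 + (cmod (y i))\<^sup>2" for i
      using sum_squares_bound[of "cmod (x i)" "cmod (y i)"]
        mult_nonneg_nonneg[OF norm_ge_zero[of "x i"] norm_ge_zero[of "y i"]] by linarith
  qed simp
  have "(\<lambda>i. norm (inner (x i) (y i))) summable_on A"
    by (rule Infinite_Sum.abs_summable_on_comparison_test'[OF *]) (simp add: Cauchy_Schwarz_ineq2)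
  then show "(\<lambda>i. inner (x i) (y i)) summable_on A"
    using summable_on_iff_abs_summable_on_real by blast
qed

lemma square_summable_ell2: "(\<lambda>i. (cmod (ell2_nth x i))\<^sup>2) summable_on UNIV"
  using ell2_nth by auto

instantiation ell2 :: (type) real_inner
begin

lift_definition zero_ell2 :: "'a ell2" is "\<lambda>_. 0"
  by simp

lift_definition plus_ell2 :: "'a ell2 \<Rightarrow> 'a ell2 \<Rightarrow> 'a ell2" is "\<lambda>x y i. x i + y i"
  by (rule square_summable_add)

lift_definition uminus_ell2 :: "'a ell2 \<Rightarrow> 'a ell2" is "\<lambda>x i. - x i"
  by simp

lift_definition minus_ell2 :: "'a ell2 \<Rightarrow> 'a ell2 \<Rightarrow> 'a ell2" is "\<lambda>x y i. x i - y i"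
  using square_summable_add[where y = "\<lambda>i. - y i" for y] by force

lift_definition scaleR_ell2 :: "real \<Rightarrow> 'a ell2 \<Rightarrow> 'a ell2" is "\<lambda>r x i. r *\<^sub>R x i"
  by (simp add: power_mult_distrib summable_on_cmult_right)

definition inner_ell2 :: "'a ell2 \<Rightarrow> 'a ell2 \<Rightarrow> real" where
  "inner_ell2 x y = (\<Sum>\<^sub>\<infinity>i. inner (ell2_nth x i) (ell2_nth y i))"

definition norm_ell2 :: "'a ell2 \<Rightarrow> real" where
  "norm_ell2 x = sqrt (inner x x)"

definition dist_ell2 :: "'a ell2 \<Rightarrow> 'a ell2 \<Rightarrow> real" where
  "dist_ell2 x y = norm (x - y)"

definition sgn_ell2 :: "'a ell2 \<Rightarrow> 'a ell2" where
  "sgn_ell2 x = inverse (norm x) *\<^sub>R x"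

definition uniformity_ell2 :: "('a ell2 \<times> 'a ell2) filter" where
  "uniformity_ell2 = (INF e\<in>{0 <..}. principal {(x, y). dist x y < e})"

definition open_ell2 :: "'a ell2 set \<Rightarrow> bool" where
  "open_ell2 U = (\<forall>x\<in>U. \<forall>\<^sub>F (x', y) in uniformity. x' = x \<longrightarrow> y \<in> U)"

instance
proof
  fix x y z :: "'a ell2" and r s :: real
  have summable: "(\<lambda>i. inner (ell2_nth u i) (ell2_nth v i)) summable_on UNIV" for u v :: "'a ell2"
    by (intro square_summable_inner square_summable_ell2)
  show "x + y + z = x + (y + z)" by transfer (simp add: algebra_simps)
  show "x + y = y + x" by transfer (simp add: algebra_simps)
  show "0 + x = x" by transfer simp
  show "- x + x = 0" by transfer simp
  show "x - y = x + - y" by transfer simp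
  show "r *\<^sub>R (x + y) = r *\<^sub>R x + r *\<^sub>R y" by transfer (simp add: algebra_simps)
  show "(r + s) *\<^sub>R x = r *\<^sub>R x + s *\<^sub>R x" by transfer (simp add: algebra_simps)
  show "r *\<^sub>R s *\<^sub>R x = (r * s) *\<^sub>R x" by transfer (simp add: algebra_simps)
  show "1 *\<^sub>R x = x" by transfer simp
  show "inner x y = inner y x" by (simp add: inner_ell2_def inner_commute)
  show "inner (x + y) z = inner x z + inner y z"
    unfolding inner_ell2_def by (simp add: plus_ell2.rep_eq inner_add_left infsum_add summable)
  show "inner (r *\<^sub>R x) y = r * inner x y"
    unfolding inner_ell2_def by (simp add: scaleR_ell2.rep_eq infsum_cmult_right')
  show "0 \<le> inner x x"
    unfolding inner_ell2_def by (rule infsum_nonneg) simp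
  show "inner x x = 0 \<longleftrightarrow> x = 0"
  proof
    assume "inner x x = 0"
    then have "inner (ell2_nth x i) (ell2_nth x i) = 0" for i
      using nonneg_infsum_le_0D[OF _ summable[of x x], of i] by (simp add: inner_ell2_def)
    then have "ell2_nth x i = 0" for i by simp
    then show "x = 0"
      by (auto simp: zero_ell2.rep_eq simp flip: ell2_nth_inject)
  qed (simp add: inner_ell2_def zero_ell2.rep_eq)
qed (simp_all add: norm_ell2_def dist_ell2_def sgn_ell2_def uniformity_ell2_def open_ell2_def)

end

lemma ell2_eqI: "(\<And>i. ell2_nth x i = ell2_nth y i) \<Longrightarrow> x = y"
  by (auto simp flip: ell2_nth_inject)

lemma norm_ell2_square: "(norm x)\<^sup>2 = (\<Sum>\<^sub>\<infinity>i. (cmod (ell2_nth x i))\<^sup>2)"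
  unfolding power2_norm_eq_inner inner_ell2_def by simp

lemma finite_sum_le_norm_ell2: "finite F \<Longrightarrow> (\<Sum>i\<in>F. (cmod (ell2_nth x i))\<^sup>2) \<le> (norm x)\<^sup>2"
  unfolding norm_ell2_square by (rule finite_sum_le_infsum[OF square_summable_ell2]) simp_all

lemma norm_ell2_nth_le: "cmod (ell2_nth x i) \<le> norm x"
  using finite_sum_le_norm_ell2[of "{i}" x] by (auto intro: power2_le_imp_le)

lemma norm_ell2_leI:
  assumes "0 \<le> c" "\<And>F. finite F \<Longrightarrow> (\<Sum>i\<in>F. (cmod (ell2_nth x i))\<^sup>2) \<le> c\<^sup>2"
  shows "norm x \<le> c"
proof -
  have "(norm x)\<^sup>2 \<le> c\<^sup>2"
    unfolding norm_ell2_square by (rule infsum_le_finite_sums) (use assms square_summable_ell2 in auto)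
  then show ?thesis using assms(1) by (rule power2_le_imp_le)
qed

lemma ell2_exists:
  assumes "\<And>F. finite F \<Longrightarrow> (\<Sum>i\<in>F. (cmod (x i))\<^sup>2) \<le> c"
  shows "ell2_nth (Abs_ell2 x) = x"
proof (rule Abs_ell2_inverse)
  have "(\<lambda>i. (cmod (x i))\<^sup>2) summable_on UNIV"
    by (rule nonneg_bdd_above_summable_on) (use assms in \<open>auto intro!: bdd_aboveI2[where M = c]\<close>)
  then show "x \<in> {x. (\<lambda>i. (cmod (x i))\<^sup>2) summable_on UNIV}" by simp
qed

instance ell2 :: (type) complete_space
proof
  fix X :: "nat \<Rightarrow> 'a ell2"
  assume "Cauchy X"
  have nth_diff: "ell2_nth (x - y) i = ell2_nth x i - ell2_nth y i" for x y :: "'a ell2" and i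
    by (simp add: minus_ell2.rep_eq)
  have "Cauchy (\<lambda>n. ell2_nth (X n) i)" for i
    unfolding Cauchy_iff
  proof (intro allI impI)
    fix e :: real assume "e > 0"
    then obtain M where "\<And>m n. m \<ge> M \<Longrightarrow> n \<ge> M \<Longrightarrow> norm (X m - X n) < e"
      using \<open>Cauchy X\<close> unfolding Cauchy_iff by metis
    then show "\<exists>M. \<forall>m\<ge>M. \<forall>n\<ge>M. norm (ell2_nth (X m) i - ell2_nth (X n) i) < e"
      by (metis norm_ell2_nth_le nth_diff order_le_less_trans)
  qed
  then obtain x where x: "\<And>i. (\<lambda>n. ell2_nth (X n) i) \<longlonglongrightarrow> x i"
    unfolding Cauchy_convergent_iff convergent_def by metis
  \<comment> \<open>Finite partial sums pass to the coordinatewise limit, so the Cauchy estimate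
    reaches \<open>x\<close> before \<open>x\<close> is known to be square summable.\<close>
  have close: "(\<Sum>i\<in>F. (cmod (ell2_nth (X m) i - x i))\<^sup>2) \<le> e\<^sup>2"
    if F: "finite F" and M: "\<And>n. n \<ge> M \<Longrightarrow> norm (X m - X n) < e" for F M m e
  proof (rule tendsto_upperbound)
    show "(\<lambda>n. \<Sum>i\<in>F. (cmod (ell2_nth (X m) i - ell2_nth (X n) i))\<^sup>2)
        \<longlonglongrightarrow> (\<Sum>i\<in>F. (cmod (ell2_nth (X m) i - x i))\<^sup>2)"
      by (intro tendsto_intros x)
    show "\<forall>\<^sub>F n in sequentially. (\<Sum>i\<in>F. (cmod (ell2_nth (X m) i - ell2_nth (X n) i))\<^sup>2) \<le> e\<^sup>2"
    proof (rule eventually_sequentiallyI)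
      fix n assume "n \<ge> M"
      then have "(norm (X m - X n))\<^sup>2 \<le> e\<^sup>2"
        using M[of n] by (intro power_mono) auto
      then show "(\<Sum>i\<in>F. (cmod (ell2_nth (X m) i - ell2_nth (X n) i))\<^sup>2) \<le> e\<^sup>2"
        using finite_sum_le_norm_ell2[OF F, of "X m - X n"] by (simp add: nth_diff)
    qed
  qed simp
  obtain M where M: "\<And>m n. m \<ge> M \<Longrightarrow> n \<ge> M \<Longrightarrow> norm (X m - X n) < 1"
    using \<open>Cauchy X\<close> unfolding Cauchy_iff by (metis zero_less_one)
  \<comment> \<open>\<open>close\<close> controls only differences from the limit, so the limit is
    built as \<open>X M\<close> minus such a difference.\<close>
  define z where "z = X M - Abs_ell2 (\<lambda>i. ell2_nth (X M) i - x i)"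
  have z: "ell2_nth z i = x i" for i
  proof -
    have "ell2_nth (Abs_ell2 (\<lambda>i. ell2_nth (X M) i - x i)) = (\<lambda>i. ell2_nth (X M) i - x i)"
      by (rule ell2_exists, erule close) (use M in auto)
    then show ?thesis by (simp add: z_def nth_diff)
  qed
  have "X \<longlonglongrightarrow> z"
    unfolding LIMSEQ_iff
  proof (intro allI impI)
    fix r :: real assume "r > 0"
    then obtain N where N: "\<And>m n. m \<ge> N \<Longrightarrow> n \<ge> N \<Longrightarrow> norm (X m - X n) < r / 2"
      using \<open>Cauchy X\<close> unfolding Cauchy_iff by (metis half_gt_zero)
    have "norm (X m - z) \<le> r / 2" if "m \<ge> N" for m
    proof (rule norm_ell2_leI)
      fix F :: "'a set" assume "finite F"
      from close[OF this, of N m "r / 2"] N that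
      show "(\<Sum>i\<in>F. (cmod (ell2_nth (X m - z) i))\<^sup>2) \<le> (r / 2)\<^sup>2"
        by (simp add: nth_diff z)
    qed (use \<open>r > 0\<close> in simp)
    then show "\<exists>no. \<forall>n\<ge>no. norm (X n - z) < r"
      using \<open>r > 0\<close> by (metis field_sum_of_halves less_add_same_cancel1 half_gt_zero order_le_less_trans)
  qed
  then show "convergent X" by (auto simp: convergent_def)
qed

instance ell2 :: (type) banach ..

section \<open>Operators with an adjoint\<close>

lemmas ell2_nth_simps [simp] =
  zero_ell2.rep_eq plus_ell2.rep_eq uminus_ell2.rep_eq minus_ell2.rep_eq scaleR_ell2.rep_eq

lemma inner_ell2_summable:
  "(\<lambda>i. inner (ell2_nth x i) (ell2_nth y i)) summable_on UNIV"
  by (intro square_summable_inner square_summable_ell2)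

definition ell2_op :: "(('i \<Rightarrow> complex) \<Rightarrow> 'j \<Rightarrow> complex) \<Rightarrow> 'i ell2 \<Rightarrow>\<^sub>L 'j ell2" where
  "ell2_op f = Blinfun (\<lambda>x. Abs_ell2 (f (ell2_nth x)))"

text \<open>One estimate on finite partial sums serves twice: it makes the image square summable, so
  that \<open>Abs_ell2\<close> is meaningful, and it bounds the operator.\<close>

lemma ell2_op_nth:
  assumes add: "\<And>x y j. f (\<lambda>i. x i + y i) j = f x j + f y j"
    and scale: "\<And>r x j. f (\<lambda>i. r *\<^sub>R x i) j = r *\<^sub>R f x j"
    and bounded: "\<And>x F. finite F \<Longrightarrow> (\<Sum>j\<in>F. (cmod (f (ell2_nth x) j))\<^sup>2) \<le> C\<^sup>2 * (norm x)\<^sup>2"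
  shows "ell2_nth (ell2_op f x) = f (ell2_nth x)"
proof -
  have nth: "ell2_nth (Abs_ell2 (f (ell2_nth x))) = f (ell2_nth x)" for x
    by (rule ell2_exists, erule bounded)
  have "bounded_linear (\<lambda>x. Abs_ell2 (f (ell2_nth x)))"
  proof
    show "Abs_ell2 (f (ell2_nth (x + y))) = Abs_ell2 (f (ell2_nth x)) + Abs_ell2 (f (ell2_nth y))"
      for x y by (rule ell2_eqI) (use nth[of "x + y"] in \<open>simp add: nth add\<close>)
    show "Abs_ell2 (f (ell2_nth (r *\<^sub>R x))) = r *\<^sub>R Abs_ell2 (f (ell2_nth x))" for r x
      by (rule ell2_eqI) (use nth[of "r *\<^sub>R x"] scale in \<open>simp add: nth\<close>)
    have "norm (Abs_ell2 (f (ell2_nth x))) \<le> norm x * \<bar>C\<bar>" for x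
      by (rule norm_ell2_leI) (use bounded in \<open>simp_all add: nth power_mult_distrib mult.commute\<close>)
    then show "\<exists>K. \<forall>x. norm (Abs_ell2 (f (ell2_nth x))) \<le> norm x * K" by blast
  qed
  then show ?thesis by (simp add: ell2_op_def bounded_linear_Blinfun_apply nth)
qed

definition diag_op :: "('i \<Rightarrow> complex) \<Rightarrow> 'i ell2 \<Rightarrow>\<^sub>L 'i ell2" where
  "diag_op a = ell2_op (\<lambda>x i. a i * x i)"

lemma diag_op_nth:
  fixes a :: "'i \<Rightarrow> complex"
  assumes "bounded (range a)"
  shows "ell2_nth (diag_op a x) i = a i * ell2_nth x i"
proof -
  obtain C where C: "\<And>i. cmod (a i) \<le> C"
    using assms by (auto simp: bounded_iff)
  have "ell2_nth (diag_op a x) = (\<lambda>i. a i * ell2_nth x i)"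
    unfolding diag_op_def
  proof (rule ell2_op_nth)
    fix x :: "'i ell2" and F :: "'i set" assume "finite F"
    have "(\<Sum>i\<in>F. (cmod (a i * ell2_nth x i))\<^sup>2) \<le> (\<Sum>i\<in>F. C\<^sup>2 * (cmod (ell2_nth x i))\<^sup>2)"
      by (intro sum_mono) (simp add: norm_mult power_mult_distrib mult_right_mono power_mono C)
    also have "\<dots> \<le> C\<^sup>2 * (norm x)\<^sup>2"
      using finite_sum_le_norm_ell2[OF \<open>finite F\<close>, of x]
      by (simp add: mult_left_mono flip: sum_distrib_left)
    finally show "(\<Sum>i\<in>F. (cmod (a i * ell2_nth x i))\<^sup>2) \<le> C\<^sup>2 * (norm x)\<^sup>2" .
  qed (simp_all add: algebra_simps)
  then show ?thesis by simp
qed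

lemma inner_cnj: "inner (a * x) y = inner x (cnj a * (y :: complex))"
  by (simp add: inner_complex_def algebra_simps)

lemma inner_diag_op:
  assumes "bounded (range a)"
  shows "inner (diag_op a x) y = inner x (diag_op (\<lambda>i. cnj (a i)) y)"
proof -
  have "bounded (range (\<lambda>i. cnj (a i)))"
    using assms by (auto simp: bounded_iff)
  then show ?thesis
    by (simp add: inner_ell2_def diag_op_nth assms inner_cnj)
qed

section \<open>Complex scalars, adjoints and the C*-algebra of operators\<close>

definition cscale_op :: "complex \<Rightarrow> 'i ell2 \<Rightarrow>\<^sub>L 'i ell2" where
  "cscale_op c = diag_op (\<lambda>_. c)"

lemma cscale_op_nth [simp]: "ell2_nth (cscale_op c x) i = c * ell2_nth x i"
  unfolding cscale_op_def by (rule diag_op_nth) (auto simp: image_def)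

lemma inner_cscale_op: "inner (cscale_op c x) y = inner x (cscale_op (cnj c) y)"
  unfolding cscale_op_def by (rule inner_diag_op) (auto simp: image_def)

text \<open>The space is formalised as a real inner product space whose \<open>inner\<close> is the
  real part of the Hermitian form. Complex scalars therefore occur as operators, and their norm has
  to be computed like that of any other operator.\<close>

lemma norm_cscale_op [simp]: "norm (cscale_op c x) = cmod c * norm x"
proof -
  have "(norm (cscale_op c x))\<^sup>2 = (cmod c * norm x)\<^sup>2"
    by (simp add: norm_ell2_square norm_mult power_mult_distrib infsum_cmult_right')
  then show ?thesis by (rule power2_eq_imp_eq) auto
qed

lemma cscale_op_simps:
  "cscale_op c (cscale_op d x) = cscale_op (c * d) x"
  "cscale_op (c + d) x = cscale_op c x + cscale_op d x"
  "cscale_op 1 x = x" "cscale_op (-1) x = - x"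
  by (auto intro!: ell2_eqI simp: algebra_simps)

definition adjoint_op :: "('i ell2 \<Rightarrow>\<^sub>L 'j ell2) \<Rightarrow> ('j ell2 \<Rightarrow>\<^sub>L 'i ell2) \<Rightarrow> bool" where
  "adjoint_op T S \<longleftrightarrow> (\<forall>x y. inner (T x) y = inner x (S y))"

lemma adjoint_op_sym: "adjoint_op T S \<Longrightarrow> adjoint_op S T"
  by (simp add: adjoint_op_def inner_commute)

lemma adjoint_op_unique:
  assumes "adjoint_op T S" "adjoint_op T S'"
  shows "S = S'"
proof (rule blinfun_eqI)
  fix y
  have "inner (S y - S' y) (S y - S' y) = 0"
    using assms unfolding adjoint_op_def by (metis inner_diff_right right_minus_eq)
  then show "S y = S' y" by simp
qed

lemma adjoint_op_add: "adjoint_op T S \<Longrightarrow> adjoint_op T' S' \<Longrightarrow> adjoint_op (T + T') (S + S')"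
  by (simp add: adjoint_op_def blinfun.add_left inner_add)

lemma adjoint_op_sum:
  "(\<And>k. k \<in> K \<Longrightarrow> adjoint_op (T k) (S k)) \<Longrightarrow> adjoint_op (\<Sum>k\<in>K. T k) (\<Sum>k\<in>K. S k)"
  by (induction K rule: infinite_finite_induct) (auto simp: adjoint_op_def blinfun.add_left inner_add)

lemma adjoint_op_compose:
  "adjoint_op T S \<Longrightarrow> adjoint_op T' S' \<Longrightarrow> adjoint_op (T o\<^sub>L T') (S' o\<^sub>L S)"
  by (simp add: adjoint_op_def)

lemma adjoint_op_norm_le:
  assumes "adjoint_op T S"
  shows "norm S \<le> norm T"
proof (rule norm_blinfun_bound)
  fix y
  have "(norm (S y))\<^sup>2 = inner (T (S y)) y"
    using assms by (simp add: adjoint_op_def power2_norm_eq_inner)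
  also have "\<dots> \<le> norm (T (S y)) * norm y" by (rule norm_cauchy_schwarz)
  also have "\<dots> \<le> norm T * norm (S y) * norm y"
    by (intro mult_right_mono norm_blinfun) simp
  finally have "norm (S y) * norm (S y) \<le> norm (S y) * (norm T * norm y)"
    by (simp add: power2_eq_square mult_ac)
  then show "norm (S y) \<le> norm T * norm y"
    by (cases "norm (S y) = 0") (auto simp: mult_le_cancel_left)
qed simp

lemma adjoint_op_norm: "adjoint_op T S \<Longrightarrow> norm S = norm T"
  by (meson adjoint_op_norm_le adjoint_op_sym order_antisym)

lemma adjoint_op_cstar_identity:
  assumes "adjoint_op T S"
  shows "norm (S o\<^sub>L T) = (norm T)\<^sup>2"
proof (rule order_antisym)
  show "norm (S o\<^sub>L T) \<le> (norm T)\<^sup>2"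
    using norm_blinfun_compose[of S T] adjoint_op_norm[OF assms] by (simp add: power2_eq_square)
  have "norm T \<le> sqrt (norm (S o\<^sub>L T))"
  proof (rule norm_blinfun_bound)
    fix x
    have "(norm (T x))\<^sup>2 = inner x ((S o\<^sub>L T) x)"
      using assms by (simp add: adjoint_op_def power2_norm_eq_inner)
    also have "\<dots> \<le> norm x * norm ((S o\<^sub>L T) x)" by (rule norm_cauchy_schwarz)
    also have "\<dots> \<le> norm x * (norm (S o\<^sub>L T) * norm x)"
      by (intro mult_left_mono norm_blinfun) simp
    finally have "(norm (T x))\<^sup>2 \<le> (sqrt (norm (S o\<^sub>L T)) * norm x)\<^sup>2"
      by (simp add: power_mult_distrib power2_eq_square mult_ac)
    then show "norm (T x) \<le> sqrt (norm (S o\<^sub>L T)) * norm x"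
      by (rule power2_le_imp_le) simp
  qed simp
  then show "(norm T)\<^sup>2 \<le> norm (S o\<^sub>L T)"
    by (metis norm_ge_zero power_mono real_sqrt_pow2)
qed

text \<open>Bounded operators are a priori only real-linear; commuting with every
  \<open>cscale_op c\<close> selects the complex-linear ones, and for these a real adjoint is also
  the adjoint for the Hermitian form. Existence of the adjoint belongs to the definition, so it has
  to be carried through limits.\<close>

definition ell2_ops :: "('i ell2 \<Rightarrow>\<^sub>L 'i ell2) set" where
  "ell2_ops = {T. (\<exists>S. adjoint_op T S) \<and> (\<forall>c. T o\<^sub>L cscale_op c = cscale_op c o\<^sub>L T)}"

definition op_star :: "('i ell2 \<Rightarrow>\<^sub>L 'i ell2) \<Rightarrow> 'i ell2 \<Rightarrow>\<^sub>L 'i ell2" where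
  "op_star T = (THE S. adjoint_op T S)"

lemma op_star_eqI: "adjoint_op T S \<Longrightarrow> op_star T = S"
  unfolding op_star_def by (blast intro: adjoint_op_unique)

lemma adjoint_op_star: "T \<in> ell2_ops \<Longrightarrow> adjoint_op T (op_star T)"
  unfolding ell2_ops_def using op_star_eqI by blast

lemma ell2_ops_cscale: "T \<in> ell2_ops \<Longrightarrow> T (cscale_op c x) = cscale_op c (T x)"
  unfolding ell2_ops_def by (metis (mono_tags) blinfun_apply_blinfun_compose mem_Collect_eq)

lemma ell2_opsI:
  "adjoint_op T S \<Longrightarrow> (\<And>c x. T (cscale_op c x) = cscale_op c (T x)) \<Longrightarrow> T \<in> ell2_ops"
  unfolding ell2_ops_def by (auto intro!: blinfun_eqI)

text \<open>The adjoint of \<open>cscale_op c\<close> is \<open>cscale_op (cnj c)\<close>, so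
  passing to adjoints preserves commutation with all scalars.\<close>

lemma adjoint_op_in_ell2_ops:
  assumes "T \<in> ell2_ops" "adjoint_op T S"
  shows "S \<in> ell2_ops"
proof (rule ell2_opsI)
  show "adjoint_op S T" using assms(2) by (rule adjoint_op_sym)
  fix c y
  have "inner x (S (cscale_op c y)) = inner x (cscale_op c (S y))" for x
    using assms inner_cscale_op[of "cnj c"]
    by (metis adjoint_op_def complex_cnj_cnj ell2_ops_cscale)
  then show "S (cscale_op c y) = cscale_op c (S y)"
    by (metis inner_commute vector_eq_ldot)
qed

lemma ell2_ops_zero: "0 \<in> ell2_ops"
  by (rule ell2_opsI[of _ 0]) (auto simp: adjoint_op_def intro: ell2_eqI)

lemma ell2_ops_add: "T \<in> ell2_ops \<Longrightarrow> T' \<in> ell2_ops \<Longrightarrow> T + T' \<in> ell2_ops"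
  by (rule ell2_opsI, rule adjoint_op_add)
     (auto intro: adjoint_op_star simp: blinfun.add_left blinfun.add_right ell2_ops_cscale)

lemma ell2_ops_sum: "(\<And>k. k \<in> K \<Longrightarrow> T k \<in> ell2_ops) \<Longrightarrow> (\<Sum>k\<in>K. T k) \<in> ell2_ops"
  by (induction K rule: infinite_finite_induct) (auto intro: ell2_ops_add ell2_ops_zero)

lemma ell2_ops_compose: "T \<in> ell2_ops \<Longrightarrow> T' \<in> ell2_ops \<Longrightarrow> T o\<^sub>L T' \<in> ell2_ops"
  by (rule ell2_opsI, rule adjoint_op_compose)
     (auto intro: adjoint_op_star simp: ell2_ops_cscale)

lemma ell2_ops_star: "T \<in> ell2_ops \<Longrightarrow> op_star T \<in> ell2_ops"
  by (meson adjoint_op_in_ell2_ops adjoint_op_star)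

lemma adjoint_cscale_op: "adjoint_op (cscale_op c) (cscale_op (cnj c))"
  by (simp add: adjoint_op_def inner_cscale_op)

lemma cscale_op_in_ell2_ops: "cscale_op c \<in> ell2_ops"
  by (rule ell2_opsI, rule adjoint_cscale_op) (simp add: cscale_op_simps mult.commute)

lemma op_star_op_star: "T \<in> ell2_ops \<Longrightarrow> op_star (op_star T) = T"
  by (simp add: adjoint_op_star adjoint_op_sym op_star_eqI)

lemma op_star_add: "T \<in> ell2_ops \<Longrightarrow> S \<in> ell2_ops \<Longrightarrow> op_star (T + S) = op_star T + op_star S"
  by (simp add: adjoint_op_add adjoint_op_star op_star_eqI)

lemma op_star_compose:
  "T \<in> ell2_ops \<Longrightarrow> S \<in> ell2_ops \<Longrightarrow> op_star (T o\<^sub>L S) = op_star S o\<^sub>L op_star T"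
  by (simp add: adjoint_op_compose adjoint_op_star op_star_eqI)

lemma cscale_op_commute: "T \<in> ell2_ops \<Longrightarrow> T o\<^sub>L cscale_op c = cscale_op c o\<^sub>L T"
  by (rule blinfun_eqI) (simp add: ell2_ops_cscale)

lemma op_star_cscale:
  "T \<in> ell2_ops \<Longrightarrow> op_star (cscale_op c o\<^sub>L T) = cscale_op (cnj c) o\<^sub>L op_star T"
  by (metis adjoint_cscale_op cscale_op_commute cscale_op_in_ell2_ops ell2_ops_star op_star_compose
      op_star_eqI)

lemma norm_cscale_compose: "norm (cscale_op c o\<^sub>L T) = cmod c * norm T"
proof (rule order_antisym)
  show "norm (cscale_op c o\<^sub>L T) \<le> cmod c * norm T"
    by (rule norm_blinfun_bound) (auto simp: mult.assoc intro: mult_left_mono norm_blinfun)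
  show "cmod c * norm T \<le> norm (cscale_op c o\<^sub>L T)"
  proof (cases "c = 0")
    case False
    have "norm T \<le> norm (cscale_op c o\<^sub>L T) / cmod c"
    proof (rule norm_blinfun_bound)
      fix x show "norm (T x) \<le> norm (cscale_op c o\<^sub>L T) / cmod c * norm x"
        using norm_blinfun[of "cscale_op c o\<^sub>L T" x] False by (simp add: field_simps)
    qed simp
    then show ?thesis using False by (simp add: field_simps)
  qed simp
qed

text \<open>Taking adjoints is isometric, so the adjoints of the \<open>T n\<close> form a Cauchy
  sequence; their limit is an adjoint of \<open>L\<close>.\<close>

lemma ell2_ops_limit:
  assumes T: "\<And>n. T n \<in> ell2_ops" and lim: "T \<longlonglongrightarrow> L"
  shows "L \<in> ell2_ops"
proof -
  have adj: "adjoint_op (T n) (op_star (T n))" for n by (intro adjoint_op_star T)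
  have diff: "adjoint_op (T m - T n) (op_star (T m) - op_star (T n))" for m n
    using adj[of m] adj[of n]
    by (simp add: adjoint_op_def blinfun.diff_left inner_diff_left inner_diff_right)
  have "Cauchy T" using lim by (rule LIMSEQ_imp_Cauchy)
  then have "Cauchy (\<lambda>n. op_star (T n))"
    unfolding Cauchy_iff by (simp add: adjoint_op_norm[OF diff])
  then obtain S where S: "(\<lambda>n. op_star (T n)) \<longlonglongrightarrow> S"
    by (auto simp: Cauchy_convergent_iff convergent_def)
  show ?thesis
  proof (rule ell2_opsI)
    show "adjoint_op L S"
      unfolding adjoint_op_def
    proof (intro allI)
      fix x y
      have "(\<lambda>n. inner (T n x) y) \<longlonglongrightarrow> inner (L x) y" by (intro tendsto_intros lim)
      moreover have "(\<lambda>n. inner x (op_star (T n) y)) \<longlonglongrightarrow> inner x (S y)" by (intro tendsto_intros S)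
      moreover have "inner (T n x) y = inner x (op_star (T n) y)" for n
        using adj[of n] by (simp add: adjoint_op_def)
      ultimately show "inner (L x) y = inner x (S y)" by (simp add: LIMSEQ_unique)
    qed
    fix c x
    have "(\<lambda>n. T n (cscale_op c x)) \<longlonglongrightarrow> L (cscale_op c x)" by (intro tendsto_intros lim)
    moreover have "(\<lambda>n. cscale_op c (T n x)) \<longlonglongrightarrow> cscale_op c (L x)" by (intro tendsto_intros lim)
    ultimately show "L (cscale_op c x) = cscale_op c (L x)"
      by (simp add: LIMSEQ_unique T ell2_ops_cscale)
  qed
qed

text \<open>The operator algebra is transported along an injection \<open>enc\<close> because the
  universal property only tests algebras whose elements are drawn from
  \<open>universe\<close>.\<close>

definition op_cstar :: "(('i ell2 \<Rightarrow>\<^sub>L 'i ell2) \<Rightarrow> 'u) \<Rightarrow> 'u cstar" where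
  "op_cstar enc = (let dec = inv_into ell2_ops enc in
    \<lparr> cs_carrier = enc ` ell2_ops,
      cs_add = (\<lambda>x y. enc (dec x + dec y)),
      cs_zero = enc 0,
      cs_scale = (\<lambda>c x. enc (cscale_op c o\<^sub>L dec x)),
      cs_mult = (\<lambda>x y. enc (dec x o\<^sub>L dec y)),
      cs_star = (\<lambda>x. enc (op_star (dec x))),
      cs_norm = (\<lambda>x. norm (dec x)) \<rparr>)"

context
  fixes enc :: "('i ell2 \<Rightarrow>\<^sub>L 'i ell2) \<Rightarrow> 'u"
  assumes inj: "inj_on enc ell2_ops"
begin

lemma op_cstar_carrier: "cs_carrier (op_cstar enc) = enc ` ell2_ops"
  by (simp add: op_cstar_def Let_def)

lemma op_cstar_simps:
  "cs_zero (op_cstar enc) = enc 0"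
  "T \<in> ell2_ops \<Longrightarrow> S \<in> ell2_ops \<Longrightarrow> cs_add (op_cstar enc) (enc T) (enc S) = enc (T + S)"
  "T \<in> ell2_ops \<Longrightarrow> cs_scale (op_cstar enc) c (enc T) = enc (cscale_op c o\<^sub>L T)"
  "T \<in> ell2_ops \<Longrightarrow> S \<in> ell2_ops \<Longrightarrow> cs_mult (op_cstar enc) (enc T) (enc S) = enc (T o\<^sub>L S)"
  "T \<in> ell2_ops \<Longrightarrow> cs_star (op_cstar enc) (enc T) = enc (op_star T)"
  "T \<in> ell2_ops \<Longrightarrow> cs_norm (op_cstar enc) (enc T) = norm T"
  by (simp_all add: op_cstar_def Let_def inv_into_f_f[OF inj])

lemma cscale_compose_simps:
  "cscale_op 1 o\<^sub>L T = T" "cscale_op (-1) o\<^sub>L T = - T"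
  "cscale_op c o\<^sub>L (cscale_op d o\<^sub>L T) = cscale_op (c * d) o\<^sub>L T"
  "cscale_op (c + d) o\<^sub>L T = (cscale_op c o\<^sub>L T) + (cscale_op d o\<^sub>L T)"
  by (rule blinfun_eqI; simp add: cscale_op_simps blinfun.add_left blinfun.minus_left)+

lemma ell2_ops_uminus: "T \<in> ell2_ops \<Longrightarrow> - T \<in> ell2_ops"
  by (metis cscale_compose_simps(2) cscale_op_in_ell2_ops ell2_ops_compose)

lemma ell2_ops_diff: "T \<in> ell2_ops \<Longrightarrow> S \<in> ell2_ops \<Longrightarrow> T - S \<in> ell2_ops"
  using ell2_ops_add[OF _ ell2_ops_uminus] by fastforce

lemma op_cstar_dist:
  "T \<in> ell2_ops \<Longrightarrow> S \<in> ell2_ops \<Longrightarrow> cs_dist (op_cstar enc) (enc T) (enc S) = norm (T - S)"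
  by (simp add: cs_dist_def op_cstar_simps op_cstar_carrier cscale_compose_simps
      cscale_op_in_ell2_ops ell2_ops_compose ell2_ops_uminus ell2_ops_diff)

lemma op_cstar_complete:
  "Metric_space.mcomplete (cs_carrier (op_cstar enc)) (cs_dist (op_cstar enc))"
proof -
  interpret Metric_space "cs_carrier (op_cstar enc)" "cs_dist (op_cstar enc)"
  proof
    show "0 \<le> cs_dist (op_cstar enc) x y" "cs_dist (op_cstar enc) x y = cs_dist (op_cstar enc) y x"
      for x y
    proof (atomize (full), cases "x \<in> enc ` ell2_ops \<and> y \<in> enc ` ell2_ops")
      case True
      then show "0 \<le> cs_dist (op_cstar enc) x y
          \<and> cs_dist (op_cstar enc) x y = cs_dist (op_cstar enc) y x"
        by (auto simp: op_cstar_dist norm_minus_commute)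
    qed (auto simp: cs_dist_def op_cstar_carrier)
  qed (use inj in \<open>auto simp: op_cstar_dist op_cstar_carrier inj_on_eq_iff
      intro: norm_diff_triangle_le[OF order_refl order_refl]\<close>)
  show ?thesis
    unfolding mcomplete_def
  proof (intro allI impI)
    fix \<sigma> assume "MCauchy \<sigma>"
    then have "range \<sigma> \<subseteq> cs_carrier (op_cstar enc)" unfolding MCauchy_def by blast
    then have "\<forall>n. \<exists>T\<in>ell2_ops. \<sigma> n = enc T" by (auto simp: op_cstar_carrier)
    then obtain T where T: "\<And>n. T n \<in> ell2_ops" "\<And>n. \<sigma> n = enc (T n)" by metis
    have "Cauchy T"
      using \<open>MCauchy \<sigma>\<close> unfolding Cauchy_iff MCauchy_def by (simp add: T op_cstar_dist)
    then obtain L where L: "T \<longlonglongrightarrow> L" by (auto simp: Cauchy_convergent_iff convergent_def)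
    have "L \<in> ell2_ops" using ell2_ops_limit[OF T(1) L] .
    moreover have "(\<lambda>n. norm (T n - L)) \<longlonglongrightarrow> 0"
      using L by (simp add: LIM_zero tendsto_norm_zero)
    ultimately have "limitin mtopology \<sigma> (enc L) sequentially"
      by (subst limitin_metric_dist_null) (simp add: T op_cstar_dist op_cstar_carrier)
    then show "\<exists>x. limitin mtopology \<sigma> x sequentially" ..
  qed
qed

lemma op_cstar_algebra: "cstar_algebra (op_cstar enc)"
proof -
  note closed = ell2_ops_zero ell2_ops_add ell2_ops_compose ell2_ops_star ell2_ops_uminus
    cscale_op_in_ell2_ops
  have blinfun_simps: "(S + T) o\<^sub>L R = (S o\<^sub>L R) + (T o\<^sub>L R)" "R o\<^sub>L (S + T) = (R o\<^sub>L S) + (R o\<^sub>L T)"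
    "(S o\<^sub>L T) o\<^sub>L R = S o\<^sub>L (T o\<^sub>L R)" for R S T :: "'i ell2 \<Rightarrow>\<^sub>L 'i ell2"
    by (auto intro!: blinfun_eqI simp: blinfun.add_left blinfun.add_right)
  have commute: "S o\<^sub>L (cscale_op c o\<^sub>L T) = cscale_op c o\<^sub>L (S o\<^sub>L T)" if "S \<in> ell2_ops" for c S T
    using that by (auto intro!: blinfun_eqI simp: ell2_ops_cscale)
  show ?thesis
  proof
    show "Metric_space.mcomplete (cs_carrier (op_cstar enc)) (cs_dist (op_cstar enc))"
      by (rule op_cstar_complete)
    show "cs_star (op_cstar enc) (cs_scale (op_cstar enc) c x) =
        cs_scale (op_cstar enc) (cnj c) (cs_star (op_cstar enc) x)"
      if "x \<in> cs_carrier (op_cstar enc)" for c x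
      using that by (auto simp: op_cstar_carrier op_cstar_simps closed op_star_cscale)
  qed (unfold op_cstar_carrier, auto simp: op_cstar_simps closed cscale_compose_simps blinfun_simps
      add_ac commute op_star_op_star op_star_add op_star_compose op_star_cscale norm_cscale_compose
      norm_triangle_ineq norm_blinfun_compose adjoint_op_cstar_identity adjoint_op_star
      inj_on_eq_iff[OF inj])
qed

end

section \<open>Compact topological graphs\<close>

lemma continuous_map_euclidean_iff:
  "continuous_map X euclidean f \<longleftrightarrow> (\<forall>x\<in>topspace X. (f \<longlongrightarrow> f x) (atin X x))"
  by (simp add: continuous_map_atin)

lemma compact_Hausdorff_bump:
  assumes "compact_space X" "Hausdorff_space X" "openin X U" "x \<in> U"
  obtains f :: "'a \<Rightarrow> real" where "continuous_map X euclidean f" "f x = 1"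
    "\<And>y. y \<in> topspace X \<Longrightarrow> 0 \<le> f y" "\<And>y. y \<in> topspace X \<Longrightarrow> y \<notin> U \<Longrightarrow> f y = 0"
proof -
  have "completely_regular_space X"
    using assms(1,2) compact_Hausdorff_or_regular_imp_normal_space
      normal_imp_completely_regular_space_gen Hausdorff_imp_t1_space
    by (metis compact_Hausdorff_imp_regular_space compact_imp_locally_compact_space
        locally_compact_regular_imp_completely_regular_space)
  moreover have "closedin X (topspace X - U)" "x \<in> topspace X - (topspace X - U)"
    using assms(3,4) openin_subset by blast+
  ultimately obtain f :: "'a \<Rightarrow> real" where f: "continuous_map X (top_of_set {0..1}) f" "f x = 0"
      "f ` (topspace X - U) \<subseteq> {1}"
    unfolding completely_regular_space_def by meson
  show thesis
  proof
    show "continuous_map X euclidean (\<lambda>y. 1 - f y)"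
      using f(1) by (auto simp: continuous_map_in_subtopology continuous_map_euclidean_iff
          intro!: tendsto_intros)
    show "0 \<le> 1 - f y" if "y \<in> topspace X" for y
      using f(1) that by (auto simp: continuous_map_in_subtopology Pi_iff image_subset_iff)
  qed (use f in auto)
qed

text \<open>Setting the function to 0 off \<open>U\<close> also makes it vanish outside the space,
  as membership in \<open>C0\<close> and \<open>Cc\<close> demands.\<close>

lemma compact_Hausdorff_complex_bump:
  assumes "compact_space X" "Hausdorff_space X" "openin X U" "x \<in> U"
  obtains f :: "'a \<Rightarrow> complex" where "continuous_map X euclidean f" "f x = 1" "\<And>y. y \<notin> U \<Longrightarrow> f y = 0"
proof -
  obtain g :: "'a \<Rightarrow> real" where g: "continuous_map X euclidean g" "g x = 1"
    "\<And>y. y \<in> topspace X \<Longrightarrow> y \<notin> U \<Longrightarrow> g y = 0"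
    using compact_Hausdorff_bump[OF assms] by metis
  have U: "U \<subseteq> topspace X" using assms(3) by (rule openin_subset)
  show thesis
  proof
    have "continuous_map X euclidean (\<lambda>y. complex_of_real (g y))"
      using g(1) by (auto simp: continuous_map_euclidean_iff intro!: tendsto_intros)
    then show "continuous_map X euclidean (\<lambda>y. if y \<in> U then complex_of_real (g y) else 0)"
      by (rule continuous_map_eq) (use g(3) in auto)
  qed (use g(2) assms(4) in auto)
qed

locale compact_tgraph = topological_graph E for E :: "('v, 'e) topgraph" +
  assumes compact_vertices: "compact_space (vertices E)"
    and compact_edges: "compact_space (edges E)"
    and no_sinks: "v \<in> topspace (vertices E) \<Longrightarrow> \<exists>e\<in>topspace (edges E). src E e = v"
begin

abbreviation "V \<equiv> topspace (vertices E)"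
abbreviation "Ed \<equiv> topspace (edges E)"
abbreviation "CE \<equiv> Cc (edges E)"
abbreviation "CV \<equiv> cs_carrier (C0 (vertices E))"

definition fib :: "'v \<Rightarrow> 'e set" where
  "fib v = {e \<in> Ed. src E e = v}"

lemma src_in: "e \<in> Ed \<Longrightarrow> src E e \<in> V"
  using src_continuous by (auto simp: continuous_map_def Pi_iff)

lemma rng_in: "e \<in> Ed \<Longrightarrow> rng E e \<in> V"
  using rng_continuous by (auto simp: continuous_map_def Pi_iff)

lemma fib_src: "e \<in> Ed \<Longrightarrow> e \<in> fib (src E e)"
  by (simp add: fib_def)

lemma fib_subset: "fib v \<subseteq> Ed"
  by (auto simp: fib_def)

text \<open>Closed subsets of a compact space are compact, so the support condition is automatic;
  for the same reason decay at infinity disappears from \<open>CV_iff\<close>.\<close>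

lemma CE_iff: "f \<in> CE \<longleftrightarrow> continuous_map (edges E) euclidean f \<and> (\<forall>e. e \<notin> Ed \<longrightarrow> f e = 0)"
  unfolding Cc_def by (simp add: closedin_compact_space[OF compact_edges])

lemma CV_iff: "a \<in> CV \<longleftrightarrow> continuous_map (vertices E) euclidean a \<and> (\<forall>v. v \<notin> V \<longrightarrow> a v = 0)"
proof -
  have "compactin (vertices E) {v \<in> V. \<epsilon> \<le> cmod (a v)}"
    if "continuous_map (vertices E) euclidean a" for \<epsilon>
  proof (rule closedin_compact_space[OF compact_vertices])
    have "closed {z :: complex. \<epsilon> \<le> cmod z}"
      by (intro closed_Collect_le continuous_intros)
    then show "closedin (vertices E) {v \<in> V. \<epsilon> \<le> cmod (a v)}"
      using closedin_continuous_map_preimage[OF that, of "{z. \<epsilon> \<le> cmod z}"] by simp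
  qed
  then show ?thesis by (auto simp: C0_def)
qed

section \<open>Frames and continuity of sums over the fibres of s\<close>

lemma src_open_map: "openin (edges E) U \<Longrightarrow> openin (vertices E) (src E ` U)"
proof (subst openin_subopen, intro ballI)
  fix v assume U: "openin (edges E) U" and "v \<in> src E ` U"
  then obtain e where e: "e \<in> U" "v = src E e" "e \<in> Ed"
    using openin_subset by blast
  obtain N where N: "openin (edges E) N" "e \<in> N" "openin (vertices E) (src E ` N)"
      "homeomorphic_map (subtopology (edges E) N) (subtopology (vertices E) (src E ` N)) (src E)"
    using src_local_homeo[OF e(3)] by blast
  have "openin (subtopology (edges E) N) (U \<inter> N)"
    using U by (auto simp: openin_subtopology)
  then have "openin (subtopology (vertices E) (src E ` N)) (src E ` (U \<inter> N))"
    using N(4) homeomorphic_imp_open_map open_map_def by blast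
  then have "openin (vertices E) (src E ` (U \<inter> N))"
    using N(3) openin_trans_full by blast
  then show "\<exists>T. openin (vertices E) T \<and> v \<in> T \<and> T \<subseteq> src E ` U"
    using e N(2) by blast
qed

lemma src_closed_map: "closedin (edges E) S \<Longrightarrow> closedin (vertices E) (src E ` S)"
  using continuous_imp_closed_map[OF src_continuous compact_edges vertices_t2] closed_map_def
  by blast

text \<open>A frame of the Hilbert module: \<open>u\<^sub>k\<close> is the square root of a partition of unity subordinate to
  open sets on which \<open>s\<close> is injective.\<close>

lemma frame_exists:
  obtains K :: "'e set" and u :: "'e \<Rightarrow> 'e \<Rightarrow> complex" where "finite K"
    "\<And>k. k \<in> K \<Longrightarrow> u k \<in> CE"
    "\<And>e. e \<in> Ed \<Longrightarrow> (\<Sum>k\<in>K. u k e * cnj (u k e)) = 1"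
    "\<And>k e e'. k \<in> K \<Longrightarrow> e \<in> Ed \<Longrightarrow> e' \<in> Ed \<Longrightarrow> src E e = src E e' \<Longrightarrow> e \<noteq> e' \<Longrightarrow> u k e = 0 \<or> u k e' = 0"
proof -
  have "\<exists>f :: 'e \<Rightarrow> real. continuous_map (edges E) euclidean f \<and> f e = 1 \<and> (\<forall>y\<in>Ed. 0 \<le> f y) \<and>
      (\<forall>x y. x \<in> Ed \<longrightarrow> y \<in> Ed \<longrightarrow> src E x = src E y \<longrightarrow> x \<noteq> y \<longrightarrow> f x = 0 \<or> f y = 0)"
    if e: "e \<in> Ed" for e
  proof -
    obtain N where N: "openin (edges E) N" "e \<in> N"
        "homeomorphic_map (subtopology (edges E) N) (subtopology (vertices E) (src E ` N)) (src E)"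
      using src_local_homeo[OF e] by blast
    have "N \<subseteq> Ed" using N(1) by (rule openin_subset)
    then have "inj_on (src E) N"
      using homeomorphic_imp_injective_map[OF N(3)] by (simp add: Int_absorb1)
    then show ?thesis
      using compact_Hausdorff_bump[OF compact_edges edges_t2 N(1,2)] by (metis inj_onD)
  qed
  then have "\<forall>e\<in>Ed. \<exists>f :: 'e \<Rightarrow> real. continuous_map (edges E) euclidean f \<and> f e = 1 \<and>
      (\<forall>y\<in>Ed. 0 \<le> f y) \<and>
      (\<forall>x y. x \<in> Ed \<longrightarrow> y \<in> Ed \<longrightarrow> src E x = src E y \<longrightarrow> x \<noteq> y \<longrightarrow> f x = 0 \<or> f y = 0)"
    by blast
  from bchoice[OF this] obtain f :: "'e \<Rightarrow> 'e \<Rightarrow> real" where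
    f: "\<And>e. e \<in> Ed \<Longrightarrow> continuous_map (edges E) euclidean (f e)" "\<And>e. e \<in> Ed \<Longrightarrow> f e e = 1"
      "\<And>e y. e \<in> Ed \<Longrightarrow> y \<in> Ed \<Longrightarrow> 0 \<le> f e y"
      "\<And>e x y. e \<in> Ed \<Longrightarrow> x \<in> Ed \<Longrightarrow> y \<in> Ed \<Longrightarrow> src E x = src E y \<Longrightarrow> x \<noteq> y \<Longrightarrow> f e x = 0 \<or> f e y = 0"
    by blast
  \<comment> \<open>The sets where the bumps are positive cover the edges because
    \<open>f e e = 1\<close>; a finite subcover makes the normalising sum \<open>g\<close> positive
    everywhere.\<close>
  define O' where "O' e = {x \<in> Ed. f e x \<in> {0<..}}" for e
  have "openin (edges E) (O' e)" if "e \<in> Ed" for e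
    unfolding O'_def by (rule openin_continuous_map_preimage[OF f(1)[OF that]]) simp
  then have "\<forall>U\<in>O' ` Ed. openin (edges E) U" by blast
  moreover have "Ed \<subseteq> \<Union>(O' ` Ed)" by (auto simp: O'_def f(2))
  ultimately obtain \<F> where \<F>: "finite \<F>" "\<F> \<subseteq> O' ` Ed" "Ed \<subseteq> \<Union>\<F>"
    using compact_edges unfolding compact_space_alt by meson
  then obtain K where K: "K \<subseteq> Ed" "finite K" "\<F> = O' ` K"
    by (meson finite_subset_image)
  define g where "g x = (\<Sum>k\<in>K. f k x)" for x
  have g_pos: "g x > 0" if x: "x \<in> Ed" for x
  proof -
    obtain k where "k \<in> K" "f k x > 0" using x \<F>(3) K(3) by (auto simp: O'_def)
    then show ?thesis
      unfolding g_def using K f(3) x by (intro sum_pos2[of K k]) auto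
  qed
  define u where "u k x = (if x \<in> Ed then complex_of_real (sqrt (f k x / g x)) else 0)" for k x
  show thesis
  proof (rule that[of K u])
    show "finite K" by fact
    show "u k \<in> CE" if "k \<in> K" for k
    proof -
      have lim: "(f j \<longlongrightarrow> f j x) (atin (edges E) x)" if "j \<in> K" "x \<in> Ed" for j x
        using f(1) that K by (auto simp: continuous_map_euclidean_iff)
      have "((\<lambda>x. complex_of_real (sqrt (f k x / g x))) \<longlongrightarrow> complex_of_real (sqrt (f k x / g x)))
          (atin (edges E) x)" if "x \<in> Ed" for x
        using g_pos[OF that] lim that \<open>k \<in> K\<close> unfolding g_def by (intro tendsto_intros) auto
      then have "continuous_map (edges E) euclidean (\<lambda>x. complex_of_real (sqrt (f k x / g x)))"
        by (simp add: continuous_map_euclidean_iff)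
      then have "continuous_map (edges E) euclidean (u k)"
        by (rule continuous_map_eq) (simp add: u_def)
      then show ?thesis by (simp add: CE_iff u_def)
    qed
    show "(\<Sum>k\<in>K. u k x * cnj (u k x)) = 1" if x: "x \<in> Ed" for x
    proof -
      have "u k x * cnj (u k x) = complex_of_real (f k x / g x)" if "k \<in> K" for k
        using x f(3)[of k x] g_pos[OF x] that K by (auto simp: u_def simp flip: of_real_mult)
      then have "(\<Sum>k\<in>K. u k x * cnj (u k x)) = complex_of_real (\<Sum>k\<in>K. f k x / g x)" by simp
      also have "(\<Sum>k\<in>K. f k x / g x) = 1"
        using g_pos[OF x] by (simp add: g_def flip: sum_divide_distrib)
      finally show ?thesis by simp
    qed
    show "u k e = 0 \<or> u k e' = 0"
      if "k \<in> K" "e \<in> Ed" "e' \<in> Ed" "src E e = src E e'" "e \<noteq> e'" for k e e'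
      using f(4)[of k e e'] that K by (auto simp: u_def)
  qed
qed

text \<open>Send each edge to some frame index whose function does not vanish there. Two edges with
  the same source cannot share an index, so every fibre embeds in \<open>K\<close>.\<close>

lemma fib_card_bound:
  obtains n where "\<And>v. finite (fib v) \<and> card (fib v) \<le> n"
proof -
  obtain K :: "'e set" and u :: "'e \<Rightarrow> 'e \<Rightarrow> complex" where u: "finite K"
    "\<And>e. e \<in> Ed \<Longrightarrow> (\<Sum>k\<in>K. u k e * cnj (u k e)) = 1"
    "\<And>k e e'. k \<in> K \<Longrightarrow> e \<in> Ed \<Longrightarrow> e' \<in> Ed \<Longrightarrow> src E e = src E e' \<Longrightarrow> e \<noteq> e' \<Longrightarrow> u k e = 0 \<or> u k e' = 0"
    by (rule frame_exists) blast
  have "\<exists>k\<in>K. u k e \<noteq> 0" if "e \<in> Ed" for e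
  proof (rule ccontr)
    assume "\<not> ?thesis"
    then have "(\<Sum>k\<in>K. u k e * cnj (u k e)) = 0" by (intro sum.neutral) auto
    then show False using u(2)[OF that] by simp
  qed
  then have "\<forall>e\<in>Ed. \<exists>k. k \<in> K \<and> u k e \<noteq> 0" by blast
  from bchoice[OF this] obtain k where k: "\<And>e. e \<in> Ed \<Longrightarrow> k e \<in> K \<and> u (k e) e \<noteq> 0"
    by blast
  have "inj_on k (fib v)" for v
    by (rule inj_onI) (use u(3) k in \<open>metis (mono_tags, lifting) fib_def mem_Collect_eq\<close>)
  moreover have "k ` fib v \<subseteq> K" for v using k by (auto simp: fib_def)
  ultimately show thesis
    using that[of "card K"] u(1) by (meson card_inj_on_le inj_on_finite)
qed

lemma finite_fib: "finite (fib v)"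
  by (meson fib_card_bound)

text \<open>The preimage of a set that omits 0 is the \<open>s\<close>-image of a preimage under \<open>h\<close>, and \<open>s\<close> is
  both open and closed.\<close>

lemma continuous_fibre_sum_injective:
  fixes h :: "'e \<Rightarrow> complex"
  assumes h: "continuous_map (edges E) euclidean h"
    and inj: "\<And>e e'. e \<in> Ed \<Longrightarrow> e' \<in> Ed \<Longrightarrow> src E e = src E e' \<Longrightarrow> e \<noteq> e' \<Longrightarrow> h e = 0 \<or> h e' = 0"
  shows "continuous_map (vertices E) euclidean (\<lambda>v. \<Sum>e\<in>fib v. h e)"
proof -
  define g where "g v = (\<Sum>e\<in>fib v. h e)" for v
  have g: "g (src E e) = h e" if "e \<in> Ed" "h e \<noteq> 0" for e
  proof -
    have "g (src E e) = (\<Sum>e'\<in>{e}. h e')"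
      unfolding g_def
      by (rule sum.mono_neutral_right) (use that inj finite_fib in \<open>auto simp: fib_def\<close>)
    then show ?thesis by simp
  qed
  have preimage: "{v \<in> V. g v \<in> W} = src E ` {e \<in> Ed. h e \<in> W}" if "0 \<notin> W" for W
  proof (intro equalityI subsetI)
    fix v assume v: "v \<in> {v \<in> V. g v \<in> W}"
    then have "g v \<noteq> 0" using that by auto
    then obtain e where "e \<in> fib v" "h e \<noteq> 0"
      unfolding g_def by (meson sum.not_neutral_contains_not_neutral)
    then show "v \<in> src E ` {e \<in> Ed. h e \<in> W}"
      using g[of e] v by (auto simp: fib_def)
  qed (use that g src_in in fastforce)
  have "openin (vertices E) {v \<in> V. g v \<in> W}" if W: "open W" for W
  proof (cases "0 \<in> W")
    case True
    have "closedin (edges E) {e \<in> Ed. h e \<in> - W}"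
      using W h by (intro closedin_continuous_map_preimage[OF h]) auto
    then have "closedin (vertices E) {v \<in> V. g v \<in> - W}"
      using True by (subst preimage) (auto intro: src_closed_map)
    moreover have "{v \<in> V. g v \<in> W} = V - {v \<in> V. g v \<in> - W}" by auto
    ultimately show ?thesis by (metis openin_diff openin_topspace)
  next
    case False
    have "openin (edges E) {e \<in> Ed. h e \<in> W}"
      using W h by (intro openin_continuous_map_preimage[OF h]) auto
    then show ?thesis using False by (subst preimage) (auto intro: src_open_map)
  qed
  then show ?thesis by (simp add: continuous_map_def g_def)
qed

lemma CE_continuous: "f \<in> CE \<Longrightarrow> continuous_map (edges E) euclidean f"
  by (simp add: CE_iff)

lemma CE_off: "f \<in> CE \<Longrightarrow> e \<notin> Ed \<Longrightarrow> f e = 0"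
  by (simp add: CE_iff)

lemma CE_zero: "(\<lambda>_. 0) \<in> CE"
  by (simp add: CE_iff)

lemma CE_add: "f \<in> CE \<Longrightarrow> g \<in> CE \<Longrightarrow> (\<lambda>e. f e + g e) \<in> CE"
  by (auto simp: CE_iff continuous_map_euclidean_iff intro!: tendsto_intros)

lemma CE_diff: "f \<in> CE \<Longrightarrow> g \<in> CE \<Longrightarrow> (\<lambda>e. f e - g e) \<in> CE"
  by (auto simp: CE_iff continuous_map_euclidean_iff intro!: tendsto_intros)

lemma CE_cmult: "f \<in> CE \<Longrightarrow> (\<lambda>e. c * f e) \<in> CE"
  by (auto simp: CE_iff continuous_map_euclidean_iff intro!: tendsto_intros)

lemma CE_mult: "f \<in> CE \<Longrightarrow> continuous_map (edges E) euclidean h \<Longrightarrow> (\<lambda>e. f e * h e) \<in> CE"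
  by (auto simp: CE_iff continuous_map_euclidean_iff intro!: tendsto_intros)

lemma CE_sum: "(\<And>k. k \<in> K \<Longrightarrow> f k \<in> CE) \<Longrightarrow> (\<lambda>e. \<Sum>k\<in>K. f k e) \<in> CE"
  by (auto simp: CE_iff continuous_map_euclidean_iff intro!: tendsto_intros)

lemma CV_continuous: "a \<in> CV \<Longrightarrow> continuous_map (vertices E) euclidean a"
  by (simp add: CV_iff)

lemma continuous_map_src: "a \<in> CV \<Longrightarrow> continuous_map (edges E) euclidean (\<lambda>e. a (src E e))"
  using continuous_map_compose[OF src_continuous CV_continuous] by (simp add: o_def)

lemma continuous_map_rng: "a \<in> CV \<Longrightarrow> continuous_map (edges E) euclidean (\<lambda>e. a (rng E e))"
  using continuous_map_compose[OF rng_continuous CV_continuous] by (simp add: o_def)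

lemma CE_ract: "f \<in> CE \<Longrightarrow> a \<in> CV \<Longrightarrow> (\<lambda>e. f e * a (src E e)) \<in> CE"
  by (intro CE_mult continuous_map_src)

lemma CE_lact: "f \<in> CE \<Longrightarrow> a \<in> CV \<Longrightarrow> (\<lambda>e. a (rng E e) * f e) \<in> CE"
  using CE_mult[OF _ continuous_map_rng] by (simp add: mult.commute)

lemma compact_continuous_bounded:
  fixes f :: "'c \<Rightarrow> complex"
  assumes "compact_space X" "continuous_map X euclidean f"
  obtains C where "0 \<le> C" "\<And>x. x \<in> topspace X \<Longrightarrow> cmod (f x) \<le> C"
proof -
  have "compact (f ` topspace X)"
    using image_compactin[OF _ assms(2)] assms(1) by (simp add: compact_space_def)
  then obtain C where "\<And>x. x \<in> topspace X \<Longrightarrow> cmod (f x) \<le> C"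
    using compact_imp_bounded by (force simp: bounded_iff)
  then show thesis using that[of "max 0 C"] by (simp add: le_max_iff_disj)
qed

lemma CE_bounded:
  assumes "f \<in> CE" obtains C where "0 \<le> C" "\<And>e. cmod (f e) \<le> C"
proof -
  obtain C where "0 \<le> C" "\<And>e. e \<in> Ed \<Longrightarrow> cmod (f e) \<le> C"
    using compact_continuous_bounded[OF compact_edges CE_continuous[OF assms]] by blast
  then show thesis using that[of C] CE_off[OF assms] by (metis norm_zero)
qed

lemma CV_bounded:
  assumes "a \<in> CV" obtains C where "0 \<le> C" "\<And>v. cmod (a v) \<le> C"
proof -
  obtain C where "0 \<le> C" "\<And>v. v \<in> V \<Longrightarrow> cmod (a v) \<le> C"
    using compact_continuous_bounded[OF compact_vertices CV_continuous[OF assms]] by blast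
  then show thesis using that[of C] assms by (metis CV_iff norm_zero)
qed

text \<open>Inserting the partition of unity splits \<open>h\<close> into finitely many functions,
  each with at most one nonzero value per fibre, which is the injective case.\<close>

lemma continuous_fibre_sum:
  fixes h :: "'e \<Rightarrow> complex"
  assumes h: "continuous_map (edges E) euclidean h"
  shows "continuous_map (vertices E) euclidean (\<lambda>v. \<Sum>e\<in>fib v. h e)"
proof -
  obtain K :: "'e set" and u :: "'e \<Rightarrow> 'e \<Rightarrow> complex" where u: "finite K" "\<And>k. k \<in> K \<Longrightarrow> u k \<in> CE"
    "\<And>e. e \<in> Ed \<Longrightarrow> (\<Sum>k\<in>K. u k e * cnj (u k e)) = 1"
    "\<And>k e e'. k \<in> K \<Longrightarrow> e \<in> Ed \<Longrightarrow> e' \<in> Ed \<Longrightarrow> src E e = src E e' \<Longrightarrow> e \<noteq> e' \<Longrightarrow> u k e = 0 \<or> u k e' = 0"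
    by (rule frame_exists) blast
  have "continuous_map (vertices E) euclidean (\<lambda>v. \<Sum>e\<in>fib v. u k e * cnj (u k e) * h e)" if "k \<in> K" for k
  proof (rule continuous_fibre_sum_injective)
    show "continuous_map (edges E) euclidean (\<lambda>e. u k e * cnj (u k e) * h e)"
      using h CE_continuous[OF u(2)[OF that]]
      by (auto simp: continuous_map_euclidean_iff intro!: tendsto_intros)
  qed (use u(4)[OF that] in fastforce)
  then have "continuous_map (vertices E) euclidean
      (\<lambda>v. \<Sum>k\<in>K. \<Sum>e\<in>fib v. u k e * cnj (u k e) * h e)"
    by (auto simp: continuous_map_euclidean_iff intro!: tendsto_intros)
  also have "(\<lambda>v. \<Sum>k\<in>K. \<Sum>e\<in>fib v. u k e * cnj (u k e) * h e) = (\<lambda>v. \<Sum>e\<in>fib v. h e)"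
  proof
    fix v
    have "(\<Sum>k\<in>K. \<Sum>e\<in>fib v. u k e * cnj (u k e) * h e) = (\<Sum>e\<in>fib v. (\<Sum>k\<in>K. u k e * cnj (u k e)) * h e)"
      by (subst sum.swap) (simp add: sum_distrib_right)
    also have "\<dots> = (\<Sum>e\<in>fib v. h e)"
      by (rule sum.cong) (use fib_subset u(3) in auto)
    finally show "(\<Sum>k\<in>K. \<Sum>e\<in>fib v. u k e * cnj (u k e) * h e) = (\<Sum>e\<in>fib v. h e)" .
  qed
  finally show ?thesis .
qed

section \<open>The inner product and the module norm\<close>

lemma edge_inner_eq: "v \<in> V \<Longrightarrow> edge_inner E f g v = (\<Sum>e\<in>fib v. cnj (f e) * g e)"
  by (simp add: edge_inner_def finite_fib flip: fib_def)

lemma edge_inner_src: "e \<in> Ed \<Longrightarrow> edge_inner E f g (src E e) = (\<Sum>e'\<in>fib (src E e). cnj (f e') * g e')"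
  by (simp add: edge_inner_eq src_in)

lemma edge_inner_off: "v \<notin> V \<Longrightarrow> edge_inner E f g v = 0"
  by (simp add: edge_inner_def)

lemma edge_inner_CV:
  assumes "f \<in> CE" "g \<in> CE" shows "edge_inner E f g \<in> CV"
proof -
  have "continuous_map (edges E) euclidean (\<lambda>e. cnj (f e) * g e)"
    using assms[THEN CE_continuous] by (auto simp: continuous_map_euclidean_iff intro!: tendsto_intros)
  then have "continuous_map (vertices E) euclidean (\<lambda>v. \<Sum>e\<in>fib v. cnj (f e) * g e)"
    by (rule continuous_fibre_sum)
  then have "continuous_map (vertices E) euclidean (edge_inner E f g)"
    by (rule continuous_map_eq) (simp add: edge_inner_eq)
  then show ?thesis by (simp add: CV_iff edge_inner_off)
qed

lemma edge_inner_cnj: "cnj (edge_inner E f g v) = edge_inner E g f v"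
  by (cases "v \<in> V") (simp_all add: edge_inner_eq edge_inner_off mult.commute)

lemma edge_inner_self:
  "v \<in> V \<Longrightarrow> edge_inner E f f v = complex_of_real ((L2_set (\<lambda>e. cmod (f e)) (fib v))\<^sup>2)"
  by (simp add: edge_inner_eq L2_set_def sum_nonneg complex_norm_square mult.commute flip: of_real_power)

text \<open>Together with \<open>L2_set_le_edge_norm\<close> this identifies the module norm as the
  supremum over the vertices of the l2 norms on the fibres. The other bound asks for a continuous
  function, so that the supremum is taken over a bounded set.\<close>

lemma edge_norm_le:
  assumes "0 \<le> c" "\<And>v. v \<in> V \<Longrightarrow> L2_set (\<lambda>e. cmod (f e)) (fib v) \<le> c"
  shows "edge_norm E f \<le> c"
proof -
  have "sup_norm (vertices E) (edge_inner E f f) \<le> c\<^sup>2"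
    unfolding sup_norm_def
    by (rule cSup_least) (use assms in \<open>auto simp: edge_inner_self norm_of_real power_mono
        simp del: of_real_power\<close>)
  then show ?thesis
    unfolding edge_norm_def using assms(1) by (simp add: real_le_lsqrt)
qed

lemma L2_set_le_edge_norm:
  assumes f: "f \<in> CE" and v: "v \<in> V"
  shows "L2_set (\<lambda>e. cmod (f e)) (fib v) \<le> edge_norm E f"
proof -
  obtain C where "\<And>v. cmod (edge_inner E f f v) \<le> C"
    using CV_bounded[OF edge_inner_CV[OF f f]] by blast
  then have "bdd_above (insert 0 ((\<lambda>v. cmod (edge_inner E f f v)) ` V))"
    by (auto intro!: bdd_aboveI2)
  then have "cmod (edge_inner E f f v) \<le> sup_norm (vertices E) (edge_inner E f f)"
    unfolding sup_norm_def using v by (intro cSup_upper) auto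
  then show ?thesis
    unfolding edge_norm_def using v
    by (intro real_le_rsqrt) (simp add: edge_inner_self norm_of_real del: of_real_power)
qed

text \<open>The 0 inserted in \<open>sup_norm\<close> yields nonnegativity once the set is known to
  be bounded above; the supremum of an unbounded set of reals is unspecified.\<close>

lemma edge_norm_nonneg:
  assumes "f \<in> CE" shows "0 \<le> edge_norm E f"
proof -
  obtain C where "\<And>v. cmod (edge_inner E f f v) \<le> C"
    using CV_bounded[OF edge_inner_CV[OF assms assms]] by blast
  then have "bdd_above (insert 0 ((\<lambda>v. cmod (edge_inner E f f v)) ` V))"
    by (auto intro!: bdd_aboveI2)
  then have "0 \<le> sup_norm (vertices E) (edge_inner E f f)"
    unfolding sup_norm_def by (rule cSup_upper[rotated]) simp
  then show ?thesis by (simp add: edge_norm_def)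
qed

lemma norm_le_edge_norm: "f \<in> CE \<Longrightarrow> cmod (f e) \<le> edge_norm E f"
proof (cases "e \<in> Ed")
  case True
  assume "f \<in> CE"
  have "cmod (f e) \<le> L2_set (\<lambda>e. cmod (f e)) (fib (src E e))"
    using True by (intro member_le_L2_set finite_fib fib_src)
  then show ?thesis
    using L2_set_le_edge_norm[OF \<open>f \<in> CE\<close> src_in[OF True]] by simp
qed (simp add: CE_off edge_norm_nonneg)

lemma edge_norm_eq_0: "f \<in> CE \<Longrightarrow> edge_norm E f = 0 \<Longrightarrow> f = (\<lambda>_. 0)"
proof (rule ext)
  fix e assume "f \<in> CE" "edge_norm E f = 0"
  then show "f e = 0" using norm_le_edge_norm[of f e] by simp
qed

lemma edge_norm_zero: "edge_norm E (\<lambda>_. 0) = 0"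
  using edge_norm_le[of 0 "\<lambda>_. 0"] edge_norm_nonneg[OF CE_zero] by (simp add: L2_set_def)

lemma edge_norm_triangle:
  assumes "f \<in> CE" "g \<in> CE"
  shows "edge_norm E (\<lambda>e. f e + g e) \<le> edge_norm E f + edge_norm E g"
proof (rule edge_norm_le)
  fix v assume v: "v \<in> V"
  have "L2_set (\<lambda>e. cmod (f e + g e)) (fib v) \<le> L2_set (\<lambda>e. cmod (f e) + cmod (g e)) (fib v)"
    by (intro L2_set_mono norm_triangle_ineq) simp
  also have "\<dots> \<le> L2_set (\<lambda>e. cmod (f e)) (fib v) + L2_set (\<lambda>e. cmod (g e)) (fib v)"
    by (rule L2_set_triangle_ineq)
  also have "\<dots> \<le> edge_norm E f + edge_norm E g"
    using assms v by (intro add_mono L2_set_le_edge_norm)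
  finally show "L2_set (\<lambda>e. cmod (f e + g e)) (fib v) \<le> edge_norm E f + edge_norm E g" .
qed (use assms in \<open>simp add: edge_norm_nonneg\<close>)

lemma edge_norm_mult_le:
  assumes "f \<in> CE" "0 \<le> C" "\<And>e. cmod (h e) \<le> C"
  shows "edge_norm E (\<lambda>e. h e * f e) \<le> C * edge_norm E f"
proof (rule edge_norm_le)
  fix v assume v: "v \<in> V"
  have "L2_set (\<lambda>e. cmod (h e * f e)) (fib v) \<le> L2_set (\<lambda>e. C * cmod (f e)) (fib v)"
    using assms by (intro L2_set_mono) (auto simp: norm_mult mult_right_mono)
  also have "\<dots> = C * L2_set (\<lambda>e. cmod (f e)) (fib v)"
    using assms by (simp add: L2_set_right_distrib)
  also have "\<dots> \<le> C * edge_norm E f"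
    using assms v by (intro mult_left_mono L2_set_le_edge_norm)
  finally show "L2_set (\<lambda>e. cmod (h e * f e)) (fib v) \<le> C * edge_norm E f" .
qed (use assms in \<open>simp add: edge_norm_nonneg\<close>)

lemma edge_norm_minus_commute: "edge_norm E (\<lambda>e. f e - g e) = edge_norm E (\<lambda>e. g e - f e)"
proof -
  have "edge_inner E (\<lambda>e. f e - g e) (\<lambda>e. f e - g e) = edge_inner E (\<lambda>e. g e - f e) (\<lambda>e. g e - f e)"
    unfolding edge_inner_def by (intro ext if_cong infsum_cong) (auto simp: algebra_simps)
  then show ?thesis by (simp add: edge_norm_def)
qed

text \<open>On a fibre with at most n points the l2 norm is at most the l1 norm, hence at most n
  times the maximum. With \<open>norm_le_edge_norm\<close> this makes the module norm equivalent to
  the uniform norm.\<close>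

lemma edge_norm_le_sup:
  obtains B where "0 \<le> B" "\<And>f c. 0 \<le> c \<Longrightarrow> (\<And>e. e \<in> Ed \<Longrightarrow> cmod (f e) \<le> c) \<Longrightarrow> edge_norm E f \<le> B * c"
proof -
  obtain n where n: "\<And>v. finite (fib v) \<and> card (fib v) \<le> n" by (rule fib_card_bound) blast
  show thesis
  proof (rule that[of "real n"])
    fix f :: "'e \<Rightarrow> complex" and c :: real
    assume c: "0 \<le> c" "\<And>e. e \<in> Ed \<Longrightarrow> cmod (f e) \<le> c"
    show "edge_norm E f \<le> real n * c"
    proof (rule edge_norm_le)
      fix v
      have "L2_set (\<lambda>e. cmod (f e)) (fib v) \<le> (\<Sum>e\<in>fib v. cmod (f e))"
        by (rule L2_set_le_sum) simp
      also have "\<dots> \<le> real (card (fib v)) * c"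
        using c(2) fib_subset by (intro sum_bounded_above) auto
      also have "\<dots> \<le> real n * c" using n c(1) by (simp add: mult_right_mono)
      finally show "L2_set (\<lambda>e. cmod (f e)) (fib v) \<le> real n * c" .
    qed (use c in simp)
  qed simp
qed

text \<open>The image of r is compact, hence closed. Such a function lies in the kernel of the left
  action; it serves as a test function both for J_X and for the surjectivity of r.\<close>

lemma CV_bump_off_range:
  assumes "v \<in> V" "v \<notin> rng E ` Ed"
  obtains b where "b \<in> CV" "b v = 1" "\<And>e. e \<in> Ed \<Longrightarrow> b (rng E e) = 0"
proof -
  have "closedin (vertices E) (rng E ` Ed)"
    using continuous_imp_closed_map[OF rng_continuous compact_edges vertices_t2] closed_map_def
    by blast
  then have "openin (vertices E) (V - rng E ` Ed)" by blast
  from compact_Hausdorff_complex_bump[OF compact_vertices vertices_t2 this, of v] assms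
  obtain b where b: "continuous_map (vertices E) euclidean b" "b v = 1"
    "\<And>w. w \<notin> V - rng E ` Ed \<Longrightarrow> b w = (0 :: complex)" by blast
  show thesis
    by (rule that[of b]) (use b in \<open>auto simp: CV_iff\<close>)
qed

text \<open>The other points of the fibre are finitely many, so they form a closed set in a
  Hausdorff space.\<close>

lemma CE_bump_on_fibre:
  assumes "e \<in> Ed"
  obtains f where "f \<in> CE" "f e = 1" "\<And>e'. e' \<in> fib (src E e) \<Longrightarrow> e' \<noteq> e \<Longrightarrow> f e' = 0"
proof -
  have "closedin (edges E) (fib (src E e) - {e})"
    by (rule closedin_Hausdorff_finite[OF edges_t2]) (use finite_fib fib_subset in auto)
  then have "openin (edges E) (Ed - (fib (src E e) - {e}))" by blast
  from compact_Hausdorff_complex_bump[OF compact_edges edges_t2 this, of e] assms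
  obtain f where f: "continuous_map (edges E) euclidean f" "f e = 1"
    "\<And>x. x \<notin> Ed - (fib (src E e) - {e}) \<Longrightarrow> f x = (0 :: complex)" by blast
  show thesis
    by (rule that[of f]) (use f in \<open>auto simp: CE_iff\<close>)
qed

section \<open>Completeness of the continuous functions and the structure of X(E)\<close>

lemma edge_dist_eq: "f \<in> CE \<Longrightarrow> g \<in> CE \<Longrightarrow> edge_dist E f g = edge_norm E (\<lambda>e. f e - g e)"
  by (simp add: edge_dist_def)

lemma Metric_space_edge_dist: "Metric_space CE (edge_dist E)"
proof
  show "0 \<le> edge_dist E f g" for f g
    by (simp add: edge_dist_def edge_norm_nonneg CE_diff)
  show "edge_dist E f g = edge_dist E g f" for f g
    by (simp add: edge_dist_def edge_norm_minus_commute[of f g])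
  show "edge_dist E f g = 0 \<longleftrightarrow> f = g" if "f \<in> CE" "g \<in> CE" for f g
  proof
    assume "edge_dist E f g = 0"
    then have "(\<lambda>e. f e - g e) = (\<lambda>_. 0)"
      using that by (intro edge_norm_eq_0) (simp_all add: edge_dist_eq CE_diff)
    then show "f = g" by (simp add: fun_eq_iff)
  qed (use that in \<open>simp add: edge_dist_eq edge_norm_zero\<close>)
  show "edge_dist E f h \<le> edge_dist E f g + edge_dist E g h"
    if "f \<in> CE" "g \<in> CE" "h \<in> CE" for f g h
    using edge_norm_triangle[OF CE_diff[OF that(1,2)] CE_diff[OF that(2,3)]] that
    by (simp add: edge_dist_eq)
qed

lemma edge_cauchy_iff:
  "s \<in> edge_cauchy E \<longleftrightarrow> range s \<subseteq> CE \<and>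
     (\<forall>\<epsilon>>0. \<exists>N. \<forall>n n'. N \<le> n \<longrightarrow> N \<le> n' \<longrightarrow> edge_dist E (s n) (s n') < \<epsilon>)"
  by (simp add: edge_cauchy_def Metric_space.MCauchy_def[OF Metric_space_edge_dist])

definition edge_conv :: "(nat \<Rightarrow> 'e \<Rightarrow> complex) \<Rightarrow> ('e \<Rightarrow> complex) \<Rightarrow> bool" where
  "edge_conv s f \<longleftrightarrow> f \<in> CE \<and> range s \<subseteq> CE \<and> (\<lambda>n. edge_dist E (s n) f) \<longlonglongrightarrow> 0"

lemma edge_conv_CE: "edge_conv s f \<Longrightarrow> f \<in> CE" "edge_conv s f \<Longrightarrow> s n \<in> CE"
  by (auto simp: edge_conv_def)

lemma edge_conv_norm:
  assumes "edge_conv s f" shows "(\<lambda>n. edge_norm E (\<lambda>e. s n e - f e)) \<longlonglongrightarrow> 0"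
proof -
  have "(\<lambda>n. edge_dist E (s n) f) \<longlonglongrightarrow> 0" using assms by (simp add: edge_conv_def)
  then show ?thesis using edge_conv_CE[OF assms] by (simp add: edge_dist_eq)
qed

lemma edge_convI:
  assumes "f \<in> CE" "\<And>n. s n \<in> CE" "c \<longlonglongrightarrow> 0" "\<And>n. edge_norm E (\<lambda>e. s n e - f e) \<le> c n"
  shows "edge_conv s f"
proof -
  have "(\<lambda>n. edge_norm E (\<lambda>e. s n e - f e)) \<longlonglongrightarrow> 0"
    by (intro tendsto_sandwich[OF _ _ tendsto_const assms(3)] always_eventually allI assms(4)
        edge_norm_nonneg CE_diff assms(1,2))
  then show ?thesis using assms(1,2) by (simp add: edge_conv_def edge_dist_eq image_subset_iff)
qed

lemma edge_conv_const: "f \<in> CE \<Longrightarrow> edge_conv (\<lambda>_. f) f"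
  by (auto simp: edge_conv_def edge_dist_eq edge_norm_zero)

lemma edge_conv_cauchy:
  assumes "edge_conv s f" shows "s \<in> edge_cauchy E"
proof -
  interpret Metric_space CE "edge_dist E" by (rule Metric_space_edge_dist)
  have "limitin mtopology s f sequentially"
    using assms by (simp add: edge_conv_def limitin_metric_dist_null image_subset_iff)
  then show ?thesis
    using assms convergent_imp_MCauchy by (auto simp: edge_conv_def edge_cauchy_def)
qed

text \<open>A Cauchy sequence for the module norm is uniformly Cauchy, so its pointwise limit is
  continuous; the equivalence of the norms then turns uniform convergence back into module
  convergence.\<close>

lemma edge_cauchy_conv:
  assumes "s \<in> edge_cauchy E"
  obtains f where "edge_conv s f"
proof -
  have s: "s n \<in> CE" for n using assms by (auto simp: edge_cauchy_iff)
  have cauchy: "\<exists>N. \<forall>n\<ge>N. \<forall>m\<ge>N. \<forall>e. cmod (s n e - s m e) < \<epsilon>" if "\<epsilon> > 0" for \<epsilon>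
  proof -
    have "\<exists>N. \<forall>n n'. N \<le> n \<longrightarrow> N \<le> n' \<longrightarrow> edge_dist E (s n) (s n') < \<epsilon>"
      using assms that unfolding edge_cauchy_iff by blast
    then obtain N where N: "\<And>n m. n \<ge> N \<Longrightarrow> m \<ge> N \<Longrightarrow> edge_dist E (s n) (s m) < \<epsilon>"
      by blast
    have "cmod (s n e - s m e) < \<epsilon>" if "n \<ge> N" "m \<ge> N" for n m e
      using norm_le_edge_norm[OF CE_diff[OF s[of n] s[of m]], of e] N[OF that] by (simp add: edge_dist_eq s)
    then show ?thesis by blast
  qed
  have "Cauchy (\<lambda>n. s n e)" for e
    unfolding Cauchy_iff
  proof (intro allI impI)
    fix \<epsilon> :: real assume "\<epsilon> > 0"
    from cauchy[OF this] show "\<exists>M. \<forall>m\<ge>M. \<forall>n\<ge>M. norm (s m e - s n e) < \<epsilon>" by blast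
  qed
  then obtain f where f: "\<And>e. (\<lambda>n. s n e) \<longlonglongrightarrow> f e"
    unfolding Cauchy_convergent_iff convergent_def by metis
  have uniform: "\<exists>N. \<forall>n\<ge>N. \<forall>e. cmod (s n e - f e) \<le> \<epsilon>" if "\<epsilon> > 0" for \<epsilon>
  proof -
    obtain N where N: "\<And>n m e. n \<ge> N \<Longrightarrow> m \<ge> N \<Longrightarrow> cmod (s n e - s m e) < \<epsilon>"
      using cauchy[OF \<open>\<epsilon> > 0\<close>] by blast
    have "cmod (s n e - f e) \<le> \<epsilon>" if "n \<ge> N" for n e
    proof (rule tendsto_upperbound)
      show "(\<lambda>m. cmod (s n e - s m e)) \<longlonglongrightarrow> cmod (s n e - f e)" by (intro tendsto_intros f)
      show "\<forall>\<^sub>F m in sequentially. cmod (s n e - s m e) \<le> \<epsilon>"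
        using N[OF that] by (intro eventually_sequentiallyI[of N]) (simp add: less_imp_le)
    qed simp
    then show ?thesis by blast
  qed
  have fCE: "f \<in> CE"
    unfolding CE_iff continuous_map_euclidean_iff
  proof (intro conjI ballI allI impI)
    fix x assume x: "x \<in> Ed"
    show "(f \<longlongrightarrow> f x) (atin (edges E) x)"
      unfolding tendsto_iff
    proof (intro allI impI)
      \<comment> \<open>Three errors enter the comparison of two values of \<open>f\<close>. With a
        quarter of the tolerance for each, the final inequality is strict although the uniform
        bounds are not.\<close>
      fix \<epsilon> :: real assume "\<epsilon> > 0"
      then obtain n where n: "\<And>e. cmod (s n e - f e) \<le> \<epsilon> / 4"
        using uniform[of "\<epsilon> / 4"] by auto
      have "(s n \<longlongrightarrow> s n x) (atin (edges E) x)"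
        using CE_continuous[OF s] x by (simp add: continuous_map_euclidean_iff)
      then have "\<forall>\<^sub>F y in atin (edges E) x. dist (s n y) (s n x) < \<epsilon> / 4"
        using \<open>\<epsilon> > 0\<close> unfolding tendsto_iff by (simp del: divide_const_simps)
      then show "\<forall>\<^sub>F y in atin (edges E) x. dist (f y) (f x) < \<epsilon>"
      proof (rule eventually_mono)
        fix y assume "dist (s n y) (s n x) < \<epsilon> / 4"
        moreover have "dist (f y) (f x) \<le> dist (s n y) (f y) + dist (s n y) (s n x) + dist (s n x) (f x)"
          using dist_triangle2[of "f y" "f x" "s n x"] dist_triangle[of "f y" "s n x" "s n y"]
          by (simp add: dist_commute)
        ultimately show "dist (f y) (f x) < \<epsilon>"
          using n[of y] n[of x] \<open>\<epsilon> > 0\<close> by (simp add: dist_norm)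
      qed
    qed
  next
    fix e assume "e \<notin> Ed"
    then have "(\<lambda>n. s n e) \<longlonglongrightarrow> 0" using CE_off[OF s] by simp
    then show "f e = 0" using f LIMSEQ_unique by blast
  qed
  obtain B where B: "0 \<le> B"
    "\<And>f c. 0 \<le> c \<Longrightarrow> (\<And>e. e \<in> Ed \<Longrightarrow> cmod (f e) \<le> c) \<Longrightarrow> edge_norm E f \<le> B * c"
    by (rule edge_norm_le_sup) blast
  have "(\<lambda>n. edge_norm E (\<lambda>e. s n e - f e)) \<longlonglongrightarrow> 0"
    unfolding LIMSEQ_iff
  proof (intro allI impI)
    fix \<epsilon> :: real assume "\<epsilon> > 0"
    \<comment> \<open>The denominator \<open>B + 1\<close> covers the case \<open>B = 0\<close> and
      makes \<open>B * (\<epsilon> / (B + 1))\<close> strictly smaller than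
      \<open>\<epsilon>\<close>.\<close>
    then have pos: "\<epsilon> / (B + 1) > 0" using B(1) by simp
    obtain N where N: "\<And>n e. n \<ge> N \<Longrightarrow> cmod (s n e - f e) \<le> \<epsilon> / (B + 1)"
      using uniform[OF pos] by blast
    have "norm (edge_norm E (\<lambda>e. s n e - f e) - 0) < \<epsilon>" if "n \<ge> N" for n
    proof -
      have "edge_norm E (\<lambda>e. s n e - f e) \<le> B * (\<epsilon> / (B + 1))"
        using N[OF that] pos by (intro B(2)) auto
      also have "\<dots> < \<epsilon>" using B(1) \<open>\<epsilon> > 0\<close> by (simp add: field_simps)
      finally show ?thesis by (simp add: edge_norm_nonneg CE_diff s fCE)
    qed
    then show "\<exists>no. \<forall>n\<ge>no. norm (edge_norm E (\<lambda>e. s n e - f e) - 0) < \<epsilon>" by blast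
  qed
  then have "edge_conv s f" using s fCE by (auto simp: edge_conv_def edge_dist_eq)
  then show thesis by (rule that)
qed

text \<open>The canonical map into the completion by constant sequences; \<open>cls_inj\<close> and
  \<open>carrier_graph_corr\<close> make it a bijection.\<close>

definition cls :: "('e \<Rightarrow> complex) \<Rightarrow> (nat \<Rightarrow> 'e \<Rightarrow> complex) set" where
  "cls f = edge_class E (\<lambda>_. f)"

lemma in_cls_iff: "f \<in> CE \<Longrightarrow> t \<in> cls f \<longleftrightarrow> edge_conv t f"
  unfolding cls_def edge_class_def edge_conv_def Metric_space.commute[OF Metric_space_edge_dist, of f]
  using edge_conv_cauchy[of t f] unfolding edge_conv_def edge_cauchy_iff by blast

text \<open>A class depends only on the limit: the triangle inequality exchanges \<open>s n\<close>
  for \<open>f\<close> up to an error tending to 0.\<close>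

lemma edge_class_eq:
  assumes "edge_conv s f" shows "edge_class E s = cls f"
proof -
  interpret Metric_space CE "edge_dist E" by (rule Metric_space_edge_dist)
  have f: "f \<in> CE" "\<And>n. s n \<in> CE" and sf: "(\<lambda>n. edge_dist E (s n) f) \<longlonglongrightarrow> 0"
    using assms by (auto simp: edge_conv_def)
  have "(\<lambda>n. edge_dist E (s n) (t n)) \<longlonglongrightarrow> 0 \<longleftrightarrow> (\<lambda>n. edge_dist E f (t n)) \<longlonglongrightarrow> 0"
    if "t \<in> edge_cauchy E" for t
  proof -
    have t: "t n \<in> CE" for n using that by (auto simp: edge_cauchy_iff)
    show ?thesis
    proof
      assume "(\<lambda>n. edge_dist E (s n) (t n)) \<longlonglongrightarrow> 0"
      note lim = tendsto_add_zero[OF sf this]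
      have "edge_dist E f (t n) \<le> edge_dist E (s n) f + edge_dist E (s n) (t n)" for n
        using triangle[OF f(1) f(2) t, of n n] by (simp add: commute[of f "s n"])
      then show "(\<lambda>n. edge_dist E f (t n)) \<longlonglongrightarrow> 0"
        by (intro tendsto_sandwich[OF _ _ tendsto_const lim] always_eventually allI) auto
    next
      assume "(\<lambda>n. edge_dist E f (t n)) \<longlonglongrightarrow> 0"
      note lim = tendsto_add_zero[OF sf this]
      have "edge_dist E (s n) (t n) \<le> edge_dist E (s n) f + edge_dist E f (t n)" for n
        using triangle[OF f(2) f(1) t, of n n] .
      then show "(\<lambda>n. edge_dist E (s n) (t n)) \<longlonglongrightarrow> 0"
        by (intro tendsto_sandwich[OF _ _ tendsto_const lim] always_eventually allI) auto
    qed
  qed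
  then show ?thesis by (auto simp: cls_def edge_class_def)
qed

lemma carrier_graph_corr: "co_carrier (graph_corr E) = cls ` CE"
proof -
  have "edge_class E ` edge_cauchy E = cls ` CE"
  proof (intro equalityI subsetI)
    fix P assume "P \<in> edge_class E ` edge_cauchy E"
    then obtain s where s: "s \<in> edge_cauchy E" "P = edge_class E s" by blast
    obtain f where "edge_conv s f" using edge_cauchy_conv[OF s(1)] by blast
    then show "P \<in> cls ` CE" using s edge_class_eq edge_conv_CE by blast
  next
    fix P assume "P \<in> cls ` CE"
    then show "P \<in> edge_class E ` edge_cauchy E"
      unfolding cls_def using edge_conv_cauchy[OF edge_conv_const] by blast
  qed
  then show ?thesis by (simp add: graph_corr_def)
qed

lemma cls_inj: "f \<in> CE \<Longrightarrow> g \<in> CE \<Longrightarrow> cls f = cls g \<longleftrightarrow> f = g"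
proof
  assume f: "f \<in> CE" and g: "g \<in> CE" and "cls f = cls g"
  then have "edge_conv (\<lambda>_. f) g"
    using in_cls_iff edge_conv_const by blast
  then have "edge_dist E f g = 0" by (simp add: edge_conv_def LIMSEQ_const_iff)
  then show "f = g" using Metric_space.zero[OF Metric_space_edge_dist f g] by simp
qed simp

text \<open>Whichever representative the choice operator returns, it converges to \<open>f\<close>.
  Since the operations respect limits, they reduce to pointwise formulas on functions.\<close>

lemma some_rep_cls: "f \<in> CE \<Longrightarrow> edge_conv (some_rep (cls f)) f"
  unfolding some_rep_def by (metis edge_conv_const in_cls_iff someI)

lemma edge_conv_add:
  assumes "edge_conv s f" "edge_conv t g"
  shows "edge_conv (\<lambda>n e. s n e + t n e) (\<lambda>e. f e + g e)"
proof (rule edge_convI)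
  note CE = edge_conv_CE[OF assms(1)] edge_conv_CE[OF assms(2)]
  show "edge_norm E (\<lambda>e. (s n e + t n e) - (f e + g e))
      \<le> edge_norm E (\<lambda>e. s n e - f e) + edge_norm E (\<lambda>e. t n e - g e)" for n
    using edge_norm_triangle[OF CE_diff CE_diff, OF CE(2,1,4,3), of n n] by (simp add: algebra_simps)
  show "(\<lambda>n. edge_norm E (\<lambda>e. s n e - f e) + edge_norm E (\<lambda>e. t n e - g e)) \<longlonglongrightarrow> 0"
    using assms by (intro tendsto_add_zero edge_conv_norm)
qed (use assms in \<open>auto intro: CE_add edge_conv_CE\<close>)

text \<open>Scalar multiplication and both module actions are multiplication by a bounded function
  \<open>h\<close> that preserves continuity, so one lemma handles all three.\<close>

lemma edge_conv_mult:
  assumes "edge_conv s f" "\<And>e. cmod (h e) \<le> C" "\<And>g. g \<in> CE \<Longrightarrow> (\<lambda>e. h e * g e) \<in> CE"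
  shows "edge_conv (\<lambda>n e. h e * s n e) (\<lambda>e. h e * f e)"
proof (rule edge_convI)
  note CE = edge_conv_CE[OF assms(1)]
  have "0 \<le> C" using assms(2) norm_ge_zero order_trans by blast
  then show "edge_norm E (\<lambda>e. h e * s n e - h e * f e) \<le> C * edge_norm E (\<lambda>e. s n e - f e)" for n
    using edge_norm_mult_le[OF CE_diff[OF CE(2,1)] _ assms(2)] by (simp add: algebra_simps)
  show "(\<lambda>n. C * edge_norm E (\<lambda>e. s n e - f e)) \<longlonglongrightarrow> 0"
    using assms by (intro tendsto_mult_right_zero edge_conv_norm)
qed (use assms in \<open>auto intro: edge_conv_CE\<close>)

lemma edge_conv_nth:
  assumes "edge_conv s f" shows "(\<lambda>n. s n e) \<longlonglongrightarrow> f e"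
proof -
  have "(\<lambda>n. s n e - f e) \<longlonglongrightarrow> 0"
    by (rule Lim_null_comparison[OF _ edge_conv_norm[OF assms]])
       (intro always_eventually allI norm_le_edge_norm CE_diff edge_conv_CE[OF assms])
  then show ?thesis by (rule LIM_zero_cancel)
qed

lemma graph_corr_zero: "co_zero (graph_corr E) = cls (\<lambda>_. 0)"
  by (simp add: graph_corr_def cls_def)

lemma graph_corr_add:
  "f \<in> CE \<Longrightarrow> g \<in> CE \<Longrightarrow> co_add (graph_corr E) (cls f) (cls g) = cls (\<lambda>e. f e + g e)"
  by (simp add: graph_corr_def edge_class_eq edge_conv_add some_rep_cls)

lemma graph_corr_scale:
  "f \<in> CE \<Longrightarrow> co_scale (graph_corr E) c (cls f) = cls (\<lambda>e. c * f e)"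
  using edge_conv_mult[OF some_rep_cls, of f "\<lambda>_. c" "cmod c"]
  by (simp add: graph_corr_def edge_class_eq CE_cmult)

lemma graph_corr_ract:
  assumes "f \<in> CE" "a \<in> CV"
  shows "co_ract (graph_corr E) (cls f) a = cls (\<lambda>e. f e * a (src E e))"
proof -
  obtain C where "\<And>v. cmod (a v) \<le> C" using CV_bounded[OF assms(2)] by blast
  then have "edge_conv (\<lambda>n e. a (src E e) * some_rep (cls f) n e) (\<lambda>e. a (src E e) * f e)"
    using CE_ract[OF _ assms(2)] by (intro edge_conv_mult some_rep_cls assms) (auto simp: mult.commute)
  then show ?thesis by (simp add: graph_corr_def edge_class_eq mult.commute)
qed

lemma graph_corr_lact:
  assumes "f \<in> CE" "a \<in> CV"
  shows "co_lact (graph_corr E) a (cls f) = cls (\<lambda>e. a (rng E e) * f e)"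
proof -
  obtain C where "\<And>v. cmod (a v) \<le> C" using CV_bounded[OF assms(2)] by blast
  then have "edge_conv (\<lambda>n e. a (rng E e) * some_rep (cls f) n e) (\<lambda>e. a (rng E e) * f e)"
    using CE_lact[OF _ assms(2)] by (intro edge_conv_mult some_rep_cls assms) auto
  then show ?thesis by (simp add: graph_corr_def edge_class_eq)
qed

text \<open>Module convergence implies pointwise convergence, and finiteness of the fibres lets the
  limit pass through the sum.\<close>

lemma graph_corr_inner:
  assumes "f \<in> CE" "g \<in> CE"
  shows "co_inner (graph_corr E) (cls f) (cls g) = edge_inner E f g"
proof
  fix v
  have "(\<lambda>n. edge_inner E (some_rep (cls f) n) (some_rep (cls g) n) v) \<longlonglongrightarrow> edge_inner E f g v"
  proof (cases "v \<in> V")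
    case True
    then show ?thesis
      using assms by (simp add: edge_inner_eq) (intro tendsto_intros edge_conv_nth some_rep_cls)
  qed (simp add: edge_inner_off)
  then show "co_inner (graph_corr E) (cls f) (cls g) v = edge_inner E f g v"
    by (simp add: graph_corr_def limI)
qed

lemmas graph_corr_simps = graph_corr_zero graph_corr_add graph_corr_scale graph_corr_ract
  graph_corr_lact graph_corr_inner

end

section \<open>Adjointable operators on the graph correspondence\<close>

text \<open>A frame is fixed once and for all because the homomorphism on the operators will be
  given by a formula in it.\<close>

locale framed_graph = compact_tgraph E for E :: "('v, 'e) topgraph" +
  fixes K :: "'k set" and u :: "'k \<Rightarrow> 'e \<Rightarrow> complex"
  assumes finite_K: "finite K"
    and u_CE: "k \<in> K \<Longrightarrow> u k \<in> Cc (edges E)"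
    and u_sum: "e \<in> topspace (edges E) \<Longrightarrow> (\<Sum>k\<in>K. u k e * cnj (u k e)) = 1"
    and u_orth: "k \<in> K \<Longrightarrow> e \<in> topspace (edges E) \<Longrightarrow> e' \<in> topspace (edges E) \<Longrightarrow>
      src E e = src E e' \<Longrightarrow> e \<noteq> e' \<Longrightarrow> u k e = 0 \<or> u k e' = 0"
begin

abbreviation "X \<equiv> graph_corr E"
abbreviation "A \<equiv> C0 (vertices E)"
abbreviation "ops \<equiv> adjointable_ops A X"

text \<open>If \<open>u k e\<close> is nonzero, then \<open>u k\<close> vanishes on the rest of the
  fibre through \<open>e\<close>; so each summand collapses to
  \<open>u k e * cnj (u k e) * f e\<close>, and the weights add up to 1.\<close>

lemma frame_expansion:
  assumes "f \<in> CE"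
  shows "(\<lambda>e. \<Sum>k\<in>K. u k e * edge_inner E (u k) f (src E e)) = f"
proof
  fix e
  show "(\<Sum>k\<in>K. u k e * edge_inner E (u k) f (src E e)) = f e"
  proof (cases "e \<in> Ed")
    case True
    have "u k e * edge_inner E (u k) f (src E e) = u k e * cnj (u k e) * f e" if "k \<in> K" for k
    proof -
      have "(\<Sum>e'\<in>fib (src E e). u k e * (cnj (u k e') * f e')) = (\<Sum>e'\<in>{e}. u k e * (cnj (u k e') * f e'))"
        by (rule sum.mono_neutral_right)
           (use True u_orth[OF that] finite_fib in \<open>auto simp: fib_def\<close>)
      then show ?thesis by (simp add: edge_inner_src[OF True] sum_distrib_left mult.assoc)
    qed
    then have "(\<Sum>k\<in>K. u k e * edge_inner E (u k) f (src E e)) = (\<Sum>k\<in>K. u k e * cnj (u k e)) * f e"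
      unfolding sum_distrib_right by (intro sum.cong refl)
    then show ?thesis using u_sum[OF True] by simp
  qed (simp add: CE_off[OF u_CE] CE_off[OF assms])
qed

lemma edge_inner_sum_right:
  "edge_inner E f (\<lambda>e. \<Sum>k\<in>K. g k e * a k (src E e)) v = (\<Sum>k\<in>K. edge_inner E f (g k) v * a k v)"
proof (cases "v \<in> V")
  case True
  have "edge_inner E f (\<lambda>e. \<Sum>k\<in>K. g k e * a k (src E e)) v
      = (\<Sum>e\<in>fib v. \<Sum>k\<in>K. cnj (f e) * g k e * a k v)"
    unfolding edge_inner_eq[OF True]
    by (intro sum.cong refl) (simp add: fib_def sum_distrib_left mult.assoc)
  also have "\<dots> = (\<Sum>k\<in>K. edge_inner E f (g k) v * a k v)"
    using True by (subst sum.swap) (simp add: edge_inner_eq sum_distrib_right)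
  finally show ?thesis .
qed (simp add: edge_inner_off)

text \<open>The coefficients of the frame expansion are inner products, so the inner products
  determine the function.\<close>

lemma edge_inner_nondegenerate:
  assumes "g \<in> CE" "h \<in> CE" "\<And>f. f \<in> CE \<Longrightarrow> edge_inner E f g = edge_inner E f h"
  shows "g = h"
proof -
  have "g = (\<lambda>e. \<Sum>k\<in>K. u k e * edge_inner E (u k) g (src E e))"
    by (rule frame_expansion[OF assms(1), symmetric])
  also have "\<dots> = (\<lambda>e. \<Sum>k\<in>K. u k e * edge_inner E (u k) h (src E e))"
    by (intro ext sum.cong refl) (simp add: assms(3) u_CE)
  also have "\<dots> = h" by (rule frame_expansion[OF assms(2)])
  finally show ?thesis .
qed

section \<open>Operators on the module, read as operators on functions\<close>

definition fn :: "(nat \<Rightarrow> 'e \<Rightarrow> complex) set \<Rightarrow> 'e \<Rightarrow> complex" where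
  "fn P = inv_into CE cls P"

lemma fn_cls: "f \<in> CE \<Longrightarrow> fn (cls f) = f"
  unfolding fn_def by (rule inv_into_f_f) (auto intro: inj_onI simp: cls_inj)

lemma cls_in_carrier: "f \<in> CE \<Longrightarrow> cls f \<in> co_carrier X"
  by (simp add: carrier_graph_corr)

lemma fn_CE: "P \<in> co_carrier X \<Longrightarrow> fn P \<in> CE"
  by (auto simp: carrier_graph_corr fn_cls)

lemma cls_fn: "P \<in> co_carrier X \<Longrightarrow> cls (fn P) = P"
  by (auto simp: carrier_graph_corr fn_cls)

text \<open>Operators act on classes of Cauchy sequences; \<open>hat\<close> moves them to
  functions, where frame and inner product live, and \<open>hat_ops_simps\<close> is the
  dictionary.\<close>

definition hat :: "((nat \<Rightarrow> 'e \<Rightarrow> complex) set \<Rightarrow> (nat \<Rightarrow> 'e \<Rightarrow> complex) set) \<Rightarrow> ('e \<Rightarrow> complex) \<Rightarrow> 'e \<Rightarrow> complex" where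
  "hat T f = fn (T (cls f))"

abbreviation "maps \<equiv> co_carrier X \<rightarrow>\<^sub>E co_carrier X"

lemma hat_CE: "T \<in> maps \<Longrightarrow> f \<in> CE \<Longrightarrow> hat T f \<in> CE"
  unfolding hat_def by (rule fn_CE, erule PiE_mem, erule cls_in_carrier)

lemma cls_hat: "T \<in> maps \<Longrightarrow> f \<in> CE \<Longrightarrow> cls (hat T f) = T (cls f)"
  unfolding hat_def by (rule cls_fn, erule PiE_mem, erule cls_in_carrier)

lemma maps_eqI:
  assumes "T \<in> maps" "S \<in> maps" "\<And>f. f \<in> CE \<Longrightarrow> hat T f = hat S f"
  shows "T = S"
proof (rule PiE_ext[OF assms(1,2)])
  fix P assume "P \<in> co_carrier X"
  then obtain f where "f \<in> CE" "P = cls f" by (auto simp: carrier_graph_corr)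
  then show "T P = S P" using assms cls_hat by metis
qed

lemma is_adjoint_iff:
  assumes "T \<in> maps"
  shows "is_adjoint X T S \<longleftrightarrow> S \<in> maps \<and>
    (\<forall>f\<in>CE. \<forall>g\<in>CE. edge_inner E (hat T f) g = edge_inner E f (hat S g))"
proof -
  have "co_inner X (T (cls f)) (cls g) = edge_inner E (hat T f) g" if "f \<in> CE" "g \<in> CE" for f g
    using that assms by (simp add: graph_corr_inner hat_CE flip: cls_hat)
  moreover have "co_inner X (cls f) (S (cls g)) = edge_inner E f (hat S g)"
    if "f \<in> CE" "g \<in> CE" "S \<in> maps" for f g
    using that by (simp add: graph_corr_inner hat_CE flip: cls_hat)
  ultimately show ?thesis
    by (auto simp: is_adjoint_def carrier_graph_corr)
qed

lemma is_adjointD: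
  assumes "T \<in> maps" "is_adjoint X T S"
  shows "S \<in> maps"
    "\<And>f g. f \<in> CE \<Longrightarrow> g \<in> CE \<Longrightarrow> edge_inner E (hat T f) g = edge_inner E f (hat S g)"
  using assms(2) unfolding is_adjoint_iff[OF assms(1)] by blast+

lemma is_adjoint_sym:
  assumes "T \<in> maps" "is_adjoint X T S" shows "is_adjoint X S T"
proof -
  note S = is_adjointD[OF assms]
  have "edge_inner E (hat S f) g = edge_inner E f (hat T g)" if "f \<in> CE" "g \<in> CE" for f g
  proof
    fix v
    have "edge_inner E (hat S f) g v = cnj (edge_inner E g (hat S f) v)"
      by (simp only: edge_inner_cnj)
    also have "\<dots> = edge_inner E f (hat T g) v"
      by (simp only: S(2)[OF that(2,1), symmetric] edge_inner_cnj)
    finally show "edge_inner E (hat S f) g v = edge_inner E f (hat T g) v" .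
  qed
  then show ?thesis unfolding is_adjoint_iff[OF S(1)] using assms(1) by blast
qed

lemma is_adjoint_unique:
  assumes "T \<in> maps" "is_adjoint X T S" "is_adjoint X T S'" shows "S = S'"
proof (rule maps_eqI)
  note S = is_adjointD[OF assms(1,2)] and S' = is_adjointD[OF assms(1,3)]
  show "S \<in> maps" "S' \<in> maps" by (fact S(1) S'(1))+
  fix g assume g: "g \<in> CE"
  show "hat S g = hat S' g"
  proof (rule edge_inner_nondegenerate)
    show "hat S g \<in> CE" "hat S' g \<in> CE" by (rule hat_CE, fact S(1) S'(1), fact g)+
    show "edge_inner E f (hat S g) = edge_inner E f (hat S' g)" if "f \<in> CE" for f
      by (simp only: S(2)[OF that g, symmetric] S'(2)[OF that g, symmetric])
  qed
qed

lemma ops_carrier: "T \<in> cs_carrier ops \<longleftrightarrow> T \<in> maps \<and> (\<exists>S. is_adjoint X T S)"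
  by (simp add: adjointable_ops_def)

lemma ops_maps: "T \<in> cs_carrier ops \<Longrightarrow> T \<in> maps"
  by (simp add: ops_carrier)

lemma ops_star:
  assumes "T \<in> maps" "is_adjoint X T S" shows "cs_star ops T = S"
  unfolding adjointable_ops_def using assms is_adjoint_unique by (simp, blast intro: the_equality)

text \<open>Adjointability is the only hypothesis, so linearity over the coefficients cannot be
  taken for granted. Pairing with \<open>g\<close> moves T to its adjoint, where the frame expansion
  of \<open>f\<close> applies, and nondegeneracy returns the identity for T.\<close>

lemma hat_expansion:
  assumes "T \<in> cs_carrier ops" "f \<in> CE"
  shows "hat T f = (\<lambda>e. \<Sum>k\<in>K. hat T (u k) e * edge_inner E (u k) f (src E e))"
proof (rule edge_inner_nondegenerate)
  have T: "T \<in> maps" using assms(1) by (rule ops_maps)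
  obtain S where TS: "is_adjoint X T S" using assms(1) by (auto simp: ops_carrier)
  note S = is_adjointD[OF is_adjointD(1)[OF T TS] is_adjoint_sym[OF T TS]]
  show "hat T f \<in> CE" using T assms(2) by (rule hat_CE)
  show "(\<lambda>e. \<Sum>k\<in>K. hat T (u k) e * edge_inner E (u k) f (src E e)) \<in> CE"
    by (intro CE_sum CE_ract hat_CE[OF T] u_CE edge_inner_CV assms)
  fix g assume g: "g \<in> CE"
  show "edge_inner E g (hat T f) = edge_inner E g (\<lambda>e. \<Sum>k\<in>K. hat T (u k) e * edge_inner E (u k) f (src E e))"
  proof
    fix v
    have "edge_inner E g (\<lambda>e. \<Sum>k\<in>K. hat T (u k) e * edge_inner E (u k) f (src E e)) v =
        (\<Sum>k\<in>K. edge_inner E (hat S g) (u k) v * edge_inner E (u k) f v)"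
      unfolding edge_inner_sum_right[of g "\<lambda>k. hat T (u k)" "\<lambda>k. edge_inner E (u k) f"]
      by (intro sum.cong refl arg_cong2[of _ _ _ _ "(*)"]) (simp add: S(2)[OF g u_CE])
    also have "\<dots> = edge_inner E (hat S g) (\<lambda>e. \<Sum>k\<in>K. u k e * edge_inner E (u k) f (src E e)) v"
      by (rule edge_inner_sum_right[symmetric])
    also have "\<dots> = edge_inner E g (hat T f) v"
      by (simp add: frame_expansion assms(2) S(2)[OF g assms(2)])
    finally show "edge_inner E g (hat T f) v =
      edge_inner E g (\<lambda>e. \<Sum>k\<in>K. hat T (u k) e * edge_inner E (u k) f (src E e)) v" ..
  qed
qed

lemma hat_cmult:
  assumes "T \<in> cs_carrier ops" "f \<in> CE"
  shows "hat T (\<lambda>e. c * f e) = (\<lambda>e. c * hat T f e)"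
proof -
  have inner: "edge_inner E g (\<lambda>e. c * f e) v = c * edge_inner E g f v" for g v
    by (cases "v \<in> V") (simp_all add: edge_inner_eq edge_inner_off sum_distrib_left mult_ac)
  show ?thesis
    unfolding hat_expansion[OF assms] hat_expansion[OF assms(1) CE_cmult[OF assms(2)]]
    by (intro ext) (simp add: inner sum_distrib_left mult_ac)
qed

lemma edge_inner_bound:
  assumes "f \<in> CE" "g \<in> CE"
  shows "cmod (edge_inner E f g v) \<le> edge_norm E f * edge_norm E g"
proof (cases "v \<in> V")
  case True
  have "cmod (edge_inner E f g v) \<le> (\<Sum>e\<in>fib v. \<bar>cmod (f e)\<bar> * \<bar>cmod (g e)\<bar>)"
    unfolding edge_inner_eq[OF True] by (rule order_trans[OF norm_sum]) (simp add: norm_mult)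
  also have "\<dots> \<le> L2_set (\<lambda>e. cmod (f e)) (fib v) * L2_set (\<lambda>e. cmod (g e)) (fib v)"
    by (rule L2_set_mult_ineq)
  also have "\<dots> \<le> edge_norm E f * edge_norm E g"
    using assms True by (intro mult_mono L2_set_le_edge_norm edge_norm_nonneg) auto
  finally show ?thesis .
qed (use assms in \<open>simp add: edge_inner_off edge_norm_nonneg\<close>)

text \<open>The frame expansion bounds \<open>hat T f\<close> uniformly by
  \<open>c * edge_norm E f\<close>, and \<open>B\<close> converts this into a bound in the module
  norm. Only then is the supremum in the operator norm known to be finite.\<close>

lemma hat_bounded:
  assumes T: "T \<in> cs_carrier ops"
  obtains M where "\<And>f. f \<in> CE \<Longrightarrow> edge_norm E (hat T f) \<le> M * edge_norm E f"
proof -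
  have hat: "hat T (u k) \<in> CE" if "k \<in> K" for k
    using ops_maps[OF T] that by (intro hat_CE u_CE)
  define c where "c = (\<Sum>k\<in>K. edge_norm E (hat T (u k)) * edge_norm E (u k))"
  have c: "0 \<le> c" unfolding c_def by (intro sum_nonneg mult_nonneg_nonneg edge_norm_nonneg hat u_CE)
  obtain B where B: "0 \<le> B"
    "\<And>f c. 0 \<le> c \<Longrightarrow> (\<And>e. e \<in> Ed \<Longrightarrow> cmod (f e) \<le> c) \<Longrightarrow> edge_norm E f \<le> B * c"
    by (rule edge_norm_le_sup) blast
  have "edge_norm E (hat T f) \<le> (B * c) * edge_norm E f" if f: "f \<in> CE" for f
  proof -
    have "cmod (hat T f e) \<le> c * edge_norm E f" for e
    proof -
      have "cmod (hat T f e) \<le> (\<Sum>k\<in>K. cmod (hat T (u k) e * edge_inner E (u k) f (src E e)))"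
        unfolding hat_expansion[OF T f] by (rule norm_sum)
      also have "\<dots> \<le> (\<Sum>k\<in>K. edge_norm E (hat T (u k)) * (edge_norm E (u k) * edge_norm E f))"
        unfolding norm_mult
        by (intro sum_mono mult_mono norm_le_edge_norm edge_inner_bound hat u_CE f edge_norm_nonneg) auto
      also have "\<dots> = c * edge_norm E f" by (simp add: c_def sum_distrib_right mult.assoc)
      finally show ?thesis .
    qed
    then have "edge_norm E (hat T f) \<le> B * (c * edge_norm E f)"
      using c f by (intro B(2)) (simp_all add: edge_norm_nonneg)
    then show ?thesis by (simp add: mult.assoc)
  qed
  then show thesis by (rule that)
qed

lemma hat_eqI: "g \<in> CE \<Longrightarrow> T (cls f) = cls g \<Longrightarrow> hat T f = g"
  by (simp add: hat_def fn_cls)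

lemma hat_ops_simps:
  "T \<in> maps \<Longrightarrow> S \<in> maps \<Longrightarrow> f \<in> CE \<Longrightarrow> hat (cs_add ops T S) f = (\<lambda>e. hat T f e + hat S f e)"
  "T \<in> maps \<Longrightarrow> f \<in> CE \<Longrightarrow> hat (cs_scale ops c T) f = (\<lambda>e. c * hat T f e)"
  "f \<in> CE \<Longrightarrow> hat (cs_zero ops) f = (\<lambda>_. 0)"
  "S \<in> maps \<Longrightarrow> f \<in> CE \<Longrightarrow> hat (cs_mult ops T S) f = hat T (hat S f)"
  "g \<in> CE \<Longrightarrow> h \<in> CE \<Longrightarrow> f \<in> CE \<Longrightarrow>
    hat (rank_one X (cls g) (cls h)) f = (\<lambda>e. g e * edge_inner E h f (src E e))"
  "a \<in> CV \<Longrightarrow> f \<in> CE \<Longrightarrow> hat (left_action X a) f = (\<lambda>e. a (rng E e) * f e)"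
proof -
  show "hat (cs_add ops T S) f = (\<lambda>e. hat T f e + hat S f e)" if "T \<in> maps" "S \<in> maps" "f \<in> CE"
  proof (rule hat_eqI)
    note CE = hat_CE[OF that(1,3)] hat_CE[OF that(2,3)]
    show "(\<lambda>e. hat T f e + hat S f e) \<in> CE" using CE by (rule CE_add)
    show "cs_add ops T S (cls f) = cls (\<lambda>e. hat T f e + hat S f e)"
      using cls_hat[OF that(1,3)] cls_hat[OF that(2,3)] graph_corr_add[OF CE]
      by (simp add: adjointable_ops_def cls_in_carrier that)
  qed
  show "hat (cs_scale ops c T) f = (\<lambda>e. c * hat T f e)" if "T \<in> maps" "f \<in> CE"
  proof (rule hat_eqI)
    note CE = hat_CE[OF that]
    show "(\<lambda>e. c * hat T f e) \<in> CE" using CE by (rule CE_cmult)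
    show "cs_scale ops c T (cls f) = cls (\<lambda>e. c * hat T f e)"
      using cls_hat[OF that] graph_corr_scale[OF CE]
      by (simp add: adjointable_ops_def cls_in_carrier that)
  qed
  show "hat (cs_zero ops) f = (\<lambda>_. 0)" if "f \<in> CE"
    by (rule hat_eqI) (simp_all add: CE_zero adjointable_ops_def cls_in_carrier that graph_corr_zero)
  show "hat (cs_mult ops T S) f = hat T (hat S f)" if "S \<in> maps" "f \<in> CE"
  proof -
    have "hat (cs_mult ops T S) f = fn (T (S (cls f)))"
      by (simp add: hat_def adjointable_ops_def compose_def cls_in_carrier that)
    also have "\<dots> = hat T (hat S f)" by (simp only: hat_def[of T] cls_hat[OF that])
    finally show ?thesis .
  qed
  show "hat (rank_one X (cls g) (cls h)) f = (\<lambda>e. g e * edge_inner E h f (src E e))"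
    if "g \<in> CE" "h \<in> CE" "f \<in> CE"
    by (rule hat_eqI) (simp_all add: CE_ract edge_inner_CV rank_one_def cls_in_carrier graph_corr_inner
        graph_corr_ract that)
  show "hat (left_action X a) f = (\<lambda>e. a (rng E e) * f e)" if "a \<in> CV" "f \<in> CE"
    by (rule hat_eqI) (simp_all add: CE_lact left_action_def cls_in_carrier graph_corr_lact that)
qed

lemma ops_maps_closed:
  "T \<in> maps \<Longrightarrow> S \<in> maps \<Longrightarrow> cs_add ops T S \<in> maps"
  "T \<in> maps \<Longrightarrow> cs_scale ops c T \<in> maps"
  "cs_zero ops \<in> maps"
  "g \<in> CE \<Longrightarrow> h \<in> CE \<Longrightarrow> rank_one X (cls g) (cls h) \<in> maps"
proof -
  show "cs_add ops T S \<in> maps" if "T \<in> maps" "S \<in> maps"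
  proof -
    have "co_add X (T P) (S P) \<in> co_carrier X" if P: "P \<in> co_carrier X" for P
      using PiE_mem[OF \<open>T \<in> maps\<close> P] PiE_mem[OF \<open>S \<in> maps\<close> P]
      by (auto simp: carrier_graph_corr graph_corr_add CE_add)
    then show ?thesis by (simp add: adjointable_ops_def)
  qed
  show "cs_scale ops c T \<in> maps" if "T \<in> maps"
  proof -
    have "co_scale X c (T P) \<in> co_carrier X" if P: "P \<in> co_carrier X" for P
      using PiE_mem[OF \<open>T \<in> maps\<close> P] by (auto simp: carrier_graph_corr graph_corr_scale CE_cmult)
    then show ?thesis by (simp add: adjointable_ops_def)
  qed
  show "cs_zero ops \<in> maps"
    by (simp add: adjointable_ops_def graph_corr_zero cls_in_carrier CE_zero)
  show "rank_one X (cls g) (cls h) \<in> maps" if "g \<in> CE" "h \<in> CE"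
    using that by (auto simp: rank_one_def carrier_graph_corr graph_corr_simps edge_inner_CV CE_ract)
qed

lemma is_adjoint_add:
  assumes "T \<in> maps" "T' \<in> maps" "is_adjoint X T S" "is_adjoint X T' S'"
  shows "is_adjoint X (cs_add ops T T') (cs_add ops S S')"
proof -
  have inner: "edge_inner E (\<lambda>e. f e + g e) h = (\<lambda>v. edge_inner E f h v + edge_inner E g h v)"
    "edge_inner E h (\<lambda>e. f e + g e) = (\<lambda>v. edge_inner E h f v + edge_inner E h g v)" for f g h
    by (rule ext; rename_tac v; case_tac "v \<in> V";
        simp add: edge_inner_eq edge_inner_off algebra_simps sum.distrib)+
  show ?thesis
    using assms by (simp add: is_adjoint_iff ops_maps_closed hat_ops_simps inner)
qed

lemma is_adjoint_scale:
  assumes "T \<in> maps" "is_adjoint X T S"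
  shows "is_adjoint X (cs_scale ops c T) (cs_scale ops (cnj c) S)"
proof -
  have inner: "edge_inner E (\<lambda>e. c * f e) h = (\<lambda>v. cnj c * edge_inner E f h v)"
    "edge_inner E h (\<lambda>e. c * f e) = (\<lambda>v. c * edge_inner E h f v)" for f h c
    by (rule ext; rename_tac v; case_tac "v \<in> V";
        simp add: edge_inner_eq edge_inner_off sum_distrib_left mult_ac)+
  show ?thesis
    using assms by (simp add: is_adjoint_iff ops_maps_closed hat_ops_simps inner)
qed

lemma is_adjoint_rank_one:
  assumes "g \<in> CE" "h \<in> CE"
  shows "is_adjoint X (rank_one X (cls g) (cls h)) (rank_one X (cls h) (cls g))"
proof -
  have inner: "edge_inner E (\<lambda>e. f e * a (src E e)) f' = (\<lambda>v. cnj (a v) * edge_inner E f f' v)"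
    "edge_inner E f' (\<lambda>e. f e * a (src E e)) = (\<lambda>v. a v * edge_inner E f' f v)" for f f' a
    by (rule ext; rename_tac v; case_tac "v \<in> V";
        force simp: edge_inner_eq edge_inner_off sum_distrib_left mult_ac fib_def intro: sum.cong)+
  show ?thesis
    using assms by (simp add: is_adjoint_iff ops_maps_closed hat_ops_simps inner edge_inner_cnj mult.commute)
qed

lemma ops_closed:
  "T \<in> cs_carrier ops \<Longrightarrow> S \<in> cs_carrier ops \<Longrightarrow> cs_add ops T S \<in> cs_carrier ops"
  "T \<in> cs_carrier ops \<Longrightarrow> cs_scale ops c T \<in> cs_carrier ops"
  "cs_zero ops \<in> cs_carrier ops"
  "g \<in> CE \<Longrightarrow> h \<in> CE \<Longrightarrow> rank_one X (cls g) (cls h) \<in> cs_carrier ops"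
proof -
  have "is_adjoint X (cs_zero ops) (cs_zero ops)"
    by (simp add: is_adjoint_iff ops_maps_closed hat_ops_simps edge_inner_def fun_eq_iff)
  then show "cs_zero ops \<in> cs_carrier ops" by (auto simp: ops_carrier ops_maps_closed)
  show "cs_add ops T S \<in> cs_carrier ops" if "T \<in> cs_carrier ops" "S \<in> cs_carrier ops"
    using that ops_maps_closed(1)[of T S] is_adjoint_add[of T S] unfolding ops_carrier by blast
  show "cs_scale ops c T \<in> cs_carrier ops" if "T \<in> cs_carrier ops"
    using that ops_maps_closed(2)[of T c] is_adjoint_scale[of T _ c] unfolding ops_carrier by blast
  show "rank_one X (cls g) (cls h) \<in> cs_carrier ops" if "g \<in> CE" "h \<in> CE"
    using that ops_maps_closed(4)[of g h] is_adjoint_rank_one[of g h] unfolding ops_carrier by blast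
qed

section \<open>The operator norm and the compact operators\<close>

lemma hat_ops_CE: "T \<in> cs_carrier ops \<Longrightarrow> f \<in> CE \<Longrightarrow> hat T f \<in> CE"
  by (rule hat_CE[OF ops_maps])

lemma co_norm_cls: "f \<in> CE \<Longrightarrow> co_norm A X (cls f) = edge_norm E f"
  by (simp add: co_norm_def graph_corr_inner edge_norm_def C0_def)

lemma cs_norm_ops:
  assumes "T \<in> maps"
  shows "cs_norm ops T = (SUP f\<in>{f \<in> CE. edge_norm E f \<le> 1}. edge_norm E (hat T f))"
proof -
  have ball: "{\<xi> \<in> co_carrier X. co_norm A X \<xi> \<le> 1} = cls ` {f \<in> CE. edge_norm E f \<le> 1}"
    by (auto simp: carrier_graph_corr co_norm_cls)
  have "(\<lambda>\<xi>. co_norm A X (T \<xi>)) ` cls ` {f \<in> CE. edge_norm E f \<le> 1}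
      = (\<lambda>f. edge_norm E (hat T f)) ` {f \<in> CE. edge_norm E f \<le> 1}"
    unfolding image_image
    by (rule image_cong) (simp_all add: assms hat_CE co_norm_cls flip: cls_hat)
  then show ?thesis by (simp add: adjointable_ops_def ball)
qed

lemma cs_dist_ops:
  assumes "S \<in> cs_carrier ops" "T \<in> cs_carrier ops"
  shows "cs_dist ops S T =
    (SUP f\<in>{f \<in> CE. edge_norm E f \<le> 1}. edge_norm E (\<lambda>e. hat S f e - hat T f e))"
proof -
  have D: "cs_add ops S (cs_scale ops (-1) T) \<in> maps"
    using assms by (intro ops_maps ops_closed)
  show ?thesis
    unfolding cs_dist_def cs_norm_ops[OF D] using assms
    by (auto intro!: SUP_cong simp: hat_ops_simps ops_maps ops_maps_closed)
qed

text \<open>\<open>closed_span\<close> refers to closed sets of this distance, and the facts about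
  its topology rest on the metric axioms. Boundedness of operators makes the suprema
  meaningful.\<close>

lemma Metric_space_ops: "Metric_space (cs_carrier ops) (cs_dist ops)"
proof -
  define U where "U = {f \<in> CE. edge_norm E f \<le> 1}"
  define d where "d S T f = edge_norm E (\<lambda>e. hat S f e - hat T f e)" for S T f
  have dist: "cs_dist ops S T = (SUP f\<in>U. d S T f)" if "S \<in> cs_carrier ops" "T \<in> cs_carrier ops" for S T
    unfolding U_def d_def by (rule cs_dist_ops[OF that])
  have zero_U: "(\<lambda>_. 0) \<in> U" by (simp add: U_def CE_zero edge_norm_zero)
  have nonneg: "0 \<le> d S T f" if "S \<in> cs_carrier ops" "T \<in> cs_carrier ops" "f \<in> U" for S T f
    using that unfolding d_def U_def by (auto intro!: edge_norm_nonneg CE_diff hat_ops_CE)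
  have commute: "d S T f = d T S f" for S T f
    unfolding d_def by (rule edge_norm_minus_commute)
  have bdd: "bdd_above (d S T ` U)" if S: "S \<in> cs_carrier ops" and T: "T \<in> cs_carrier ops" for S T
  proof -
    obtain M where M: "\<And>f. f \<in> CE \<Longrightarrow> edge_norm E (hat S f) \<le> M * edge_norm E f"
      using hat_bounded[OF S] by blast
    obtain N where N: "\<And>f. f \<in> CE \<Longrightarrow> edge_norm E (hat T f) \<le> N * edge_norm E f"
      using hat_bounded[OF T] by blast
    have "d S T f \<le> \<bar>M\<bar> + \<bar>N\<bar>" if f: "f \<in> U" for f
    proof -
      have fCE: "f \<in> CE" "0 \<le> edge_norm E f" "edge_norm E f \<le> 1"
        using f edge_norm_nonneg by (auto simp: U_def)
      have "d S T f \<le> edge_norm E (hat S f) + edge_norm E (\<lambda>e. (-1) * hat T f e)"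
        using edge_norm_triangle[OF hat_ops_CE[OF S fCE(1)] CE_cmult[OF hat_ops_CE[OF T fCE(1)], of "-1"]]
        by (simp add: d_def)
      also have "edge_norm E (\<lambda>e. (-1) * hat T f e) \<le> 1 * edge_norm E (hat T f)"
        by (rule edge_norm_mult_le[OF hat_ops_CE[OF T fCE(1)]]) auto
      also have "edge_norm E (hat S f) + 1 * edge_norm E (hat T f)
          \<le> \<bar>M\<bar> * edge_norm E f + \<bar>N\<bar> * edge_norm E f"
        using M[OF fCE(1)] N[OF fCE(1)] mult_right_mono[OF abs_ge_self fCE(2), of M]
          mult_right_mono[OF abs_ge_self fCE(2), of N] by linarith
      also have "\<dots> \<le> \<bar>M\<bar> * 1 + \<bar>N\<bar> * 1"
        using fCE by (intro add_mono mult_left_mono) auto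
      finally show ?thesis by simp
    qed
    then show ?thesis by (rule bdd_aboveI2)
  qed
  show ?thesis
  proof
    show "0 \<le> cs_dist ops S T" for S T
    proof (cases "S \<in> cs_carrier ops \<and> T \<in> cs_carrier ops")
      case True
      then have ST: "S \<in> cs_carrier ops" "T \<in> cs_carrier ops" by auto
      show ?thesis
        unfolding dist[OF ST] by (rule order_trans[OF nonneg[OF ST zero_U] cSUP_upper[OF zero_U bdd[OF ST]]])
    qed (auto simp: cs_dist_def)
    show "cs_dist ops S T = cs_dist ops T S" for S T
    proof (cases "S \<in> cs_carrier ops \<and> T \<in> cs_carrier ops")
      case True
      then show ?thesis by (simp add: dist commute[of S T])
    qed (auto simp: cs_dist_def)
    show "cs_dist ops S R \<le> cs_dist ops S T + cs_dist ops T R"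
      if R: "S \<in> cs_carrier ops" "T \<in> cs_carrier ops" "R \<in> cs_carrier ops" for S T R
    proof -
      have "d S R f \<le> (SUP f\<in>U. d S T f) + (SUP f\<in>U. d T R f)" if f: "f \<in> U" for f
      proof -
        have CE: "hat S f \<in> CE" "hat T f \<in> CE" "hat R f \<in> CE"
          using R f by (auto simp: U_def hat_ops_CE)
        have "d S R f \<le> d S T f + d T R f"
          using edge_norm_triangle[OF CE_diff[OF CE(1,2)] CE_diff[OF CE(2,3)]] by (simp add: d_def)
        then show ?thesis
          using cSUP_upper[OF f bdd[OF R(1,2)]] cSUP_upper[OF f bdd[OF R(2,3)]] by linarith
      qed
      then show ?thesis using zero_U by (auto simp: dist R intro!: cSUP_least)
    qed
    show "cs_dist ops S T = 0 \<longleftrightarrow> S = T" if ST: "S \<in> cs_carrier ops" "T \<in> cs_carrier ops" for S T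
    proof
      assume "cs_dist ops S T = 0"
      have U_eq: "hat S f = hat T f" if f: "f \<in> U" for f
      proof -
        have fCE: "f \<in> CE" using f by (simp add: U_def)
        have "d S T f \<le> 0"
          using cSUP_upper[OF f bdd[OF ST]] \<open>cs_dist ops S T = 0\<close> by (simp add: dist ST)
        then have "d S T f = 0" using nonneg[OF ST f] by simp
        then have "(\<lambda>e. hat S f e - hat T f e) = (\<lambda>_. 0)"
          unfolding d_def by (intro edge_norm_eq_0 CE_diff hat_ops_CE ST fCE)
        then show ?thesis by (simp add: fun_eq_iff)
      qed
      show "S = T"
      proof (rule maps_eqI)
        fix f assume f: "f \<in> CE"
        \<comment> \<open>The metric compares operators on the unit ball only. Dividing by
          \<open>edge_norm E f + 1\<close> moves any \<open>f\<close> into it, also when the norm is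
          0, and \<open>hat_cmult\<close> cancels the factor again.\<close>
        define c where "c = complex_of_real (edge_norm E f + 1)"
        have c: "c \<noteq> 0" "0 < edge_norm E f + 1" "cmod (inverse c) = inverse (edge_norm E f + 1)"
          using edge_norm_nonneg[OF f] unfolding c_def norm_inverse norm_of_real
          by (simp_all del: of_real_add add: add_nonneg_eq_0_iff)
        have "edge_norm E (\<lambda>e. inverse c * f e) \<le> cmod (inverse c) * edge_norm E f"
          by (rule edge_norm_mult_le[OF f]) auto
        also have "\<dots> \<le> 1" unfolding c(3) using c(2) by (simp add: field_simps)
        finally have "(\<lambda>e. inverse c * f e) \<in> U" by (simp add: U_def CE_cmult f)
        then have "hat S (\<lambda>e. inverse c * f e) = hat T (\<lambda>e. inverse c * f e)" by (rule U_eq)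
        then have "(\<lambda>e. inverse c * hat S f e) = (\<lambda>e. inverse c * hat T f e)"
          unfolding hat_cmult[OF ST(1) f] hat_cmult[OF ST(2) f] .
        then show "hat S f = hat T f" using c(1) by (simp add: fun_eq_iff)
      qed (rule ops_maps, fact ST)+
    next
      assume "S = T"
      have "(SUP f\<in>U. d T T f) = (SUP f\<in>U. 0)"
        by (simp add: d_def edge_norm_zero)
      also have "\<dots> = 0" using zero_U by (intro cSUP_const) auto
      finally show "cs_dist ops S T = 0" using \<open>S = T\<close> ST by (simp add: dist)
    qed
  qed
qed

text \<open>The adjointable operators are themselves a closed subspace containing all rank one
  operators, hence one of the sets intersected in \<open>closed_span\<close>.\<close>

lemma compact_ops_subset: "cs_carrier (compact_ops A X) \<subseteq> cs_carrier ops"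
proof -
  interpret Metric_space "cs_carrier ops" "cs_dist ops" by (rule Metric_space_ops)
  have "closed_subspace ops (cs_carrier ops)"
    unfolding closed_subspace_def using closedin_topspace[of mtopology] by (simp add: ops_closed)
  moreover have "{rank_one X \<xi> \<eta> |\<xi> \<eta>. \<xi> \<in> co_carrier X \<and> \<eta> \<in> co_carrier X} \<subseteq> cs_carrier ops"
    by (auto simp: carrier_graph_corr ops_closed)
  ultimately show ?thesis
    unfolding compact_ops_def closed_span_def by (auto intro: Inter_lower)
qed

lemma compact_ops_simps:
  "cs_add (compact_ops A X) = cs_add ops" "cs_mult (compact_ops A X) = cs_mult ops"
  "cs_star (compact_ops A X) = cs_star ops" "cs_scale (compact_ops A X) = cs_scale ops"
  by (simp_all add: compact_ops_def)

end

section \<open>Covariant representations on a Hilbert space\<close>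

lemmas blinfun_compose_sum_left = bounded_bilinear.sum_left[OF bounded_bilinear_blinfun_compose]
lemmas blinfun_compose_sum_right = bounded_bilinear.sum_right[OF bounded_bilinear_blinfun_compose]

lemma blinfun_compose_assoc: "(R o\<^sub>L S) o\<^sub>L T = R o\<^sub>L (S o\<^sub>L T)"
  by (rule blinfun_eqI) simp

lemma blinfun_compose_add:
  "(R + S) o\<^sub>L T = (R o\<^sub>L T) + (S o\<^sub>L T)" "T o\<^sub>L (R + S) = (T o\<^sub>L R) + (T o\<^sub>L S)"
  by (rule blinfun_eqI; simp add: blinfun.add_left blinfun.add_right)+

lemma op_star_sum:
  "(\<And>k. k \<in> K \<Longrightarrow> T k \<in> ell2_ops) \<Longrightarrow> op_star (\<Sum>k\<in>K. T k) = (\<Sum>k\<in>K. op_star (T k))"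
  by (intro op_star_eqI adjoint_op_sum adjoint_op_star)

text \<open>The relations of a covariant representation, stated for functions instead of classes.
  \<open>\<sigma>_covariant\<close> is the concrete form of covariance: a function in J_X vanishes
  off the image of r, and the frame sum must act on its image as a unit.\<close>

locale graph_rep = framed_graph E K u
  for E :: "('v, 'e) topgraph" and K :: "'k set" and u :: "'k \<Rightarrow> 'e \<Rightarrow> complex" +
  fixes \<rho> :: "('v \<Rightarrow> complex) \<Rightarrow> 'i ell2 \<Rightarrow>\<^sub>L 'i ell2"
    and \<sigma> :: "('e \<Rightarrow> complex) \<Rightarrow> 'i ell2 \<Rightarrow>\<^sub>L 'i ell2"
  assumes \<rho>_ops: "a \<in> CV \<Longrightarrow> \<rho> a \<in> ell2_ops"
    and \<rho>_add: "a \<in> CV \<Longrightarrow> b \<in> CV \<Longrightarrow> \<rho> (\<lambda>v. a v + b v) = \<rho> a + \<rho> b"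
    and \<rho>_mult: "a \<in> CV \<Longrightarrow> b \<in> CV \<Longrightarrow> \<rho> (\<lambda>v. a v * b v) = \<rho> a o\<^sub>L \<rho> b"
    and \<rho>_scale: "a \<in> CV \<Longrightarrow> \<rho> (\<lambda>v. c * a v) = cscale_op c o\<^sub>L \<rho> a"
    and \<rho>_star: "a \<in> CV \<Longrightarrow> \<rho> (\<lambda>v. cnj (a v)) = op_star (\<rho> a)"
    and \<sigma>_ops: "f \<in> CE \<Longrightarrow> \<sigma> f \<in> ell2_ops"
    and \<sigma>_add: "f \<in> CE \<Longrightarrow> g \<in> CE \<Longrightarrow> \<sigma> (\<lambda>e. f e + g e) = \<sigma> f + \<sigma> g"
    and \<sigma>_scale: "f \<in> CE \<Longrightarrow> \<sigma> (\<lambda>e. c * f e) = cscale_op c o\<^sub>L \<sigma> f"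
    and \<sigma>_left: "a \<in> CV \<Longrightarrow> f \<in> CE \<Longrightarrow> \<sigma> (\<lambda>e. a (rng E e) * f e) = \<rho> a o\<^sub>L \<sigma> f"
    and \<sigma>_right: "a \<in> CV \<Longrightarrow> f \<in> CE \<Longrightarrow> \<sigma> (\<lambda>e. f e * a (src E e)) = \<sigma> f o\<^sub>L \<rho> a"
    and \<sigma>_inner: "f \<in> CE \<Longrightarrow> g \<in> CE \<Longrightarrow> op_star (\<sigma> f) o\<^sub>L \<sigma> g = \<rho> (edge_inner E f g)"
    and \<sigma>_covariant: "a \<in> CV \<Longrightarrow> (\<And>v. v \<in> V \<Longrightarrow> v \<notin> rng E ` Ed \<Longrightarrow> a v = 0) \<Longrightarrow>
      \<rho> a o\<^sub>L (\<Sum>k\<in>K. \<sigma> (u k) o\<^sub>L op_star (\<sigma> (u k))) = \<rho> a"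
begin

lemma \<sigma>_sum:
  assumes "\<And>k. k \<in> J \<Longrightarrow> f k \<in> CE"
  shows "\<sigma> (\<lambda>e. \<Sum>k\<in>J. f k e) = (\<Sum>k\<in>J. \<sigma> (f k))"
proof -
  have "cscale_op 0 o\<^sub>L \<sigma> (\<lambda>_. 0) = 0" by (auto intro!: blinfun_eqI ell2_eqI)
  then have zero: "\<sigma> (\<lambda>_. 0) = 0" using \<sigma>_scale[OF CE_zero, of 0] by simp
  show ?thesis
    using assms
    by (induction J rule: infinite_finite_induct) (simp_all add: zero \<sigma>_add CE_sum)
qed

text \<open>Because the expansion into rank one operators is finite, the homomorphism is defined on
  all adjointable operators at once, without an extension by continuity.\<close>

definition \<phi> :: "((nat \<Rightarrow> 'e \<Rightarrow> complex) set \<Rightarrow> (nat \<Rightarrow> 'e \<Rightarrow> complex) set) \<Rightarrow> 'i ell2 \<Rightarrow>\<^sub>L 'i ell2" where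
  "\<phi> T = (\<Sum>k\<in>K. \<sigma> (hat T (u k)) o\<^sub>L op_star (\<sigma> (u k)))"

text \<open>This is the projection onto the closed span of the ranges of the
  \<open>\<sigma> g\<close>: it is self-adjoint and fixes each of these ranges.\<close>

definition frame_proj :: "'i ell2 \<Rightarrow>\<^sub>L 'i ell2" where
  "frame_proj = (\<Sum>k\<in>K. \<sigma> (u k) o\<^sub>L op_star (\<sigma> (u k)))"

lemma \<phi>_ops: "T \<in> cs_carrier ops \<Longrightarrow> \<phi> T \<in> ell2_ops"
  unfolding \<phi>_def by (intro ell2_ops_sum ell2_ops_compose ell2_ops_star \<sigma>_ops hat_ops_CE u_CE)

text \<open>The inner product relation turns the sum into \<open>\<sigma>\<close> of the frame
  expansion of \<open>hat T g\<close>. Multiplicativity of \<open>\<phi>\<close> is read off from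
  this intertwining.\<close>

lemma \<phi>_\<sigma>:
  assumes T: "T \<in> cs_carrier ops" and g: "g \<in> CE"
  shows "\<phi> T o\<^sub>L \<sigma> g = \<sigma> (hat T g)"
proof -
  have "\<phi> T o\<^sub>L \<sigma> g = (\<Sum>k\<in>K. \<sigma> (hat T (u k)) o\<^sub>L (op_star (\<sigma> (u k)) o\<^sub>L \<sigma> g))"
    unfolding \<phi>_def by (simp add: blinfun_compose_sum_left blinfun_compose_assoc)
  also have "\<dots> = (\<Sum>k\<in>K. \<sigma> (\<lambda>e. hat T (u k) e * edge_inner E (u k) g (src E e)))"
    by (intro sum.cong refl)
       (simp add: \<sigma>_inner u_CE g \<sigma>_right edge_inner_CV hat_ops_CE[OF T])
  also have "\<dots> = \<sigma> (\<lambda>e. \<Sum>k\<in>K. hat T (u k) e * edge_inner E (u k) g (src E e))"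
    by (rule \<sigma>_sum[symmetric]) (intro CE_ract hat_ops_CE T u_CE edge_inner_CV g)
  also have "\<dots> = \<sigma> (hat T g)" by (simp only: hat_expansion[OF T g, symmetric])
  finally show ?thesis .
qed

lemma frame_proj_\<sigma>:
  assumes g: "g \<in> CE"
  shows "frame_proj o\<^sub>L \<sigma> g = \<sigma> g"
proof -
  have "frame_proj o\<^sub>L \<sigma> g = (\<Sum>k\<in>K. \<sigma> (u k) o\<^sub>L (op_star (\<sigma> (u k)) o\<^sub>L \<sigma> g))"
    unfolding frame_proj_def by (simp add: blinfun_compose_sum_left blinfun_compose_assoc)
  also have "\<dots> = (\<Sum>k\<in>K. \<sigma> (\<lambda>e. u k e * edge_inner E (u k) g (src E e)))"
    by (intro sum.cong refl) (simp add: \<sigma>_inner u_CE g \<sigma>_right edge_inner_CV)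
  also have "\<dots> = \<sigma> (\<lambda>e. \<Sum>k\<in>K. u k e * edge_inner E (u k) g (src E e))"
    by (rule \<sigma>_sum[symmetric]) (intro CE_ract u_CE edge_inner_CV g)
  also have "\<dots> = \<sigma> g" by (simp only: frame_expansion[OF g])
  finally show ?thesis .
qed

lemma frame_proj_ops: "frame_proj \<in> ell2_ops"
  unfolding frame_proj_def by (intro ell2_ops_sum ell2_ops_compose ell2_ops_star \<sigma>_ops u_CE)

lemma op_star_frame_proj: "op_star frame_proj = frame_proj"
  unfolding frame_proj_def
  by (simp add: op_star_sum op_star_compose op_star_op_star ell2_ops_compose ell2_ops_star \<sigma>_ops u_CE)

lemma \<sigma>_star_frame_proj: "g \<in> CE \<Longrightarrow> op_star (\<sigma> g) o\<^sub>L frame_proj = op_star (\<sigma> g)"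
  using op_star_compose[OF frame_proj_ops \<sigma>_ops, of g] frame_proj_\<sigma>[of g]
  by (simp add: op_star_frame_proj)

lemma \<phi>_mult:
  assumes "S \<in> cs_carrier ops" "T \<in> cs_carrier ops"
  shows "\<phi> (cs_mult ops S T) = \<phi> S o\<^sub>L \<phi> T"
proof -
  have "\<phi> (cs_mult ops S T) = (\<Sum>k\<in>K. \<sigma> (hat S (hat T (u k))) o\<^sub>L op_star (\<sigma> (u k)))"
    unfolding \<phi>_def
    by (intro sum.cong refl) (simp only: hat_ops_simps(4)[OF ops_maps[OF assms(2)] u_CE])
  also have "\<dots> = (\<Sum>k\<in>K. \<phi> S o\<^sub>L (\<sigma> (hat T (u k)) o\<^sub>L op_star (\<sigma> (u k))))"
    by (intro sum.cong refl)
       (simp add: \<phi>_\<sigma>[OF assms(1) hat_ops_CE[OF assms(2) u_CE], symmetric] blinfun_compose_assoc)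
  also have "\<dots> = \<phi> S o\<^sub>L \<phi> T" by (simp add: \<phi>_def[of T] blinfun_compose_sum_right)
  finally show ?thesis .
qed

text \<open>Expanding \<open>\<sigma> (hat S (u k))\<close> by the frame brings in the inner
  products of \<open>u j\<close> with \<open>hat S (u k)\<close>, which adjointness rewrites as
  those of \<open>hat T (u j)\<close> with \<open>u k\<close>. Summing over k then produces
  \<open>frame_proj\<close>, which is absorbed on the right.\<close>

lemma \<phi>_star:
  assumes T: "T \<in> cs_carrier ops"
  shows "\<phi> (cs_star ops T) = op_star (\<phi> T)"
proof -
  obtain S where adj: "is_adjoint X T S" using T by (auto simp: ops_carrier)
  note S = is_adjointD[OF ops_maps[OF T] adj]
  have uCE: "hat T (u k) \<in> CE" "hat S (u k) \<in> CE" if "k \<in> K" for k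
    using hat_ops_CE[OF T u_CE[OF that]] hat_CE[OF S(1) u_CE[OF that]] by auto
  have \<sigma>S: "\<sigma> (hat S (u k)) = (\<Sum>j\<in>K. \<sigma> (u j) o\<^sub>L (op_star (\<sigma> (hat T (u j))) o\<^sub>L \<sigma> (u k)))"
    if k: "k \<in> K" for k
  proof -
    have "\<sigma> (hat S (u k)) = (\<Sum>j\<in>K. \<sigma> (u j) o\<^sub>L (op_star (\<sigma> (u j)) o\<^sub>L \<sigma> (hat S (u k))))"
      using frame_proj_\<sigma>[OF uCE(2)[OF k]]
      by (simp add: frame_proj_def blinfun_compose_sum_left blinfun_compose_assoc)
    also have "\<dots> = (\<Sum>j\<in>K. \<sigma> (u j) o\<^sub>L (op_star (\<sigma> (hat T (u j))) o\<^sub>L \<sigma> (u k)))"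
      by (intro sum.cong refl) (simp add: \<sigma>_inner uCE u_CE k S(2))
    finally show ?thesis .
  qed
  have "\<phi> S = (\<Sum>k\<in>K. \<Sum>j\<in>K. \<sigma> (u j) o\<^sub>L (op_star (\<sigma> (hat T (u j))) o\<^sub>L
      (\<sigma> (u k) o\<^sub>L op_star (\<sigma> (u k)))))"
    unfolding \<phi>_def
    by (intro sum.cong refl) (simp add: \<sigma>S blinfun_compose_sum_left blinfun_compose_assoc)
  also have "\<dots> = (\<Sum>j\<in>K. \<sigma> (u j) o\<^sub>L (op_star (\<sigma> (hat T (u j))) o\<^sub>L frame_proj))"
    by (subst sum.swap) (simp add: frame_proj_def blinfun_compose_sum_right)
  also have "\<dots> = (\<Sum>j\<in>K. \<sigma> (u j) o\<^sub>L op_star (\<sigma> (hat T (u j))))"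
    by (intro sum.cong refl) (simp add: \<sigma>_star_frame_proj uCE)
  also have "\<dots> = op_star (\<phi> T)"
    unfolding \<phi>_def
    by (simp add: op_star_sum op_star_compose op_star_op_star ell2_ops_compose ell2_ops_star \<sigma>_ops
        u_CE uCE)
  finally show ?thesis using ops_star[OF ops_maps[OF T] adj] by simp
qed

text \<open>Pulling \<open>\<sigma> g\<close> and the adjoint of \<open>\<sigma> h\<close> out of
  the sum leaves \<open>frame_proj\<close>, which the adjoint of \<open>\<sigma> h\<close>
  absorbs.\<close>

lemma \<phi>_rank_one:
  assumes "g \<in> CE" "h \<in> CE"
  shows "\<phi> (rank_one X (cls g) (cls h)) = \<sigma> g o\<^sub>L op_star (\<sigma> h)"
proof -
  have "\<phi> (rank_one X (cls g) (cls h)) =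
      (\<Sum>k\<in>K. \<sigma> g o\<^sub>L (op_star (\<sigma> h) o\<^sub>L (\<sigma> (u k) o\<^sub>L op_star (\<sigma> (u k)))))"
    unfolding \<phi>_def
    by (intro sum.cong refl)
       (simp add: hat_ops_simps u_CE assms \<sigma>_right edge_inner_CV \<sigma>_inner[symmetric] blinfun_compose_assoc)
  also have "\<dots> = \<sigma> g o\<^sub>L (op_star (\<sigma> h) o\<^sub>L frame_proj)"
    by (simp add: frame_proj_def blinfun_compose_sum_right)
  finally show ?thesis by (simp add: \<sigma>_star_frame_proj assms)
qed

text \<open>The value is \<open>\<rho> a\<close> times \<open>frame_proj\<close>. To drop the
  projection, \<open>a\<close> must vanish off the image of r: at such a vertex there is a bump in
  the kernel of the left action, and members of J_X annihilate that kernel.\<close>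

lemma \<phi>_left_action:
  assumes "a \<in> covariance_ideal A X"
  shows "\<phi> (left_action X a) = \<rho> a"
proof -
  have a: "a \<in> CV" using assms by (simp add: covariance_ideal_def)
  have "\<phi> (left_action X a) = \<rho> a o\<^sub>L frame_proj"
    unfolding \<phi>_def frame_proj_def blinfun_compose_sum_right
    by (intro sum.cong refl) (simp add: hat_ops_simps u_CE a \<sigma>_left blinfun_compose_assoc)
  also have "\<dots> = \<rho> a"
    unfolding frame_proj_def
  proof (rule \<sigma>_covariant[OF a])
    fix v assume v: "v \<in> V" "v \<notin> rng E ` Ed"
    obtain b where b: "b \<in> CV" "b v = 1" "\<And>e. e \<in> Ed \<Longrightarrow> b (rng E e) = 0"
      using CV_bump_off_range[OF v] by blast
    have "(\<lambda>e. b (rng E e) * g e) = (\<lambda>_. 0)" if "g \<in> CE" for g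
    proof
      show "b (rng E e) * g e = 0" for e
        using CE_off[OF that, of e] b(3)[of e] by (cases "e \<in> Ed") auto
    qed
    then have "left_action X b = cs_zero ops"
      by (auto simp: left_action_def adjointable_ops_def carrier_graph_corr graph_corr_lact b(1)
          graph_corr_zero intro!: restrict_ext)
    then have "cs_mult A a b = cs_zero A"
      using assms b(1) by (simp add: covariance_ideal_def)
    then have "a v * b v = 0" by (simp add: C0_def fun_eq_iff)
    then show "a v = 0" using b(2) by simp
  qed
  finally show ?thesis .
qed

lemma \<phi>_add:
  assumes "S \<in> cs_carrier ops" "T \<in> cs_carrier ops"
  shows "\<phi> (cs_add ops S T) = \<phi> S + \<phi> T"
  unfolding \<phi>_def sum.distrib[symmetric]
  by (intro sum.cong refl)
     (simp only: hat_ops_simps(1)[OF ops_maps[OF assms(1)] ops_maps[OF assms(2)] u_CE]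
       \<sigma>_add[OF hat_ops_CE[OF assms(1) u_CE] hat_ops_CE[OF assms(2) u_CE]] blinfun_compose_add)

lemma \<phi>_scale:
  assumes "T \<in> cs_carrier ops"
  shows "\<phi> (cs_scale ops c T) = cscale_op c o\<^sub>L \<phi> T"
  unfolding \<phi>_def blinfun_compose_sum_right
  by (intro sum.cong refl)
     (simp only: hat_ops_simps(2)[OF ops_maps[OF assms] u_CE] \<sigma>_scale[OF hat_ops_CE[OF assms u_CE]]
       blinfun_compose_assoc)

theorem covariant_rep_op_cstar:
  assumes inj: "inj_on enc ell2_ops"
  shows "covariant_rep A X (op_cstar enc) (\<lambda>a. enc (\<rho> a)) (\<lambda>P. enc (\<sigma> (fn P)))"
proof -
  note enc_simps = op_cstar_simps[OF inj] op_cstar_carrier[OF inj]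
  have C0_simps: "cs_add A a b = (\<lambda>v. a v + b v)" "cs_mult A a b = (\<lambda>v. a v * b v)"
    "cs_star A a = (\<lambda>v. cnj (a v))" "cs_scale A c a = (\<lambda>v. c * a v)" for a b c
    by (simp_all add: C0_def)
  have "star_hom A (op_cstar enc) (\<lambda>a. enc (\<rho> a))"
    unfolding star_hom_def
    by (auto simp: enc_simps \<rho>_ops \<rho>_add \<rho>_mult \<rho>_star \<rho>_scale C0_simps)
  moreover have "toeplitz_rep A X (op_cstar enc) (\<lambda>a. enc (\<rho> a)) (\<lambda>P. enc (\<sigma> (fn P)))"
    unfolding toeplitz_rep_def carrier_graph_corr using calculation
    by (auto simp: enc_simps graph_corr_simps fn_cls CE_add CE_cmult CE_lact \<sigma>_ops \<rho>_ops ell2_ops_star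
        \<sigma>_add \<sigma>_scale \<sigma>_left \<sigma>_inner)
  moreover have "star_hom (compact_ops A X) (op_cstar enc) (\<lambda>T. enc (\<phi> T))"
    unfolding star_hom_def compact_ops_simps
    using compact_ops_subset
    by (auto simp: enc_simps \<phi>_ops \<phi>_add \<phi>_mult \<phi>_star \<phi>_scale subset_iff)
  moreover have "\<forall>\<xi>\<in>co_carrier X. \<forall>\<eta>\<in>co_carrier X. enc (\<phi> (rank_one X \<xi> \<eta>)) =
      cs_mult (op_cstar enc) (enc (\<sigma> (fn \<xi>))) (cs_star (op_cstar enc) (enc (\<sigma> (fn \<eta>))))"
    by (auto simp: carrier_graph_corr \<phi>_rank_one fn_cls enc_simps \<sigma>_ops ell2_ops_star)
  moreover have "\<forall>a\<in>covariance_ideal A X. enc (\<phi> (left_action X a)) = enc (\<rho> a)"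
    by (simp add: \<phi>_left_action)
  ultimately show ?thesis unfolding covariant_rep_def by blast
qed

end

section \<open>The boundary path representation\<close>

lemma ell2_nth_sum: "ell2_nth (\<Sum>k\<in>K. x k) i = (\<Sum>k\<in>K. ell2_nth (x k) i)"
  by (induction K rule: infinite_finite_induct) simp_all

text \<open>\<open>N\<close> indexes paths and \<open>N1\<close> those of positive length; \<open>w n\<close>, \<open>ed n\<close> and \<open>par n\<close> are the
  range, the first edge and the remainder of path \<open>n\<close>.\<close>

locale path_system = framed_graph E K u
  for E :: "('v, 'e) topgraph" and K :: "'k set" and u :: "'k \<Rightarrow> 'e \<Rightarrow> complex" +
  fixes N N1 :: "'i set" and w :: "'i \<Rightarrow> 'v" and ed :: "'i \<Rightarrow> 'e" and par :: "'i \<Rightarrow> 'i"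
  assumes N1_subset: "N1 \<subseteq> N"
    and w_in: "n \<in> N \<Longrightarrow> w n \<in> V"
    and ed_in: "n \<in> N1 \<Longrightarrow> ed n \<in> Ed"
    and rng_ed: "n \<in> N1 \<Longrightarrow> rng E (ed n) = w n"
    and par_in: "n \<in> N1 \<Longrightarrow> par n \<in> N"
    and src_ed: "n \<in> N1 \<Longrightarrow> src E (ed n) = w (par n)"
    and extend: "m \<in> N \<Longrightarrow> e \<in> fib (w m) \<Longrightarrow> \<exists>n\<in>N1. ed n = e \<and> par n = m"
    and ed_par_inj: "n \<in> N1 \<Longrightarrow> n' \<in> N1 \<Longrightarrow> ed n = ed n' \<Longrightarrow> par n = par n' \<Longrightarrow> n = n'"
    and terminal: "n \<in> N \<Longrightarrow> n \<notin> N1 \<Longrightarrow> w n \<notin> rng E ` Ed"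
begin

definition chl :: "'i \<Rightarrow> 'i set" where
  "chl m = {n \<in> N1. par n = m}"

text \<open>Prepending an edge to path \<open>m\<close> is possible exactly for the edges whose
  source is the range of \<open>m\<close>. Thus sums over a fibre of s become sums over the
  extensions of a path.\<close>

lemma chl_bij: "m \<in> N \<Longrightarrow> bij_betw ed (chl m) (fib (w m))"
  unfolding bij_betw_def
proof (intro conjI equalityI subsetI)
  show "inj_on ed (chl m)" by (rule inj_onI) (auto simp: chl_def intro: ed_par_inj)
  show "e \<in> fib (w m)" if "e \<in> ed ` chl m" for e
    using that by (auto simp: chl_def fib_def ed_in src_ed)
  show "e \<in> ed ` chl m" if "m \<in> N" "e \<in> fib (w m)" for e
    using extend[OF that] by (auto simp: chl_def)
qed

lemma chl_empty: "m \<notin> N \<Longrightarrow> chl m = {}"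
  using par_in by (auto simp: chl_def)

lemma chl_card_bound:
  obtains b where "\<And>m. finite (chl m) \<and> card (chl m) \<le> b"
proof -
  obtain b where b: "\<And>v. finite (fib v) \<and> card (fib v) \<le> b" by (rule fib_card_bound) blast
  have "finite (chl m) \<and> card (chl m) \<le> b" for m
  proof (cases "m \<in> N")
    case True
    then show ?thesis
      using b[of "w m"] chl_bij[OF True] by (simp add: bij_betw_finite bij_betw_same_card)
  qed (simp add: chl_empty)
  then show thesis by (rule that)
qed

lemma finite_chl: "finite (chl m)"
  using chl_card_bound by blast

text \<open>The value 0 off \<open>N\<close> treats indices that number no path, since
  \<open>N\<close> may be a proper subset of the index type.\<close>

definition vertex_op :: "('v \<Rightarrow> complex) \<Rightarrow> 'i ell2 \<Rightarrow>\<^sub>L 'i ell2" where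
  "vertex_op a = diag_op (\<lambda>n. if n \<in> N then a (w n) else 0)"

text \<open>A creation operator: it sends the basis vector of a path to the combination of its
  one-edge extensions \<open>n\<close> with weights \<open>f (ed n)\<close>.\<close>

definition edge_op :: "('e \<Rightarrow> complex) \<Rightarrow> 'i ell2 \<Rightarrow>\<^sub>L 'i ell2" where
  "edge_op f = ell2_op (\<lambda>x n. if n \<in> N1 then f (ed n) * x (par n) else 0)"

definition edge_adj :: "('e \<Rightarrow> complex) \<Rightarrow> 'i ell2 \<Rightarrow>\<^sub>L 'i ell2" where
  "edge_adj f = ell2_op (\<lambda>y m. \<Sum>n\<in>chl m. cnj (f (ed n)) * y n)"

lemma vertex_fun_bounded:
  assumes "a \<in> CV" shows "bounded (range (\<lambda>n. if n \<in> N then a (w n) else 0))"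
proof -
  obtain C where "0 \<le> C" "\<And>v. cmod (a v) \<le> C" using CV_bounded[OF assms] by blast
  then show ?thesis unfolding bounded_iff by (intro exI[of _ C]) auto
qed

lemma vertex_op_nth: "a \<in> CV \<Longrightarrow> ell2_nth (vertex_op a x) n = (if n \<in> N then a (w n) * ell2_nth x n else 0)"
  unfolding vertex_op_def by (simp add: diag_op_nth[OF vertex_fun_bounded])

text \<open>Each coordinate of \<open>x\<close> is copied to at most \<open>b\<close> extensions and
  multiplied by a factor of modulus at most \<open>C\<close>, whence the operator bound
  \<open>C * sqrt b\<close>.\<close>

lemma edge_op_nth:
  assumes "f \<in> CE"
  shows "ell2_nth (edge_op f x) n = (if n \<in> N1 then f (ed n) * ell2_nth x (par n) else 0)"
proof -
  obtain C where C: "0 \<le> C" "\<And>e. cmod (f e) \<le> C" using CE_bounded[OF assms] by blast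
  obtain b where b: "\<And>m. finite (chl m) \<and> card (chl m) \<le> b" by (rule chl_card_bound) blast
  have "ell2_nth (edge_op f x) = (\<lambda>n. if n \<in> N1 then f (ed n) * ell2_nth x (par n) else 0)"
    unfolding edge_op_def
  proof (rule ell2_op_nth[where C = "C * sqrt (real b)"])
    fix x :: "'i ell2" and F :: "'i set" assume F: "finite F"
    define G where "G = F \<inter> N1"
    have G: "finite G" using F by (simp add: G_def)
    have "(\<Sum>n\<in>F. (cmod (if n \<in> N1 then f (ed n) * ell2_nth x (par n) else 0))\<^sup>2)
        = (\<Sum>n\<in>G. (cmod (f (ed n) * ell2_nth x (par n)))\<^sup>2)"
      unfolding G_def by (subst sum.inter_restrict[OF F]) (auto intro: sum.cong)
    also have "\<dots> \<le> (\<Sum>n\<in>G. C\<^sup>2 * (cmod (ell2_nth x (par n)))\<^sup>2)"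
      by (intro sum_mono) (simp add: norm_mult power_mult_distrib mult_right_mono power_mono C)
    also have "\<dots> = C\<^sup>2 * (\<Sum>n\<in>G. (cmod (ell2_nth x (par n)))\<^sup>2)"
      by (simp add: sum_distrib_left)
    also have "(\<Sum>n\<in>G. (cmod (ell2_nth x (par n)))\<^sup>2)
        = (\<Sum>m\<in>par ` G. \<Sum>n\<in>{n \<in> G. par n = m}. (cmod (ell2_nth x (par n)))\<^sup>2)"
      by (rule sum.image_gen[OF G])
    also have "\<dots> \<le> (\<Sum>m\<in>par ` G. real b * (cmod (ell2_nth x m))\<^sup>2)"
    proof (rule sum_mono)
      fix m
      have "{n \<in> G. par n = m} \<subseteq> chl m" by (auto simp: G_def chl_def)
      then have "card {n \<in> G. par n = m} \<le> b" using b[of m] card_mono order_trans by blast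
      moreover have "(\<Sum>n\<in>{n \<in> G. par n = m}. (cmod (ell2_nth x (par n)))\<^sup>2)
          = real (card {n \<in> G. par n = m}) * (cmod (ell2_nth x m))\<^sup>2" by simp
      ultimately show "(\<Sum>n\<in>{n \<in> G. par n = m}. (cmod (ell2_nth x (par n)))\<^sup>2)
          \<le> real b * (cmod (ell2_nth x m))\<^sup>2" by (simp add: mult_right_mono)
    qed
    also have "\<dots> = real b * (\<Sum>m\<in>par ` G. (cmod (ell2_nth x m))\<^sup>2)" by (simp add: sum_distrib_left)
    also have "\<dots> \<le> real b * (norm x)\<^sup>2"
      using G by (intro mult_left_mono finite_sum_le_norm_ell2) auto
    finally show "(\<Sum>n\<in>F. (cmod (if n \<in> N1 then f (ed n) * ell2_nth x (par n) else 0))\<^sup>2)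
        \<le> (C * sqrt (real b))\<^sup>2 * (norm x)\<^sup>2"
      by (simp add: power_mult_distrib mult_left_mono mult.assoc)
  qed (auto simp: algebra_simps)
  then show ?thesis by simp
qed

text \<open>Cauchy-Schwarz on each set \<open>chl m\<close> gives the factor
  \<open>real b * C\<close>, by estimating an l2 norm by the l1 norm. These sets are disjoint for
  different \<open>m\<close>, so the remaining sums together stay below the squared norm of
  \<open>y\<close>.\<close>

lemma edge_adj_nth:
  assumes "f \<in> CE"
  shows "ell2_nth (edge_adj f y) m = (\<Sum>n\<in>chl m. cnj (f (ed n)) * ell2_nth y n)"
proof -
  obtain C where C: "0 \<le> C" "\<And>e. cmod (f e) \<le> C" using CE_bounded[OF assms] by blast
  obtain b where b: "\<And>m. finite (chl m) \<and> card (chl m) \<le> b" by (rule chl_card_bound) blast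
  have "ell2_nth (edge_adj f y) = (\<lambda>m. \<Sum>n\<in>chl m. cnj (f (ed n)) * ell2_nth y n)"
    unfolding edge_adj_def
  proof (rule ell2_op_nth[where C = "real b * C"])
    fix y :: "'i ell2" and F :: "'i set" assume F: "finite F"
    have "(cmod (\<Sum>n\<in>chl m. cnj (f (ed n)) * ell2_nth y n))\<^sup>2
        \<le> (real b * C)\<^sup>2 * (\<Sum>n\<in>chl m. (cmod (ell2_nth y n))\<^sup>2)" for m
    proof -
      have "cmod (\<Sum>n\<in>chl m. cnj (f (ed n)) * ell2_nth y n)
          \<le> (\<Sum>n\<in>chl m. \<bar>cmod (f (ed n))\<bar> * \<bar>cmod (ell2_nth y n)\<bar>)"
        by (rule order_trans[OF norm_sum]) (simp add: norm_mult)
      also have "\<dots> \<le> L2_set (\<lambda>n. cmod (f (ed n))) (chl m) * L2_set (\<lambda>n. cmod (ell2_nth y n)) (chl m)"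
        by (rule L2_set_mult_ineq)
      also have "\<dots> \<le> (real b * C) * L2_set (\<lambda>n. cmod (ell2_nth y n)) (chl m)"
      proof (rule mult_right_mono)
        have "L2_set (\<lambda>n. cmod (f (ed n))) (chl m) \<le> (\<Sum>n\<in>chl m. cmod (f (ed n)))"
          by (rule L2_set_le_sum) simp
        also have "\<dots> \<le> real (card (chl m)) * C" using C(2) by (intro sum_bounded_above) auto
        also have "\<dots> \<le> real b * C" using b[of m] C(1) by (simp add: mult_right_mono)
        finally show "L2_set (\<lambda>n. cmod (f (ed n))) (chl m) \<le> real b * C" .
      qed simp
      finally have "(cmod (\<Sum>n\<in>chl m. cnj (f (ed n)) * ell2_nth y n))\<^sup>2
          \<le> ((real b * C) * L2_set (\<lambda>n. cmod (ell2_nth y n)) (chl m))\<^sup>2"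
        by (rule power_mono) simp
      then show ?thesis by (simp add: power_mult_distrib L2_set_def sum_nonneg)
    qed
    then have "(\<Sum>m\<in>F. (cmod (\<Sum>n\<in>chl m. cnj (f (ed n)) * ell2_nth y n))\<^sup>2)
        \<le> (\<Sum>m\<in>F. (real b * C)\<^sup>2 * (\<Sum>n\<in>chl m. (cmod (ell2_nth y n))\<^sup>2))"
      by (intro sum_mono)
    also have "\<dots> = (real b * C)\<^sup>2 * (\<Sum>n\<in>(\<Union>m\<in>F. chl m). (cmod (ell2_nth y n))\<^sup>2)"
      unfolding sum_distrib_left[symmetric]
      by (subst sum.UNION_disjoint) (use F finite_chl in \<open>auto simp: chl_def\<close>)
    also have "\<dots> \<le> (real b * C)\<^sup>2 * (norm y)\<^sup>2"
      using F finite_chl by (intro mult_left_mono finite_sum_le_norm_ell2) auto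
    finally show "(\<Sum>m\<in>F. (cmod (\<Sum>n\<in>chl m. cnj (f (ed n)) * ell2_nth y n))\<^sup>2)
        \<le> (real b * C)\<^sup>2 * (norm y)\<^sup>2" .
  qed (simp_all add: algebra_simps sum.distrib scaleR_sum_right)
  then show ?thesis by simp
qed

text \<open>Pairing each path of positive length with its remainder identifies \<open>N1\<close>
  with the disjoint union of the sets \<open>chl m\<close>; absolute summability permits regrouping
  the inner product by remainders.\<close>

lemma adjoint_edge_op:
  assumes f: "f \<in> CE"
  shows "adjoint_op (edge_op f) (edge_adj f)"
  unfolding adjoint_op_def
proof (intro allI)
  fix x y :: "'i ell2"
  define g where "g m n = inner (ell2_nth x m) (cnj (f (ed n)) * ell2_nth y n)" for m n
  have left: "inner (ell2_nth (edge_op f x) n) (ell2_nth y n) = (if n \<in> N1 then g (par n) n else 0)" for n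
    by (simp add: edge_op_nth[OF f] g_def inner_cnj)
  have bij: "bij_betw (\<lambda>n. (par n, n)) N1 (Sigma UNIV chl)"
    by (auto simp: bij_betw_def inj_on_def chl_def)
  have "(\<lambda>n. inner (ell2_nth (edge_op f x) n) (ell2_nth y n)) summable_on N1"
    using inner_ell2_summable by (rule summable_on_subset_banach) simp
  then have "(\<lambda>n. g (par n) n) summable_on N1"
    by (rule summable_on_cong[THEN iffD1, rotated]) (simp add: left)
  then have summable: "(\<lambda>(m, n). g m n) summable_on Sigma UNIV chl"
    using summable_on_reindex_bij_betw[OF bij, of "\<lambda>(m, n). g m n"] by simp
  have "inner (edge_op f x) y = (\<Sum>\<^sub>\<infinity>n\<in>N1. g (par n) n)"
    unfolding inner_ell2_def by (rule infsum_cong_neutral) (auto simp: left)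
  also have "\<dots> = (\<Sum>\<^sub>\<infinity>(m, n)\<in>Sigma UNIV chl. g m n)"
    using infsum_reindex_bij_betw[OF bij, of "\<lambda>(m, n). g m n"] by simp
  also have "\<dots> = (\<Sum>\<^sub>\<infinity>m. \<Sum>\<^sub>\<infinity>n\<in>chl m. g m n)"
    using infsum_Sigma'_banach[OF summable] by simp
  also have "\<dots> = inner x (edge_adj f y)"
    unfolding inner_ell2_def
    by (rule infsum_cong) (simp add: finite_chl edge_adj_nth[OF f] inner_sum_right g_def)
  finally show "inner (edge_op f x) y = inner x (edge_adj f y)" .
qed

lemma edge_op_ops: "f \<in> CE \<Longrightarrow> edge_op f \<in> ell2_ops"
  by (rule ell2_opsI[OF adjoint_edge_op]) (auto intro!: ell2_eqI simp: edge_op_nth)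

lemma op_star_edge_op: "f \<in> CE \<Longrightarrow> op_star (edge_op f) = edge_adj f"
  by (rule op_star_eqI[OF adjoint_edge_op])

lemma adjoint_vertex_op:
  assumes "a \<in> CV" shows "adjoint_op (vertex_op a) (vertex_op (\<lambda>v. cnj (a v)))"
proof -
  have "(\<lambda>n. cnj (if n \<in> N then a (w n) else 0)) = (\<lambda>n. if n \<in> N then cnj (a (w n)) else 0)" by auto
  then show ?thesis
    unfolding adjoint_op_def vertex_op_def by (simp add: inner_diag_op[OF vertex_fun_bounded[OF assms]])
qed

lemma vertex_op_ops: "a \<in> CV \<Longrightarrow> vertex_op a \<in> ell2_ops"
  by (rule ell2_opsI[OF adjoint_vertex_op]) (auto intro!: ell2_eqI simp: vertex_op_nth)

lemma CV_ops:
  "a \<in> CV \<Longrightarrow> b \<in> CV \<Longrightarrow> (\<lambda>v. a v + b v) \<in> CV" "a \<in> CV \<Longrightarrow> b \<in> CV \<Longrightarrow> (\<lambda>v. a v * b v) \<in> CV"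
  "a \<in> CV \<Longrightarrow> (\<lambda>v. c * a v) \<in> CV"
  by (auto simp: CV_iff continuous_map_euclidean_iff intro!: tendsto_intros)

lemma edge_adj_edge_op_nth:
  assumes "f \<in> CE" "g \<in> CE"
  shows "ell2_nth (edge_adj f (edge_op g x)) m = ell2_nth (vertex_op (edge_inner E f g) x) m"
proof (cases "m \<in> N")
  case True
  have "ell2_nth (edge_adj f (edge_op g x)) m = (\<Sum>n\<in>chl m. cnj (f (ed n)) * g (ed n) * ell2_nth x m)"
    unfolding edge_adj_nth[OF assms(1)]
    by (intro sum.cong refl) (simp add: edge_op_nth[OF assms(2)] chl_def)
  also have "\<dots> = (\<Sum>e\<in>fib (w m). cnj (f e) * g e) * ell2_nth x m"
    unfolding sum_distrib_right by (rule sum.reindex_bij_betw[OF chl_bij[OF True]])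
  finally show ?thesis
    using True by (simp add: vertex_op_nth edge_inner_CV assms edge_inner_eq w_in)
qed (simp add: vertex_op_nth edge_inner_CV assms edge_adj_nth chl_empty)

text \<open>Different extensions of the same path begin with different edges of equal source, on
  which \<open>u k\<close> has at most one nonzero value. The off-diagonal terms vanish, and the
  operator is diagonal.\<close>

lemma edge_op_edge_adj_nth:
  assumes k: "k \<in> K"
  shows "ell2_nth (edge_op (u k) (edge_adj (u k) y)) n =
    (if n \<in> N1 then u k (ed n) * cnj (u k (ed n)) * ell2_nth y n else 0)"
proof (cases "n \<in> N1")
  case True
  have "u k (ed n) * (\<Sum>n'\<in>chl (par n). cnj (u k (ed n')) * ell2_nth y n')
      = (\<Sum>n'\<in>chl (par n). u k (ed n) * (cnj (u k (ed n')) * ell2_nth y n'))"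
    by (rule sum_distrib_left)
  also have "\<dots> = (\<Sum>n'\<in>{n}. u k (ed n) * (cnj (u k (ed n')) * ell2_nth y n'))"
  proof (rule sum.mono_neutral_right)
    show "\<forall>n'\<in>chl (par n) - {n}. u k (ed n) * (cnj (u k (ed n')) * ell2_nth y n') = 0"
    proof
      fix n' assume n': "n' \<in> chl (par n) - {n}"
      then have "n' \<in> N1" "par n' = par n" "n' \<noteq> n" by (auto simp: chl_def)
      then have "ed n \<noteq> ed n'" "src E (ed n) = src E (ed n')"
        using ed_par_inj[of n n'] True by (auto simp: src_ed)
      then have "u k (ed n) = 0 \<or> u k (ed n') = 0"
        using u_orth[OF k] ed_in True \<open>n' \<in> N1\<close> by blast
      then show "u k (ed n) * (cnj (u k (ed n')) * ell2_nth y n') = 0" by auto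
    qed
  qed (use True finite_chl in \<open>auto simp: chl_def\<close>)
  finally show ?thesis using True by (simp add: edge_op_nth edge_adj_nth u_CE k mult.assoc)
qed (simp add: edge_op_nth u_CE k)

lemma graph_rep: "graph_rep E K u vertex_op edge_op"
proof
  note nth = vertex_op_nth edge_op_nth CV_ops CE_add CE_cmult CE_lact CE_ract
  fix a b :: "'v \<Rightarrow> complex" and f g :: "'e \<Rightarrow> complex" and c :: complex
  show "vertex_op a \<in> ell2_ops" if "a \<in> CV" using that by (rule vertex_op_ops)
  show "edge_op f \<in> ell2_ops" if "f \<in> CE" using that by (rule edge_op_ops)
  show "vertex_op (\<lambda>v. a v + b v) = vertex_op a + vertex_op b" if "a \<in> CV" "b \<in> CV"
    using that by (auto intro!: blinfun_eqI ell2_eqI simp: nth blinfun.add_left algebra_simps)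
  show "vertex_op (\<lambda>v. a v * b v) = vertex_op a o\<^sub>L vertex_op b" if "a \<in> CV" "b \<in> CV"
    using that by (auto intro!: blinfun_eqI ell2_eqI simp: nth)
  show "vertex_op (\<lambda>v. c * a v) = cscale_op c o\<^sub>L vertex_op a" if "a \<in> CV"
    using that by (auto intro!: blinfun_eqI ell2_eqI simp: nth)
  show "vertex_op (\<lambda>v. cnj (a v)) = op_star (vertex_op a)" if "a \<in> CV"
    by (rule op_star_eqI[OF adjoint_vertex_op[OF that], symmetric])
  show "edge_op (\<lambda>e. f e + g e) = edge_op f + edge_op g" if "f \<in> CE" "g \<in> CE"
    using that by (auto intro!: blinfun_eqI ell2_eqI simp: nth blinfun.add_left algebra_simps)
  show "edge_op (\<lambda>e. c * f e) = cscale_op c o\<^sub>L edge_op f" if "f \<in> CE"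
    using that by (auto intro!: blinfun_eqI ell2_eqI simp: nth)
  show "edge_op (\<lambda>e. a (rng E e) * f e) = vertex_op a o\<^sub>L edge_op f" if "a \<in> CV" "f \<in> CE"
    using that N1_subset by (auto intro!: blinfun_eqI ell2_eqI simp: nth rng_ed)
  show "edge_op (\<lambda>e. f e * a (src E e)) = edge_op f o\<^sub>L vertex_op a" if "a \<in> CV" "f \<in> CE"
    using that by (auto intro!: blinfun_eqI ell2_eqI simp: nth src_ed par_in)
  show "op_star (edge_op f) o\<^sub>L edge_op g = vertex_op (edge_inner E f g)" if "f \<in> CE" "g \<in> CE"
    using that by (auto intro!: blinfun_eqI ell2_eqI simp: op_star_edge_op edge_adj_edge_op_nth)
  \<comment> \<open>The diagonal weights sum to 1 on \<open>N1\<close> and to 0 elsewhere. The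
    missing coordinates belong to paths of length 0, where \<open>a (w n)\<close> is 0 by the choice
    of \<open>a\<close>.\<close>
  show "vertex_op a o\<^sub>L (\<Sum>k\<in>K. edge_op (u k) o\<^sub>L op_star (edge_op (u k))) = vertex_op a"
    if a: "a \<in> CV" and van: "\<And>v. v \<in> V \<Longrightarrow> v \<notin> rng E ` Ed \<Longrightarrow> a v = 0"
  proof (intro blinfun_eqI ell2_eqI)
    fix y :: "'i ell2" and n
    have "ell2_nth ((\<Sum>k\<in>K. edge_op (u k) o\<^sub>L op_star (edge_op (u k))) y) n =
        (\<Sum>k\<in>K. if n \<in> N1 then u k (ed n) * cnj (u k (ed n)) * ell2_nth y n else 0)"
      unfolding blinfun.sum_left ell2_nth_sum
      by (intro sum.cong refl) (simp add: op_star_edge_op u_CE edge_op_edge_adj_nth)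
    also have "\<dots> = (if n \<in> N1 then ell2_nth y n else 0)"
      using u_sum[OF ed_in, of n] by (simp flip: sum_distrib_right)
    finally show "ell2_nth ((vertex_op a o\<^sub>L (\<Sum>k\<in>K. edge_op (u k) o\<^sub>L op_star (edge_op (u k)))) y) n =
        ell2_nth (vertex_op a y) n"
      using van[OF w_in, of n] terminal[of n] by (auto simp: vertex_op_nth[OF a])
  qed
qed

end

section \<open>Coding operators by matrices\<close>

definition ell2_basis :: "'i \<Rightarrow> 'i ell2" where
  "ell2_basis j = Abs_ell2 (\<lambda>i. if i = j then 1 else 0)"

lemma ell2_basis_nth: "ell2_nth (ell2_basis j) i = (if i = j then 1 else 0)"
proof -
  have "(\<Sum>i\<in>F. (cmod (if i = j then 1 else 0))\<^sup>2) \<le> 1" if "finite F" for F :: "'a set"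
  proof -
    have "(\<Sum>i\<in>F. (cmod (if i = j then 1 else 0))\<^sup>2) = (\<Sum>i\<in>F. if i = j then 1 else 0 :: real)"
      by (rule sum.cong) auto
    then show ?thesis using that by (simp add: sum.delta)
  qed
  then show ?thesis unfolding ell2_basis_def by (subst ell2_exists) auto
qed

text \<open>Since \<open>inner\<close> is real-valued, a single basis vector shows only a real part;
  the factor \<open>c\<close> recovers the whole complex coordinate.\<close>

lemma inner_ell2_basis: "inner x (cscale_op c (ell2_basis j)) = inner (ell2_nth x j) c"
proof -
  have "inner x (cscale_op c (ell2_basis j)) =
      (\<Sum>\<^sub>\<infinity>i\<in>{j}. inner (ell2_nth x i) (ell2_nth (cscale_op c (ell2_basis j)) i))"
    unfolding inner_ell2_def by (rule infsum_cong_neutral) (auto simp: ell2_basis_nth)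
  then show ?thesis by (simp add: ell2_basis_nth)
qed

lemma complex_inner_eqI: "(\<And>c. inner a c = inner b c) \<Longrightarrow> a = (b :: complex)"
  by (metis inner_commute vector_eq_ldot)

text \<open>The matrix of the adjoint, packed into the type over which the universal property
  quantifies.\<close>

definition matrix_code :: "(nat ell2 \<Rightarrow>\<^sub>L nat ell2) \<Rightarrow> ('v \<Rightarrow> complex, 'x) universe" where
  "matrix_code T = (\<lambda>n. [[(Inl (\<lambda>_. ell2_nth (op_star T (ell2_basis (fst (prod_decode n))))
      (snd (prod_decode n))), True)]])"

text \<open>Coordinate j of \<open>T x\<close> is the pairing of \<open>x\<close> with the adjoint
  applied to basis vector j. The rows of the adjoint's code thus determine T on every vector without
  a density argument, which is the reason for coding the adjoint.\<close>

lemma inj_matrix_code: "inj_on (matrix_code :: _ \<Rightarrow> ('v \<Rightarrow> complex, 'x) universe) ell2_ops"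
proof (rule inj_onI)
  fix T S :: "nat ell2 \<Rightarrow>\<^sub>L nat ell2"
  assume T: "T \<in> ell2_ops" and S: "S \<in> ell2_ops"
    and eq: "(matrix_code T :: ('v \<Rightarrow> complex, 'x) universe) = matrix_code S"
  have nth: "ell2_nth (op_star T (ell2_basis j)) i = ell2_nth (op_star S (ell2_basis j)) i" for i j
    using fun_cong[OF eq, of "prod_encode (j, i)"] by (simp add: matrix_code_def fun_eq_iff)
  have basis: "op_star T (ell2_basis j) = op_star S (ell2_basis j)" for j
    by (rule ell2_eqI) (rule nth)
  show "T = S"
  proof (intro blinfun_eqI ell2_eqI complex_inner_eqI)
    fix x j c
    have "inner (T x) (cscale_op c (ell2_basis j)) = inner x (cscale_op c (op_star T (ell2_basis j)))"
      using adjoint_op_star[OF T] by (simp add: adjoint_op_def ell2_ops_cscale ell2_ops_star T)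
    also have "\<dots> = inner (S x) (cscale_op c (ell2_basis j))"
      using adjoint_op_star[OF S] by (simp add: adjoint_op_def ell2_ops_cscale ell2_ops_star S basis)
    finally show "inner (ell2_nth (T x) j) c = inner (ell2_nth (S x) j) c"
      by (simp add: inner_ell2_basis)
  qed
qed

section \<open>Boundary paths and their countable orbits\<close>

context compact_tgraph
begin

text \<open>A boundary path records at time \<open>k\<close> its current vertex and the edge by which it continues.
  It has no such edge precisely at vertices outside the range of \<open>r\<close>; what follows is then
  irrelevant.\<close>

definition boundary_path :: "(nat \<Rightarrow> 'e option \<times> 'v) \<Rightarrow> bool" where
  "boundary_path p \<longleftrightarrow> (\<forall>k. snd (p k) \<in> V \<and> (case fst (p k) of None \<Rightarrow> snd (p k) \<notin> rng E ` Ed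
     | Some e \<Rightarrow> e \<in> Ed \<and> rng E e = snd (p k) \<and> src E e = snd (p (Suc k))))"

definition path_tail :: "(nat \<Rightarrow> 'e option \<times> 'v) \<Rightarrow> nat \<Rightarrow> 'e option \<times> 'v" where
  "path_tail p = (\<lambda>k. p (Suc k))"

definition path_cons :: "'e \<Rightarrow> (nat \<Rightarrow> 'e option \<times> 'v) \<Rightarrow> nat \<Rightarrow> 'e option \<times> 'v" where
  "path_cons e p = case_nat (Some e, rng E e) p"

lemma path_cons_simps:
  "path_cons e p 0 = (Some e, rng E e)" "path_tail (path_cons e p) = p"
  by (simp_all add: path_cons_def path_tail_def)

text \<open>At each vertex choose an edge with this range if there is one and move on to its source;
  otherwise stay, which is allowed because entries after a missing edge carry no meaning.\<close>

lemma boundary_path_exists: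
  assumes "v \<in> V" obtains p where "boundary_path p" "snd (p 0) = v"
proof -
  define nxt where "nxt x = (if x \<in> rng E ` Ed then Some (SOME e. e \<in> Ed \<and> rng E e = x) else None)" for x
  have nxt: "e \<in> Ed \<and> rng E e = x" if "nxt x = Some e" for x e
  proof -
    have "\<exists>e. e \<in> Ed \<and> rng E e = x" "e = (SOME e. e \<in> Ed \<and> rng E e = x)"
      using that by (auto simp: nxt_def split: if_splits)
    then show ?thesis by (metis (mono_tags, lifting) someI_ex)
  qed
  define step where "step x = (case nxt x of None \<Rightarrow> x | Some e \<Rightarrow> src E e)" for x
  define p where "p k = (nxt ((step ^^ k) v), (step ^^ k) v)" for k
  have step: "step x \<in> V" if "x \<in> V" for x
    using that nxt by (auto simp: step_def src_in split: option.split)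
  have V: "(step ^^ k) v \<in> V" for k
    by (induction k) (auto simp: assms step)
  show thesis
  proof
    show "boundary_path p"
      unfolding boundary_path_def
    proof (intro allI conjI)
      fix k
      show "snd (p k) \<in> V" by (simp add: p_def V)
      show "case fst (p k) of None \<Rightarrow> snd (p k) \<notin> rng E ` Ed
          | Some e \<Rightarrow> e \<in> Ed \<and> rng E e = snd (p k) \<and> src E e = snd (p (Suc k))"
      proof (cases "nxt ((step ^^ k) v)")
        case None
        then show ?thesis by (auto simp: p_def nxt_def split: if_splits)
      next
        case (Some e)
        then show ?thesis using nxt[OF Some] by (simp add: p_def step_def)
      qed
    qed
    show "snd (p 0) = v" by (simp add: p_def)
  qed
qed

text \<open>Level n collects what is reached in at most n moves, a move being the removal or the
  prepending of an edge. The union of the levels is stable under both moves, as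
  \<open>path_system\<close> requires.\<close>

primrec path_level :: "(nat \<Rightarrow> 'e option \<times> 'v) \<Rightarrow> nat \<Rightarrow> (nat \<Rightarrow> 'e option \<times> 'v) set" where
  "path_level p 0 = {p}"
| "path_level p (Suc n) = path_level p n \<union> path_tail ` path_level p n \<union>
     (\<Union>q\<in>path_level p n. (\<lambda>e. path_cons e q) ` fib (snd (q 0)))"

definition path_orbit :: "(nat \<Rightarrow> 'e option \<times> 'v) \<Rightarrow> (nat \<Rightarrow> 'e option \<times> 'v) set" where
  "path_orbit p = (\<Union>n. path_level p n)"

lemma countable_path_orbit: "countable (path_orbit p)"
proof -
  have "countable (path_level p n)" for n
  proof (induction n)
    case (Suc n)
    then have "countable (\<Union>q\<in>path_level p n. (\<lambda>e. path_cons e q) ` fib (snd (q 0)))"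
      by (rule countable_UN) (rule countable_finite[OF finite_imageI[OF finite_fib]])
    then show ?case using Suc by simp
  qed simp
  then show ?thesis by (simp add: path_orbit_def)
qed

lemma path_orbit_tail: "q \<in> path_orbit p \<Longrightarrow> path_tail q \<in> path_orbit p"
proof -
  assume "q \<in> path_orbit p"
  then obtain n where "q \<in> path_level p n" by (auto simp: path_orbit_def)
  then have "path_tail q \<in> path_level p (Suc n)" by simp
  then show ?thesis unfolding path_orbit_def by blast
qed

lemma path_orbit_cons: "q \<in> path_orbit p \<Longrightarrow> e \<in> fib (snd (q 0)) \<Longrightarrow> path_cons e q \<in> path_orbit p"
proof -
  assume "q \<in> path_orbit p" and e: "e \<in> fib (snd (q 0))"
  then obtain n where "q \<in> path_level p n" by (auto simp: path_orbit_def)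
  then have "path_cons e q \<in> path_level p (Suc n)" using e by auto
  then show ?thesis unfolding path_orbit_def by blast
qed

lemma path_orbit_refl: "p \<in> path_orbit p"
  unfolding path_orbit_def by (auto intro!: exI[of _ 0])

lemma boundary_path_orbit:
  assumes "boundary_path p" "q \<in> path_orbit p" shows "boundary_path q"
proof -
  have tail: "boundary_path (path_tail q)" if "boundary_path q" for q
    using that by (simp add: boundary_path_def path_tail_def)
  have cons: "boundary_path (path_cons e q)" if "boundary_path q" "e \<in> fib (snd (q 0))" for e q
    unfolding boundary_path_def
  proof
    fix k
    show "snd (path_cons e q k) \<in> V \<and> (case fst (path_cons e q k) of None \<Rightarrow> snd (path_cons e q k) \<notin> rng E ` Ed
      | Some e' \<Rightarrow> e' \<in> Ed \<and> rng E e' = snd (path_cons e q k) \<and> src E e' = snd (path_cons e q (Suc k)))"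
    proof (cases k)
      case 0
      then show ?thesis using that(2) by (auto simp: path_cons_def fib_def rng_in)
    next
      case (Suc j)
      then have eq: "path_cons e q k = q j" "path_cons e q (Suc k) = q (Suc j)"
        by (simp_all add: path_cons_def)
      show ?thesis unfolding eq using that(1) unfolding boundary_path_def by blast
    qed
  qed
  have "\<forall>q\<in>path_level p n. boundary_path q" for n
    by (induction n) (auto simp: assms(1) tail cons)
  then show ?thesis using assms(2) by (auto simp: path_orbit_def)
qed

end

context framed_graph
begin

text \<open>Countability lets the orbit be numbered by naturals, with \<open>code\<close> and
  \<open>q\<close> inverse to each other on it. The index type must be \<open>nat\<close> because
  \<open>matrix_code\<close> acts on operators over \<open>nat ell2\<close>.\<close>

lemma path_system_exists:
  assumes "v \<in> V"
  obtains N N1 w ed and par :: "nat \<Rightarrow> nat" and n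
  where "path_system E K u N N1 w ed par" "n \<in> N" "w n = v"
proof -
  obtain p where p: "boundary_path p" "snd (p 0) = v"
    using boundary_path_exists[OF assms] by blast
  define P where "P = path_orbit p"
  define q where "q = from_nat_into P"
  define code where "code = to_nat_on P"
  have code: "q (code x) = x" if "x \<in> P" for x
    using that countable_path_orbit by (simp add: q_def code_def P_def)
  define N where "N = code ` P"
  define N1 where "N1 = {n \<in> N. fst (q n 0) \<noteq> None}"
  define w where "w n = snd (q n 0)" for n
  define ed where "ed n = the (fst (q n 0))" for n
  define par where "par n = code (path_tail (q n))" for n
  have N: "q n \<in> P" "boundary_path (q n)" if "n \<in> N" for n
    using that code boundary_path_orbit[OF p(1)] by (auto simp: N_def P_def)
  have N_eq: "n = m" if "n \<in> N" "m \<in> N" "q n = q m" for n m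
    using that code by (auto simp: N_def)
  have q_par: "q (par n) = path_tail (q n)" if "n \<in> N" for n
    using N(1)[OF that] path_orbit_tail by (simp add: par_def code P_def)
  have start: "q n 0 = (Some (ed n), w n) \<and> ed n \<in> Ed \<and> rng E (ed n) = w n \<and> src E (ed n) = snd (q n 1)"
    if n: "n \<in> N1" for n
  proof -
    obtain e where e: "fst (q n 0) = Some e" using n by (auto simp: N1_def)
    then show ?thesis
      using N(2)[of n] n unfolding boundary_path_def
      by (auto simp: N1_def ed_def w_def prod_eq_iff dest!: spec[of _ 0])
  qed
  have "path_system E K u N N1 w ed par"
  proof
    show "N1 \<subseteq> N" by (auto simp: N1_def)
    show "w n \<in> V" if "n \<in> N" for n
      using N(2)[OF that] by (simp add: w_def boundary_path_def)
    fix n assume n: "n \<in> N1"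
    then have nN: "n \<in> N" by (simp add: N1_def)
    show "ed n \<in> Ed" "rng E (ed n) = w n" using start[OF n] by auto
    show "par n \<in> N" using N(1)[OF nN] path_orbit_tail by (auto simp: par_def N_def P_def)
    show "src E (ed n) = w (par n)"
      using start[OF n] by (simp add: w_def[of "par n"] q_par[OF nN] path_tail_def)
  next
    fix m e assume m: "m \<in> N" and e: "e \<in> fib (w m)"
    have "path_cons e (q m) \<in> P"
      using path_orbit_cons N(1)[OF m] e by (simp add: P_def w_def)
    then have "code (path_cons e (q m)) \<in> N1" "q (code (path_cons e (q m))) = path_cons e (q m)"
      by (auto simp: N1_def N_def code path_cons_simps)
    moreover have "code (q m) = m"
      using N_eq[OF _ m] N(1)[OF m] code by (simp add: N_def)
    ultimately show "\<exists>n\<in>N1. ed n = e \<and> par n = m"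
      by (intro bexI[of _ "code (path_cons e (q m))"]) (auto simp: ed_def par_def path_cons_simps)
  next
    fix n m assume n: "n \<in> N1" and m: "m \<in> N1" and eq: "ed n = ed m" "par n = par m"
    then have N': "n \<in> N" "m \<in> N" by (auto simp: N1_def)
    \<comment> \<open>Entry 0 consists of the first edge and its range, so it is fixed by
      \<open>ed\<close>; all later entries form the tail, which is fixed by
      \<open>par\<close>.\<close>
    have "q n k = q m k" for k
    proof (cases k)
      case 0
      then show ?thesis using start[OF n] start[OF m] eq(1) by metis
    next
      case (Suc j)
      have "path_tail (q n) = path_tail (q m)" using q_par[OF N'(1)] q_par[OF N'(2)] eq(2) by metis
      then show ?thesis using Suc by (metis path_tail_def)
    qed
    then show "n = m" using N_eq[OF N'] by blast
  next
    show "w n \<notin> rng E ` Ed" if "n \<in> N" "n \<notin> N1" for n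
      using N(2)[OF that(1)] that unfolding boundary_path_def
      by (auto simp: N1_def w_def dest!: spec[of _ 0])
  qed
  moreover have "code p \<in> N" "w (code p) = v"
    using path_orbit_refl[of p] p(2) by (auto simp: N_def P_def w_def code)
  ultimately show thesis by (rule that)
qed

end

section \<open>Finite graph algebras\<close>

context framed_graph
begin

text \<open>The universal property maps \<open>\<pi> a\<close> to the code of
  \<open>vertex_op a\<close>, whose diagonal entry at a path with range v is \<open>a v\<close>. A
  separate representation is built for each v.\<close>

lemma vertex_image_injective:
  assumes cp: "cuntz_pimsner A X B \<pi> \<tau>"
    and ab: "a \<in> CV" "b \<in> CV" "\<pi> a = \<pi> b" and v: "v \<in> V"
  shows "a v = b v"
proof -
  obtain N N1 w ed and par :: "nat \<Rightarrow> nat" and n where sys: "path_system E K u N N1 w ed par"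
    and n: "n \<in> N" "w n = v"
    using path_system_exists[OF v] by blast
  interpret path_system E K u N N1 w ed par by (rule sys)
  interpret graph_rep E K u vertex_op edge_op by (rule graph_rep)
  let ?enc = "matrix_code :: _ \<Rightarrow> ('v \<Rightarrow> complex, (nat \<Rightarrow> 'e \<Rightarrow> complex) set) universe"
  have "cstar_algebra (op_cstar ?enc)"
    by (rule op_cstar_algebra[OF inj_matrix_code])
  moreover have "covariant_rep A X (op_cstar ?enc) (\<lambda>a. ?enc (vertex_op a)) (\<lambda>P. ?enc (edge_op (fn P)))"
    by (rule covariant_rep_op_cstar[OF inj_matrix_code])
  ultimately obtain \<psi> where "\<And>a. a \<in> CV \<Longrightarrow> \<psi> (\<pi> a) = ?enc (vertex_op a)"
    using cp unfolding cuntz_pimsner_def by blast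
  then have "?enc (vertex_op a) = ?enc (vertex_op b)"
    using ab by metis
  then have "vertex_op a = vertex_op b"
    using inj_matrix_code vertex_op_ops ab(1,2) by (meson inj_onD)
  then have "ell2_nth (vertex_op a (ell2_basis n)) n = ell2_nth (vertex_op b (ell2_basis n)) n" by simp
  then show ?thesis using n ab by (simp add: vertex_op_nth ell2_basis_nth)
qed

end

context compact_tgraph
begin

lemma fib_nonempty: "v \<in> V \<Longrightarrow> fib v \<noteq> {}"
  using no_sinks by (auto simp: fib_def)

lemma unit_vector_exists:
  obtains \<xi> where "\<xi> \<in> CE" "\<And>e. e \<in> Ed \<Longrightarrow> \<xi> e \<noteq> 0" "\<And>v. v \<in> V \<Longrightarrow> edge_inner E \<xi> \<xi> v = 1"
proof -
  define I where "I e = (if e \<in> Ed then 1 else 0 :: complex)" for e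
  have "continuous_map (edges E) euclidean I"
    by (rule continuous_map_eq[where f = "\<lambda>_. 1"]) (simp_all add: I_def)
  then have I: "I \<in> CE" by (simp add: CE_iff I_def)
  have card: "edge_inner E I I v = of_nat (card (fib v))" if "v \<in> V" for v
    using fib_subset[of v] by (simp add: edge_inner_eq[OF that] I_def subset_iff)
  have card_pos: "card (fib v) > 0" if "v \<in> V" for v
    using fib_nonempty[OF that] finite_fib by (simp add: card_gt_0_iff)
  \<comment> \<open>The inner product of the constant function 1 with itself counts the edges of a
    fibre, so the count is continuous; it is positive since there are no sinks. Dividing by its
    square root gives inner product 1.\<close>
  define \<xi> where "\<xi> e = (if e \<in> Ed then complex_of_real (1 / sqrt (Re (edge_inner E I I (src E e)))) else 0)" for e
  have "continuous_map (edges E) euclidean (\<lambda>e. complex_of_real (1 / sqrt (Re (edge_inner E I I (src E e)))))"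
    unfolding continuous_map_euclidean_iff
  proof
    fix e assume e: "e \<in> Ed"
    have "((\<lambda>e. edge_inner E I I (src E e)) \<longlongrightarrow> edge_inner E I I (src E e)) (atin (edges E) e)"
      using continuous_map_src[OF edge_inner_CV[OF I I]] e by (simp add: continuous_map_euclidean_iff)
    then show "((\<lambda>e. complex_of_real (1 / sqrt (Re (edge_inner E I I (src E e))))) \<longlongrightarrow>
        complex_of_real (1 / sqrt (Re (edge_inner E I I (src E e))))) (atin (edges E) e)"
      using card_pos[OF src_in[OF e]] by (intro tendsto_intros) (auto simp: card src_in e)
  qed
  then have "continuous_map (edges E) euclidean \<xi>"
    by (rule continuous_map_eq) (simp add: \<xi>_def)
  then have "\<xi> \<in> CE" by (simp add: CE_iff \<xi>_def)
  moreover have \<xi>: "\<xi> e = complex_of_real (1 / sqrt (card (fib (src E e))))" if "e \<in> Ed" for e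
    using that by (simp add: \<xi>_def card src_in)
  then have "\<xi> e \<noteq> 0" if "e \<in> Ed" for e
    using card_pos[OF src_in[OF that]] that by simp
  moreover have "edge_inner E \<xi> \<xi> v = 1" if v: "v \<in> V" for v
  proof -
    have "cnj (\<xi> e) * \<xi> e = complex_of_real (1 / card (fib v))" if "e \<in> fib v" for e
    proof -
      have "\<xi> e = complex_of_real (1 / sqrt (card (fib v)))"
        using \<xi>[of e] that by (simp add: fib_def)
      then have "cnj (\<xi> e) * \<xi> e =
          complex_of_real (1 / sqrt (card (fib v)) * (1 / sqrt (card (fib v))))"
        by (simp only: complex_cnj_complex_of_real of_real_mult)
      also have "1 / sqrt (card (fib v)) * (1 / sqrt (card (fib v))) = 1 / card (fib v)"
        using card_pos[OF v] by (simp add: field_simps)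
      finally show ?thesis .
    qed
    then have "edge_inner E \<xi> \<xi> v = (\<Sum>e\<in>fib v. complex_of_real (1 / card (fib v)))"
      unfolding edge_inner_eq[OF v] by (intro sum.cong) auto
    then show ?thesis using card_pos[OF v] by simp
  qed
  ultimately show thesis by (rule that)
qed

end

context framed_graph
begin

theorem finite_imp_homeomorphism:
  assumes cp: "cuntz_pimsner A X B \<pi> \<tau>" and fin: "finite_cstar B"
  shows "homeomorphic_map (edges E) (vertices E) (src E) \<and> rng E ` Ed = V"
proof -
  interpret B: cstar_algebra B using cp by (simp add: cuntz_pimsner_def)
  note injective = vertex_image_injective[OF cp]
  have rep: "toeplitz_rep A X B \<pi> \<tau>"
    using cp by (simp add: cuntz_pimsner_def covariant_rep_def)
  have \<pi>_in: "\<pi> a \<in> cs_carrier B" if "a \<in> CV" for a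
    using rep that by (auto simp: toeplitz_rep_def star_hom_def)
  have \<pi>_mult: "\<pi> (\<lambda>v. a v * b v) = cs_mult B (\<pi> a) (\<pi> b)" if "a \<in> CV" "b \<in> CV" for a b
  proof -
    have "\<pi> (cs_mult A a b) = cs_mult B (\<pi> a) (\<pi> b)"
      using rep that unfolding toeplitz_rep_def star_hom_def by blast
    then show ?thesis by (simp add: C0_def)
  qed
  have \<pi>_star: "\<pi> (\<lambda>v. cnj (a v)) = cs_star B (\<pi> a)" if "a \<in> CV" for a
  proof -
    have "\<pi> (cs_star A a) = cs_star B (\<pi> a)"
      using rep that unfolding toeplitz_rep_def star_hom_def by blast
    then show ?thesis by (simp add: C0_def)
  qed
  have \<tau>_in: "\<tau> (cls f) \<in> cs_carrier B" if "f \<in> CE" for f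
    using rep cls_in_carrier[OF that] unfolding toeplitz_rep_def by blast
  have \<tau>_left: "\<tau> (cls (\<lambda>e. a (rng E e) * f e)) = cs_mult B (\<pi> a) (\<tau> (cls f))"
    if "a \<in> CV" "f \<in> CE" for a f
  proof -
    have "\<tau> (co_lact X a (cls f)) = cs_mult B (\<pi> a) (\<tau> (cls f))"
      using rep that(1) cls_in_carrier[OF that(2)] unfolding toeplitz_rep_def by blast
    then show ?thesis by (simp add: graph_corr_lact that)
  qed
  have \<tau>_inner: "cs_mult B (cs_star B (\<tau> (cls f))) (\<tau> (cls g)) = \<pi> (edge_inner E f g)"
    if "f \<in> CE" "g \<in> CE" for f g
  proof -
    have "cs_mult B (cs_star B (\<tau> (cls f))) (\<tau> (cls g)) = \<pi> (co_inner X (cls f) (cls g))"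
      using rep that[THEN cls_in_carrier] unfolding toeplitz_rep_def by blast
    then show ?thesis by (simp add: graph_corr_inner that)
  qed
  note B_in = \<pi>_in \<tau>_in B.closed edge_inner_CV

  define I where "I v = (if v \<in> V then 1 else 0 :: complex)" for v
  have "continuous_map (vertices E) euclidean I"
    by (rule continuous_map_eq[where f = "\<lambda>_. 1"]) (simp_all add: I_def)
  then have I: "I \<in> CV" by (simp add: CV_iff I_def)
  have I_mult: "(\<lambda>v. I v * a v) = a" "(\<lambda>v. a v * I v) = a" if "a \<in> CV" for a
    using that by (auto simp: I_def CV_iff)
  have I_left: "(\<lambda>e. I (rng E e) * f e) = f" if "f \<in> CE" for f
  proof
    show "I (rng E e) * f e = f e" for e
      using CE_off[OF that, of e] rng_in[of e] by (cases "e \<in> Ed") (simp_all add: I_def)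
  qed
  have I_star: "cs_star B (\<pi> I) = \<pi> I"
  proof -
    have "(\<lambda>v. cnj (I v)) = I" by (auto simp: I_def)
    then show ?thesis using \<pi>_star[OF I] by simp
  qed
  have unit: "cs_one B = \<pi> I" "\<And>x. x \<in> cs_carrier B \<Longrightarrow> cs_mult B (\<pi> I) x = x"
    "\<And>x. x \<in> cs_carrier B \<Longrightarrow> cs_mult B x (\<pi> I) = x"
  proof (atomize (full), intro conjI allI impI)
    have gen: "cs_carrier B = generated_cstar B (\<pi> ` CV \<union> \<tau> ` co_carrier X)"
      using cp by (simp add: cuntz_pimsner_def)
    have sub: "\<pi> ` CV \<union> \<tau> ` co_carrier X \<subseteq> cs_carrier B"
      by (auto simp: carrier_graph_corr \<pi>_in \<tau>_in)
    have left: "cs_mult B (\<pi> I) x = x" if "x \<in> \<pi> ` CV \<union> \<tau> ` co_carrier X" for x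
      using that by (auto simp: carrier_graph_corr I I_mult I_left simp flip: \<pi>_mult \<tau>_left)
    have right: "cs_mult B x (\<pi> I) = x" if "x \<in> \<pi> ` CV \<union> \<tau> ` co_carrier X" for x
      using that
    proof
      assume "x \<in> \<pi> ` CV"
      then show ?thesis by (auto simp: I I_mult simp flip: \<pi>_mult)
    next
      \<comment> \<open>The relations of a Toeplitz representation contain no rule for the right
        action. The right unit is therefore derived from \<open>\<tau>_inner\<close>, which places
        the square of \<open>\<tau> (cls f)\<close> in the image of \<open>\<pi>\<close>.\<close>
      assume "x \<in> \<tau> ` co_carrier X"
      then obtain f where f: "f \<in> CE" "x = \<tau> (cls f)" by (auto simp: carrier_graph_corr)
      show ?thesis
        by (rule B.right_unit_from_square)
           (simp_all add: f B_in I I_star \<tau>_inner I_mult flip: \<pi>_mult)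
    qed
    note one = B.cs_one_eqI[OF gen sub \<pi>_in[OF I] I_star]
    show "cs_one B = \<pi> I" by (rule one(1)) (use left right in blast)+
    show "cs_mult B (\<pi> I) x = x" if "x \<in> cs_carrier B" for x by (rule one(2)) (use left right that in blast)+
    show "cs_mult B x (\<pi> I) = x" if "x \<in> cs_carrier B" for x by (rule one(3)) (use left right that in blast)+
  qed

  obtain \<xi> where \<xi>: "\<xi> \<in> CE" "\<And>e. e \<in> Ed \<Longrightarrow> \<xi> e \<noteq> 0" "\<And>v. v \<in> V \<Longrightarrow> edge_inner E \<xi> \<xi> v = 1"
    by (rule unit_vector_exists) blast
  define S where "S = \<tau> (cls \<xi>)"
  have S: "S \<in> cs_carrier B" by (simp add: S_def \<tau>_in \<xi>)
  have "edge_inner E \<xi> \<xi> = I"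
    using \<xi>(3) by (auto simp: I_def edge_inner_off)
  then have "cs_mult B (cs_star B S) S = cs_one B"
    using unit(1) by (simp add: S_def \<tau>_inner \<xi>(1))
  then have SS: "cs_mult B S (cs_star B S) = \<pi> I"
    using fin S unit(1) unfolding finite_cstar_def by simp

  have inner_factor: "edge_inner E f g v = edge_inner E f \<xi> v * edge_inner E \<xi> g v"
    if fg: "f \<in> CE" "g \<in> CE" and v: "v \<in> V" for f g v
  proof (rule injective[OF _ _ _ v])
    have "\<pi> (edge_inner E f g) = cs_mult B (cs_star B (\<tau> (cls f))) (cs_mult B (\<pi> I) (\<tau> (cls g)))"
      using fg by (simp add: unit(2) B_in \<tau>_inner)
    also have "\<dots> = cs_mult B (cs_mult B (cs_star B (\<tau> (cls f))) S) (cs_mult B (cs_star B S) (\<tau> (cls g)))"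
      using fg S by (simp add: SS[symmetric] B_in B.mult_assoc)
    also have "\<dots> = \<pi> (\<lambda>v. edge_inner E f \<xi> v * edge_inner E \<xi> g v)"
      using fg \<xi>(1) by (simp add: S_def \<tau>_inner \<pi>_mult edge_inner_CV)
    finally show "\<pi> (edge_inner E f g) = \<pi> (\<lambda>v. edge_inner E f \<xi> v * edge_inner E \<xi> g v)" .
    show "(\<lambda>v. edge_inner E f \<xi> v * edge_inner E \<xi> g v) \<in> CV"
      using edge_inner_CV[OF fg(1) \<xi>(1)] edge_inner_CV[OF \<xi>(1) fg(2)]
      by (auto simp: CV_iff continuous_map_euclidean_iff intro!: tendsto_intros)
  qed (use fg in \<open>simp add: edge_inner_CV\<close>)
  have "inj_on (src E) Ed"
  proof (rule inj_onI, rule ccontr)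
    fix e e' assume e: "e \<in> Ed" "e' \<in> Ed" "src E e = src E e'" "e \<noteq> e'"
    have fib: "e \<in> fib (src E e)" "e' \<in> fib (src E e)" using e by (auto simp: fib_def)
    obtain f where f: "f \<in> CE" "f e = 1" "\<And>x. x \<in> fib (src E e) \<Longrightarrow> x \<noteq> e \<Longrightarrow> f x = 0"
      using CE_bump_on_fibre[OF e(1)] by blast
    obtain g where g: "g \<in> CE" "g e' = 1" "\<And>x. x \<in> fib (src E e) \<Longrightarrow> x \<noteq> e' \<Longrightarrow> g x = 0"
      using CE_bump_on_fibre[OF e(2)] e(3) by metis
    have "edge_inner E f \<xi> (src E e) = (\<Sum>x\<in>{e}. cnj (f x) * \<xi> x)"
      unfolding edge_inner_src[OF e(1)]
      by (rule sum.mono_neutral_right) (use finite_fib fib f(3) in auto)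
    moreover have "edge_inner E \<xi> g (src E e) = (\<Sum>x\<in>{e'}. cnj (\<xi> x) * g x)"
      unfolding edge_inner_src[OF e(1)]
      by (rule sum.mono_neutral_right) (use finite_fib fib g(3) in auto)
    moreover have "cnj (f x) * g x = 0" if "x \<in> fib (src E e)" for x
      using f(3)[OF that] g(3)[OF that] e(4) by (cases "x = e") auto
    then have "edge_inner E f g (src E e) = 0"
      unfolding edge_inner_src[OF e(1)] by (intro sum.neutral) blast
    \<comment> \<open>On this fibre \<open>f\<close> lives at \<open>e\<close> alone and
      \<open>g\<close> at \<open>e'\<close> alone: the left side of the factorisation is 0, while
      the right side is \<open>\<xi> e * cnj (\<xi> e')\<close>, a product of nonzero
      numbers.\<close>
    ultimately show False
      using inner_factor[OF f(1) g(1) src_in[OF e(1)]] f(2) g(2) \<xi>(2) e by simp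
  qed
  moreover have "src E ` Ed = V" using src_in no_sinks by fastforce
  moreover have "closed_map (edges E) (vertices E) (src E)"
    by (simp add: closed_map_def src_closed_map)
  ultimately have "homeomorphic_map (edges E) (vertices E) (src E)"
    using src_continuous bijective_closed_imp_homeomorphic_map by blast
  moreover have "v \<in> rng E ` Ed" if v: "v \<in> V" for v
  proof (rule ccontr)
    assume "v \<notin> rng E ` Ed"
    then obtain b where b: "b \<in> CV" "b v = 1" "\<And>e. e \<in> Ed \<Longrightarrow> b (rng E e) = 0"
      using CV_bump_off_range[OF v] by blast
    have z: "(\<lambda>_. 0) \<in> CV" by (simp add: CV_iff)
    have "(\<lambda>e. b (rng E e) * \<xi> e) = (\<lambda>e. 0 * \<xi> e)"
    proof
      show "b (rng E e) * \<xi> e = 0 * \<xi> e" for e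
        using b(3)[of e] CE_off[OF \<xi>(1), of e] by (cases "e \<in> Ed") auto
    qed
    then have "cs_mult B (\<pi> b) S = cs_mult B (\<pi> (\<lambda>_. 0)) S"
      using \<tau>_left[OF b(1) \<xi>(1)] \<tau>_left[OF z \<xi>(1)] by (simp add: S_def)
    \<comment> \<open>As \<open>S\<close> has the right inverse \<open>cs_star B S\<close>, the
      product of \<open>\<pi> a\<close> with \<open>S\<close> determines \<open>\<pi> a\<close>;
      this is applied to \<open>b\<close> and to the zero function.\<close>
    moreover have "\<pi> a = cs_mult B (cs_mult B (\<pi> a) S) (cs_star B S)" if "a \<in> CV" for a
      using that S by (simp add: B.mult_assoc B_in SS unit(3))
    ultimately have "\<pi> b = \<pi> (\<lambda>_. 0)" using b(1) z by metis
    then have "b v = 0" by (rule injective[OF b(1) z _ v])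
    then show False using b(2) by simp
  qed
  ultimately show ?thesis using rng_in by blast
qed

end

theorem theorem6p1:
  fixes E :: "('v, 'e) topgraph"
    and B :: "'b cstar"
    and \<pi> :: "('v \<Rightarrow> complex) \<Rightarrow> 'b"
    and \<tau> :: "(nat \<Rightarrow> 'e \<Rightarrow> complex) set \<Rightarrow> 'b"
  assumes "topological_graph E"
    and "compact_graph E"
    and "\<nexists>v. sink E v"
    and "graph_cstar E B \<pi> \<tau>"
    and "finite_cstar B"
  shows "homeomorphic_map (edges E) (vertices E) (src E) \<and>
         rng E ` topspace (edges E) = topspace (vertices E)"
proof -
  interpret topological_graph E by fact
  interpret compact_tgraph E
    using assms(2,3) by unfold_locales (auto simp: compact_graph_def sink_def)
  obtain K :: "'e set" and u :: "'e \<Rightarrow> 'e \<Rightarrow> complex" where "finite K" "\<And>k. k \<in> K \<Longrightarrow> u k \<in> CE"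
    "\<And>e. e \<in> Ed \<Longrightarrow> (\<Sum>k\<in>K. u k e * cnj (u k e)) = 1"
    "\<And>k e e'. k \<in> K \<Longrightarrow> e \<in> Ed \<Longrightarrow> e' \<in> Ed \<Longrightarrow> src E e = src E e' \<Longrightarrow> e \<noteq> e' \<Longrightarrow> u k e = 0 \<or> u k e' = 0"
    by (rule frame_exists) blast
  then interpret framed_graph E K u
    by unfold_locales
  show ?thesis
    using assms(4,5) finite_imp_homeomorphism unfolding graph_cstar_def by blast
qed

end
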